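(* Suppose $P_{\mathrm{RCW}}$ and $P_{\mathrm{DCW}}$ have positive $L^2(\Pi)$ spectral gaps $\eta_{\mathrm{RCW}}=1-\|P_{\mathrm{RCW}}-\Pi\|>0$ and $\eta_{\mathrm{DCW}}=1-\|P_{\mathrm{DCW}}-\Pi\|>0$, respectively. Let $(X_n)_{n\ge0}$ be the Markov chain with transition kernel $(P_{\mathrm{RCW}})^d$ and $(Y_n)_{n\ge0}$ the Markov chain with transition kernel $P_{\mathrm{DCW}}$, both started from $\Pi$. Then, for every $f\in L^2(\Pi)$ with $\Pi f=0$, there exist finite asymptotic variances $\sigma^2_{\mathrm{RCW}^d}(f)$ and $\sigma^2_{\mathrm{DCW}}(f)$ such that, as $n\to\infty$, $$\frac1{\sqrt n}\sum_{k=0}^{n-1}f(X_k)\xrightarrow{d}\mathcal N\bigl(0,\sigma^2_{\mathrm{RCW}^d}(f)\bigr)\qquad\text{and}\qquad \frac1{\sqrt n}\sum_{k=0}^{n-1}f(Y_k)\xrightarrow{d}\mathcal N\bigl(0,\sigma^2_{\mathrm{DCW}}(f)\bigr).$$ Moreover, $$\left|\sigma^2_{\mathrm{DCW}}(f)-\sigma^2_{\mathrm{RCW}^d}(f)\right|\le\frac{4}{\eta_{\mathrm{RCW}}\,\eta_{\mathrm{DCW}}}\,\|f\|_\Pi^2.$$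
   Context: Let $[d]=\{1,\dots,d\}$. Let $(\mathcal X_j,\mathcal B_j)$, $j\in[d]$, be Polish measurable spaces, $\mathcal X=\prod_{j=1}^d\mathcal X_j$ with product $\sigma$-algebra, and $\Pi$ a probability measure on $\mathcal X$. Write $x=(x_1,\dots,x_d)$ and $x_{-j}=(x_i)_{i\ne j}$. Let $\Pi_j(\mathrm dx_j\mid x_{-j})$ be a (regular) conditional distribution of $x_j$ given $x_{-j}$ under $\Pi$. $L^2(\Pi)$ has inner product $\langle f,g\rangle_\Pi=\int fg\,\mathrm d\Pi$ and norm $\|\cdot\|_\Pi$; $\|\cdot\|$ denotes the operator norm on $L^2(\Pi)$; $\Pi$ also denotes the operator sending $f$ to the constant function $\int f\,\mathrm d\Pi$. A Markov kernel $K$ acts by $(Kf)(x)=\int f(y)K(x,\mathrm dy)$. Component-wise update: for each $j$ and $x_{-j}$, $K_{j,x_{-j}}$ is a Markov kernel on $\mathcal X_j$ reversible with respect to $\Pi_j(\cdot\mid x_{-j})$, with $(x_j,x_{-j})\mapsto K_{j,x_{-j}}(x_j,A_j)$ measurable for each $A_j\in\mathcal B_j$, and $(K_jf)(x_j,x_{-j})=\int f(y_j,x_{-j})\,K_{j,x_{-j}}(x_j,\mathrm dy_j)$. Random-scan and deterministic-scan component-wise kernels: $P_{\mathrm{RCW}}=\frac1d\sum_{j=1}^dK_j$ and $P_{\mathrm{DCW}}=K_d\cdots K_1$. $\mathcal N(0,0)$ is understood as the point mass at $0$. *)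

theory Defs
  imports "HOL-Probability.Probability"
begin

section \<open>Spaces and kernels\<close>

text \<open>The topology is carried by the set \<open>space M\<close>, not by the type, so that coordinate spaces
  of different nature can share one ambient type.\<close>

definition polish_measurable :: "'a measure \<Rightarrow> bool" where
  "polish_measurable M \<longleftrightarrow>
     (\<exists>T. completely_metrizable_space T \<and> second_countable T \<and> topspace T = space M \<and>
          sets M = sigma_sets (topspace T) {U. openin T U})"

definition markov_kernel :: "'a measure \<Rightarrow> ('a \<Rightarrow> 'a measure) \<Rightarrow> bool" where
  "markov_kernel M P \<longleftrightarrow> P \<in> measurable M (prob_algebra M)"

definition reversible :: "'a measure \<Rightarrow> ('a \<Rightarrow> 'a measure) \<Rightarrow> bool" where
  "reversible \<mu> P \<longleftrightarrow>
     (\<forall>A\<in>sets \<mu>. \<forall>B\<in>sets \<mu>. (\<integral>\<^sup>+x\<in>A. emeasure (P x) B \<partial>\<mu>) = (\<integral>\<^sup>+x\<in>B. emeasure (P x) A \<partial>\<mu>))"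

definition kernel_op :: "('a \<Rightarrow> 'a measure) \<Rightarrow> ('a \<Rightarrow> real) \<Rightarrow> 'a \<Rightarrow> real" where
  "kernel_op P f x = (\<integral>y. f y \<partial>P x)"

text \<open>\<open>kernel_comp P Q\<close> is the kernel of the operator product \<open>P Q\<close>: a step of \<open>P\<close> comes first,
  \<open>(P Q)(x, A) = \<integral> Q(y, A) P(x, dy)\<close>.\<close>

definition kernel_comp ::
  "('a \<Rightarrow> 'a measure) \<Rightarrow> ('a \<Rightarrow> 'a measure) \<Rightarrow> 'a \<Rightarrow> 'a measure" where
  "kernel_comp P Q x = P x \<bind> Q"

primrec kernel_power :: "'a measure \<Rightarrow> ('a \<Rightarrow> 'a measure) \<Rightarrow> nat \<Rightarrow> 'a \<Rightarrow> 'a measure" where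
  "kernel_power M P 0 = return M"
| "kernel_power M P (Suc n) = kernel_comp P (kernel_power M P n)"


section \<open>Component-wise kernels on the product space\<close>

text \<open>Points of the product are extensional functions on \<open>{1..d}\<close>; \<open>drop_coord d j x\<close> is \<open>x\<^sub>-\<^sub>j\<close>.\<close>

abbreviation prod_space :: "nat \<Rightarrow> (nat \<Rightarrow> 'a measure) \<Rightarrow> (nat \<Rightarrow> 'a) measure" where
  "prod_space d M \<equiv> PiM {1..d} M"

abbreviation prod_space_without ::
  "nat \<Rightarrow> nat \<Rightarrow> (nat \<Rightarrow> 'a measure) \<Rightarrow> (nat \<Rightarrow> 'a) measure" where
  "prod_space_without d j M \<equiv> PiM ({1..d} - {j}) M"

abbreviation drop_coord :: "nat \<Rightarrow> nat \<Rightarrow> (nat \<Rightarrow> 'a) \<Rightarrow> nat \<Rightarrow> 'a" where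
  "drop_coord d j x \<equiv> restrict x ({1..d} - {j})"

definition conditional_distribution ::
  "nat \<Rightarrow> (nat \<Rightarrow> 'a measure) \<Rightarrow> (nat \<Rightarrow> 'a) measure \<Rightarrow> nat \<Rightarrow> ((nat \<Rightarrow> 'a) \<Rightarrow> 'a measure) \<Rightarrow> bool" where
  "conditional_distribution d M \<pi> j \<kappa> \<longleftrightarrow>
     \<kappa> \<in> measurable (prod_space_without d j M) (prob_algebra (M j)) \<and>
     (\<forall>A\<in>sets (prod_space_without d j M). \<forall>B\<in>sets (M j).
        emeasure \<pi> {x \<in> space \<pi>. drop_coord d j x \<in> A \<and> x j \<in> B} =
        (\<integral>\<^sup>+x. indicator A (drop_coord d j x) * emeasure (\<kappa> (drop_coord d j x)) B \<partial>\<pi>))"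

text \<open>\<open>K j z\<close> is the Markov kernel on the \<open>j\<close>-th space used when the other coordinates are \<open>z\<close>, and
  \<open>\<kappa> j z\<close> the conditional distribution it is reversible for.\<close>

definition componentwise_update ::
  "nat \<Rightarrow> (nat \<Rightarrow> 'a measure) \<Rightarrow> (nat \<Rightarrow> (nat \<Rightarrow> 'a) \<Rightarrow> 'a measure) \<Rightarrow>
   (nat \<Rightarrow> (nat \<Rightarrow> 'a) \<Rightarrow> 'a \<Rightarrow> 'a measure) \<Rightarrow> bool" where
  "componentwise_update d M \<kappa> K \<longleftrightarrow>
     (\<forall>j\<in>{1..d}.
        (\<forall>z\<in>space (prod_space_without d j M).
            markov_kernel (M j) (K j z) \<and> reversible (\<kappa> j z) (K j z)) \<and>
        (\<forall>A\<in>sets (M j).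
            (\<lambda>x. emeasure (K j (drop_coord d j x) (x j)) A) \<in> borel_measurable (prod_space d M)))"

definition cw_kernel ::
  "nat \<Rightarrow> (nat \<Rightarrow> 'a measure) \<Rightarrow> (nat \<Rightarrow> (nat \<Rightarrow> 'a) \<Rightarrow> 'a \<Rightarrow> 'a measure) \<Rightarrow>
   nat \<Rightarrow> (nat \<Rightarrow> 'a) \<Rightarrow> (nat \<Rightarrow> 'a) measure" where
  "cw_kernel d M K j x = distr (K j (drop_coord d j x) (x j)) (prod_space d M) (\<lambda>y. x(j := y))"

definition RCW ::
  "nat \<Rightarrow> (nat \<Rightarrow> 'a measure) \<Rightarrow> (nat \<Rightarrow> (nat \<Rightarrow> 'a) \<Rightarrow> 'a \<Rightarrow> 'a measure) \<Rightarrow>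
   (nat \<Rightarrow> 'a) \<Rightarrow> (nat \<Rightarrow> 'a) measure" where
  "RCW d M K x = measure_of (space (prod_space d M)) (sets (prod_space d M))
     (\<lambda>A. (\<Sum>j\<in>{1..d}. emeasure (cw_kernel d M K j x) A) / of_nat d)"

text \<open>\<open>DCW_upto d M K m\<close> is the product \<open>K\<^sub>m \<dots> K\<^sub>1\<close>.\<close>

primrec DCW_upto ::
  "nat \<Rightarrow> (nat \<Rightarrow> 'a measure) \<Rightarrow> (nat \<Rightarrow> (nat \<Rightarrow> 'a) \<Rightarrow> 'a \<Rightarrow> 'a measure) \<Rightarrow>
   nat \<Rightarrow> (nat \<Rightarrow> 'a) \<Rightarrow> (nat \<Rightarrow> 'a) measure" where
  "DCW_upto d M K 0 = return (prod_space d M)"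
| "DCW_upto d M K (Suc m) = kernel_comp (cw_kernel d M K (Suc m)) (DCW_upto d M K m)"

definition DCW ::
  "nat \<Rightarrow> (nat \<Rightarrow> 'a measure) \<Rightarrow> (nat \<Rightarrow> (nat \<Rightarrow> 'a) \<Rightarrow> 'a \<Rightarrow> 'a measure) \<Rightarrow>
   (nat \<Rightarrow> 'a) \<Rightarrow> (nat \<Rightarrow> 'a) measure" where
  "DCW d M K = DCW_upto d M K d"


section \<open>Square-integrable functions and spectral gaps\<close>

text \<open>Elements of \<open>L\<^sup>2\<close> are represented by functions, without passing to the quotient by almost-sure
  equality.\<close>

definition L2 :: "'a measure \<Rightarrow> ('a \<Rightarrow> real) set" where
  "L2 \<mu> = {f \<in> borel_measurable \<mu>. integrable \<mu> (\<lambda>x. (f x)\<^sup>2)}"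

definition L2_norm :: "'a measure \<Rightarrow> ('a \<Rightarrow> real) \<Rightarrow> real" where
  "L2_norm \<mu> f = sqrt (\<integral>x. (f x)\<^sup>2 \<partial>\<mu>)"

text \<open>The supremum is taken in the reals, hence meaningful only for operators bounded on \<open>L2 \<mu>\<close>.\<close>

definition L2_opnorm :: "'a measure \<Rightarrow> (('a \<Rightarrow> real) \<Rightarrow> ('a \<Rightarrow> real)) \<Rightarrow> real" where
  "L2_opnorm \<mu> T = (SUP f\<in>{f \<in> L2 \<mu>. L2_norm \<mu> f \<le> 1}. L2_norm \<mu> (T f))"

definition spectral_gap :: "'a measure \<Rightarrow> ('a \<Rightarrow> 'a measure) \<Rightarrow> real" where
  "spectral_gap \<mu> P = 1 - L2_opnorm \<mu> (\<lambda>f x. kernel_op P f x - (\<integral>y. f y \<partial>\<mu>))"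


section \<open>Markov chains and Gaussian limits\<close>

definition history :: "'w measure \<Rightarrow> 'a measure \<Rightarrow> (nat \<Rightarrow> 'w \<Rightarrow> 'a) \<Rightarrow> nat \<Rightarrow> 'w measure" where
  "history \<Omega> S X n = sigma (space \<Omega>) (\<Union>i\<in>{..n}. {X i -` A \<inter> space \<Omega> |A. A \<in> sets S})"

definition markov_chain ::
  "'w measure \<Rightarrow> 'a measure \<Rightarrow> 'a measure \<Rightarrow> ('a \<Rightarrow> 'a measure) \<Rightarrow> (nat \<Rightarrow> 'w \<Rightarrow> 'a) \<Rightarrow> bool" where
  "markov_chain \<Omega> S \<mu> P X \<longleftrightarrow>
     prob_space \<Omega> \<and> (\<forall>n. X n \<in> measurable \<Omega> S) \<and> distr \<Omega> S (X 0) = \<mu> \<and>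
     (\<forall>n. \<forall>A\<in>sets S. AE \<omega> in \<Omega>.
        real_cond_exp \<Omega> (history \<Omega> S X n) (indicator (X (Suc n) -` A \<inter> space \<Omega>)) \<omega> =
        measure (P (X n \<omega>)) A)"

definition centered_normal :: "real \<Rightarrow> real measure" where
  "centered_normal v = (if v = 0 then return borel 0 else density lborel (normal_density 0 (sqrt v)))"

definition scaled_sum_law ::
  "'w measure \<Rightarrow> (nat \<Rightarrow> 'w \<Rightarrow> 'a) \<Rightarrow> ('a \<Rightarrow> real) \<Rightarrow> nat \<Rightarrow> real measure" where
  "scaled_sum_law \<Omega> X f n = distr \<Omega> borel (\<lambda>\<omega>. (\<Sum>k<n. f (X k \<omega>)) / sqrt (real n))"

end

theory Submission
  imports Defs
begin

text \<open>
  A kernel with a spectral gap \<open>\<eta>\<close> whose invariant law is \<open>\<pi>\<close> contracts mean-zero functions in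
  \<open>L\<^sup>2\<close> by the factor \<open>\<rho> = 1 - \<eta> < 1\<close> (\<open>spectral_gap_contracting\<close>), and so do its powers
  (\<open>contracting_kernel_power\<close>). Both the limit theorem and the variance bound follow from this
  contraction for a single kernel \<open>P\<close>, applied once to the random-scan power and once to the
  deterministic scan.

  \<^emph>\<open>Variances.\<close> The asymptotic variance is \<open>\<sigma>\<^sup>2(f) = 2 (\<Sum>k. \<langle>f, P\<^sup>k f\<rangle>) - \<parallel>f\<parallel>\<^sup>2\<close>. For the difference of
  two kernels the term \<open>\<parallel>f\<parallel>\<^sup>2\<close> cancels, and each series is at most \<open>\<parallel>f\<parallel>\<^sup>2 / \<eta>\<close> in absolute value by the
  contraction. Hence the difference is at most
  \<open>2 (1/\<eta> + 1/\<eta>') \<parallel>f\<parallel>\<^sup>2 = 2 (\<eta> + \<eta>') \<parallel>f\<parallel>\<^sup>2 / (\<eta> \<eta>')\<close>, and both gaps are at most \<open>1\<close>.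

  \<^emph>\<open>Central limit theorem\<close> (\<open>chain_central_limit_theorem\<close>). With \<open>g = \<Sum>k<N. P\<^sup>k f\<close> one has
  \<open>f = g - P g + P\<^sup>N f\<close>, so the sum of the \<open>f (X\<^sub>k)\<close> is the sum of the martingale increments
  \<open>g (X\<^sub>k\<^sub>+\<^sub>1) - (P g) (X\<^sub>k)\<close>, plus two boundary terms, plus the sum of the \<open>(P\<^sup>N f) (X\<^sub>k)\<close>. After division
  by \<open>sqrt n\<close> the last sum has \<open>L\<^sup>2\<close> norm of order \<open>\<rho>\<^sup>N\<close>, uniformly in \<open>n\<close>. Working with finite \<open>N\<close>
  instead of the full Neumann series avoids any appeal to completeness of \<open>L\<^sup>2\<close>.

  For the martingale part (\<open>phase_tendsto\<close>), let \<open>\<theta> = t / sqrt n\<close> and let \<open>\<psi>\<^sub>k\<close> be the characteristic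
  function of the first \<open>k\<close> increments at \<open>\<theta>\<close>. A second-order Taylor expansion, conditioned on the past,
  gives \<open>\<psi>\<^sub>k\<^sub>+\<^sub>1 \<approx> (1 - \<theta>\<^sup>2 v / 2) \<psi>\<^sub>k\<close>, where \<open>v\<close> is the mean of the conditional variance \<open>V (X\<^sub>k)\<close>. The
  replacement of \<open>V (X\<^sub>k)\<close> by \<open>v\<close> is justified by mixing: the exponential \<open>Z\<^sub>k = exp (\<i> \<theta> S\<^sub>k)\<close> hardly
  differs from \<open>Z\<^sub>k\<^sub>-\<^sub>m\<close>, as \<open>\<theta>\<close> is small, whereas the conditional mean of
  \<open>V (X\<^sub>k) - v\<close> given the past up to \<open>k - m\<close> is small by contraction, once \<open>V\<close> is truncated. Iterating \<open>n\<close> times gives the limit \<open>exp (- t\<^sup>2 v / 2)\<close>; finally \<open>v \<rightarrow> \<sigma>\<^sup>2(f)\<close> as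
  \<open>N \<rightarrow> \<infinity>\<close>, and Levy's continuity theorem concludes.

  \<^emph>\<open>Invariance.\<close> A component update preserves \<open>\<pi>\<close> because \<open>\<pi>\<close> disintegrates into the conditional laws of
  one coordinate given the others, and a reversible kernel preserves its reference law
  (\<open>cw_kernel_invariant\<close>); mixtures and products of such kernels then preserve \<open>\<pi>\<close> as well.
\<close>

section \<open>Square-integrable functions\<close>

lemma L2_measurable [measurable_dest]: "f \<in> L2 \<mu> \<Longrightarrow> f \<in> borel_measurable \<mu>"
  by (simp add: L2_def)

lemma L2_square_integrable: "f \<in> L2 \<mu> \<Longrightarrow> integrable \<mu> (\<lambda>x. (f x)\<^sup>2)"
  by (simp add: L2_def)

lemma L2I: "f \<in> borel_measurable \<mu> \<Longrightarrow> integrable \<mu> (\<lambda>x. (f x)\<^sup>2) \<Longrightarrow> f \<in> L2 \<mu>"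
  by (simp add: L2_def)

lemma L2_mult_integrable:
  assumes "f \<in> L2 \<mu>" "g \<in> L2 \<mu>"
  shows "integrable \<mu> (\<lambda>x. f x * g x)"
proof (rule Bochner_Integration.integrable_bound)
  show "integrable \<mu> (\<lambda>x. (f x)\<^sup>2 + (g x)\<^sup>2)"
    using assms by (auto intro: L2_square_integrable)
  show "(\<lambda>x. f x * g x) \<in> borel_measurable \<mu>"
    using assms by measurable
  have "\<bar>a * b\<bar> \<le> a\<^sup>2 + b\<^sup>2" for a b :: real
    using sum_squares_bound[of a b] sum_squares_bound[of a "-b"]
      zero_le_power2[of a] zero_le_power2[of b]
    by (auto simp: abs_le_iff)
  then show "AE x in \<mu>. norm (f x * g x) \<le> norm ((f x)\<^sup>2 + (g x)\<^sup>2)"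
    by simp
qed

lemma L2_add: "f \<in> L2 \<mu> \<Longrightarrow> g \<in> L2 \<mu> \<Longrightarrow> (\<lambda>x. f x + g x) \<in> L2 \<mu>"
  using L2_mult_integrable[of f \<mu> g]
  by (auto simp: L2_def power2_sum mult.assoc)

lemma L2_cmult: "f \<in> L2 \<mu> \<Longrightarrow> (\<lambda>x. c * f x) \<in> L2 \<mu>"
  by (auto simp: L2_def power_mult_distrib)

lemma L2_diff: "f \<in> L2 \<mu> \<Longrightarrow> g \<in> L2 \<mu> \<Longrightarrow> (\<lambda>x. f x - g x) \<in> L2 \<mu>"
  using L2_add[of f \<mu> "\<lambda>x. -1 * g x"] L2_cmult[of g \<mu> "-1"] by simp

lemma L2_zero: "(\<lambda>x. 0) \<in> L2 \<mu>"
  by (simp add: L2_def)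

lemma L2_sum: "(\<And>i. i \<in> I \<Longrightarrow> f i \<in> L2 \<mu>) \<Longrightarrow> (\<lambda>x. \<Sum>i\<in>I. f i x) \<in> L2 \<mu>"
  by (induction I rule: infinite_finite_induct) (auto intro: L2_zero L2_add)

lemma L2_norm_nonneg: "0 \<le> L2_norm \<mu> f"
  by (simp add: L2_norm_def)

lemma L2_norm_power2: "(L2_norm \<mu> f)\<^sup>2 = (\<integral>x. (f x)\<^sup>2 \<partial>\<mu>)"
  by (simp add: L2_norm_def)

lemma L2_norm_cmult: "L2_norm \<mu> (\<lambda>x. c * f x) = \<bar>c\<bar> * L2_norm \<mu> f"
  by (simp add: L2_norm_def power_mult_distrib real_sqrt_mult)

lemma L2_norm_cong_AE:
  assumes "f \<in> L2 \<mu>" "g \<in> L2 \<mu>" "AE x in \<mu>. f x = g x"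
  shows "L2_norm \<mu> f = L2_norm \<mu> g"
proof -
  have "(\<integral>x. (f x)\<^sup>2 \<partial>\<mu>) = (\<integral>x. (g x)\<^sup>2 \<partial>\<mu>)"
    using assms by (intro integral_cong_AE) auto
  then show ?thesis by (simp add: L2_norm_def)
qed

lemma L2_norm_mono_AE:
  assumes "f \<in> L2 \<mu>" "g \<in> L2 \<mu>" "AE x in \<mu>. \<bar>f x\<bar> \<le> \<bar>g x\<bar>"
  shows "L2_norm \<mu> f \<le> L2_norm \<mu> g"
proof -
  have "(\<integral>x. (f x)\<^sup>2 \<partial>\<mu>) \<le> (\<integral>x. (g x)\<^sup>2 \<partial>\<mu>)"
    using assms by (intro integral_mono_AE L2_square_integrable) (auto simp: abs_le_square_iff)
  then show ?thesis by (simp add: L2_norm_def)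
qed

lemma L2_Cauchy_Schwarz:
  assumes f: "f \<in> L2 \<mu>" and g: "g \<in> L2 \<mu>"
  shows "\<bar>\<integral>x. f x * g x \<partial>\<mu>\<bar> \<le> L2_norm \<mu> f * L2_norm \<mu> g"
proof -
  define A B C where "A = (\<integral>x. (f x)\<^sup>2 \<partial>\<mu>)" and "B = (\<integral>x. (g x)\<^sup>2 \<partial>\<mu>)"
    and "C = (\<integral>x. f x * g x \<partial>\<mu>)"
  have quad: "0 \<le> A * a\<^sup>2 + 2 * C * a * b + B * b\<^sup>2" for a b :: real
  proof -
    have "0 \<le> (\<integral>x. (a * f x + b * g x)\<^sup>2 \<partial>\<mu>)" by simp
    also have "(\<lambda>x. (a * f x + b * g x)\<^sup>2)
        = (\<lambda>x. a\<^sup>2 * (f x)\<^sup>2 + (2 * a * b) * (f x * g x) + b\<^sup>2 * (g x)\<^sup>2)"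
      by (auto simp: power2_eq_square algebra_simps)
    also have "(\<integral>x. a\<^sup>2 * (f x)\<^sup>2 + (2 * a * b) * (f x * g x) + b\<^sup>2 * (g x)\<^sup>2 \<partial>\<mu>)
        = a\<^sup>2 * A + (2 * a * b) * C + b\<^sup>2 * B"
      unfolding A_def B_def C_def
      using L2_square_integrable[OF f] L2_square_integrable[OF g] L2_mult_integrable[OF f g]
      by simp
    finally show ?thesis by (simp add: algebra_simps)
  qed
  have nn: "0 \<le> A" "0 \<le> B" by (auto simp: A_def B_def)
  have "C\<^sup>2 \<le> A * B"
  proof (cases "B = 0")
    case False
    then have "B > 0" using nn by simp
    (* The quadratic form at (B, -C), the residual of f after projection onto g, scaled by B. *)
    have "0 \<le> B * (A * B - C\<^sup>2)"
      using quad[of B "-C"] by (simp add: power2_eq_square algebra_simps)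
    then show ?thesis using \<open>B > 0\<close> by (simp add: zero_le_mult_iff)
  next
    case True
    have "C = 0"
    proof (rule ccontr)
      assume "C \<noteq> 0"
      (* With B = 0 the form is affine in the second coordinate, so it can be made negative. *)
      then have "A + 2 * C * (- (A + 1) / (2 * C)) = -1" by (simp add: field_simps)
      then show False using quad[of 1 "- (A + 1) / (2 * C)"] True by simp
    qed
    then show ?thesis using nn by simp
  qed
  then have "sqrt (C\<^sup>2) \<le> sqrt (A * B)" by (rule real_sqrt_le_mono)
  then show ?thesis by (simp add: A_def B_def C_def L2_norm_def real_sqrt_mult)
qed

lemma L2_norm_triangle:
  assumes f: "f \<in> L2 \<mu>" and g: "g \<in> L2 \<mu>"
  shows "L2_norm \<mu> (\<lambda>x. f x + g x) \<le> L2_norm \<mu> f + L2_norm \<mu> g"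
proof (rule power2_le_imp_le)
  have "(L2_norm \<mu> (\<lambda>x. f x + g x))\<^sup>2
      = (\<integral>x. (f x)\<^sup>2 + 2 * (f x * g x) + (g x)\<^sup>2 \<partial>\<mu>)"
    unfolding L2_norm_power2 by (intro Bochner_Integration.integral_cong) (auto simp: power2_sum)
  also have "\<dots> = (L2_norm \<mu> f)\<^sup>2 + 2 * (\<integral>x. f x * g x \<partial>\<mu>) + (L2_norm \<mu> g)\<^sup>2"
    unfolding L2_norm_power2
    using L2_square_integrable[OF f] L2_square_integrable[OF g] L2_mult_integrable[OF f g] by simp
  also have "\<dots> \<le> (L2_norm \<mu> f + L2_norm \<mu> g)\<^sup>2"
    using L2_Cauchy_Schwarz[OF f g] by (simp add: power2_sum)
  finally show "(L2_norm \<mu> (\<lambda>x. f x + g x))\<^sup>2 \<le> (L2_norm \<mu> f + L2_norm \<mu> g)\<^sup>2" .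
qed (simp add: L2_norm_nonneg)

lemma L2_norm_triangle_diff:
  assumes f: "f \<in> L2 \<mu>" and g: "g \<in> L2 \<mu>"
  shows "L2_norm \<mu> (\<lambda>x. f x - g x) \<le> L2_norm \<mu> f + L2_norm \<mu> g"
  using L2_norm_triangle[OF f L2_cmult[OF g, of "-1"]] L2_norm_cmult[of \<mu> "-1" g] by simp

lemma L2_norm_sum_le:
  assumes "\<And>i. i \<in> I \<Longrightarrow> f i \<in> L2 \<mu>"
  shows "L2_norm \<mu> (\<lambda>x. \<Sum>i\<in>I. f i x) \<le> (\<Sum>i\<in>I. L2_norm \<mu> (f i))"
  using assms
proof (induction I rule: infinite_finite_induct)
  case (insert i I)
  then show ?case
    using L2_norm_triangle[of "f i" \<mu> "\<lambda>x. \<Sum>i\<in>I. f i x"] L2_sum[of I f \<mu>] by fastforce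
qed (auto simp: L2_norm_def)

context prob_space
begin

lemma L2_const: "(\<lambda>x. c) \<in> L2 M"
  by (simp add: L2_def)

lemma L2_integrable: "f \<in> L2 M \<Longrightarrow> integrable M f"
  using L2_mult_integrable[of f M "\<lambda>x. 1"] L2_const[of 1] by simp

lemma L2_bounded: "f \<in> borel_measurable M \<Longrightarrow> (\<And>x. \<bar>f x\<bar> \<le> B) \<Longrightarrow> f \<in> L2 M"
  by (intro L2I integrable_const_bound[where B = "B\<^sup>2"])
     (auto simp: abs_le_square_iff[symmetric] intro: order_trans[OF _ abs_ge_self])

lemma L2_abs: "f \<in> L2 M \<Longrightarrow> (\<lambda>x. \<bar>f x\<bar>) \<in> L2 M"
  by (auto simp: L2_def)

lemma integral_abs_le_L2_norm:
  assumes "f \<in> L2 M"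
  shows "(\<integral>x. \<bar>f x\<bar> \<partial>M) \<le> L2_norm M f"
proof -
  have "L2_norm M (\<lambda>x. 1) = 1"
    by (simp add: L2_norm_def prob_space)
  moreover have "L2_norm M (\<lambda>x. \<bar>f x\<bar>) = L2_norm M f"
    by (simp add: L2_norm_def)
  ultimately show ?thesis
    using L2_Cauchy_Schwarz[OF L2_abs[OF assms] L2_const[of 1]] by simp
qed

lemma abs_integral_le_L2_norm:
  assumes "f \<in> L2 M"
  shows "\<bar>\<integral>x. f x \<partial>M\<bar> \<le> L2_norm M f"
  using integral_abs_le_L2_norm[OF assms] integral_abs_bound[of M f] by linarith

end

section \<open>Markov kernels and integration\<close>

text \<open>Fubini for a kernel, under the sole assumption that \<open>u\<close> is integrable for the mixture; bounded
  integrands would not do, as square-integrable functions are needed below. The positive and negative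
  parts of \<open>u\<close> are handled by the identity for nonnegative integrals; both are almost surely finite
  under \<open>N x\<close>, which is why the conclusions about individual \<open>x\<close> hold only almost everywhere.\<close>

lemma bind_integrable:
  fixes u :: "'b \<Rightarrow> real"
  assumes N: "N \<in> measurable \<nu> (subprob_algebra S)" and u[measurable]: "u \<in> borel_measurable S"
    and i: "integrable (\<nu> \<bind> N) u" and ne: "space \<nu> \<noteq> {}"
  shows bind_integrable_AE: "AE x in \<nu>. integrable (N x) u"
    and bind_integrable_integral: "integrable \<nu> (\<lambda>x. \<integral>y. u y \<partial>N x)"
    and bind_integral_eq: "(\<integral>y. u y \<partial>(\<nu> \<bind> N)) = (\<integral>x. (\<integral>y. u y \<partial>N x) \<partial>\<nu>)"
proof -
  note [measurable] = N
  have sN: "sets (N x) = sets S" if "x \<in> space \<nu>" for x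
    using sets_kernel[OF N that] .
  define p m where "p x = (\<integral>\<^sup>+y. ennreal (u y) \<partial>N x)" and "m x = (\<integral>\<^sup>+y. ennreal (- u y) \<partial>N x)" for x
  have [measurable]: "p \<in> borel_measurable \<nu>" "m \<in> borel_measurable \<nu>"
    unfolding p_def[abs_def] m_def[abs_def] by measurable
  have P: "(\<integral>\<^sup>+y. ennreal (u y) \<partial>(\<nu> \<bind> N)) = (\<integral>\<^sup>+x. p x \<partial>\<nu>)"
    unfolding p_def by (intro nn_integral_bind[OF _ N]) simp
  have M: "(\<integral>\<^sup>+y. ennreal (- u y) \<partial>(\<nu> \<bind> N)) = (\<integral>\<^sup>+x. m x \<partial>\<nu>)"
    unfolding m_def by (intro nn_integral_bind[OF _ N]) simp
  have Pf: "(\<integral>\<^sup>+x. p x \<partial>\<nu>) < \<infinity>" and Mf: "(\<integral>\<^sup>+x. m x \<partial>\<nu>) < \<infinity>"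
    using i unfolding P[symmetric] M[symmetric] real_integrable_def by (auto simp: top.not_eq_extremum)
  have aeP: "AE x in \<nu>. p x \<noteq> \<infinity>" and aeM: "AE x in \<nu>. m x \<noteq> \<infinity>"
    using nn_integral_PInf_AE[of p \<nu>] nn_integral_PInf_AE[of m \<nu>] Pf Mf by auto
  have meas_u: "u \<in> borel_measurable (N x)" if "x \<in> space \<nu>" for x
    using measurable_cong_sets[OF sN[OF that] refl] u by blast
  show ae: "AE x in \<nu>. integrable (N x) u"
    using aeP aeM AE_space
    by eventually_elim (auto simp: real_integrable_def meas_u p_def m_def)
  have eq: "AE x in \<nu>. (\<integral>y. u y \<partial>N x) = enn2real (p x) - enn2real (m x)"
    using ae by eventually_elim (simp add: real_lebesgue_integral_def p_def m_def)
  have ip: "integrable \<nu> (\<lambda>x. enn2real (p x))"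
  proof (rule integrableI_nonneg)
    have "(\<integral>\<^sup>+x. ennreal (enn2real (p x)) \<partial>\<nu>) = (\<integral>\<^sup>+x. p x \<partial>\<nu>)"
      by (intro nn_integral_cong_AE) (use aeP in \<open>auto elim!: eventually_mono simp: top.not_eq_extremum\<close>)
    then show "(\<integral>\<^sup>+x. ennreal (enn2real (p x)) \<partial>\<nu>) < \<infinity>"
      using Pf by simp
  qed auto
  have im: "integrable \<nu> (\<lambda>x. enn2real (m x))"
  proof (rule integrableI_nonneg)
    have "(\<integral>\<^sup>+x. ennreal (enn2real (m x)) \<partial>\<nu>) = (\<integral>\<^sup>+x. m x \<partial>\<nu>)"
      by (intro nn_integral_cong_AE) (use aeM in \<open>auto elim!: eventually_mono simp: top.not_eq_extremum\<close>)
    then show "(\<integral>\<^sup>+x. ennreal (enn2real (m x)) \<partial>\<nu>) < \<infinity>"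
      using Mf by simp
  qed auto
  have Imeas[measurable]: "(\<lambda>x. \<integral>y. u y \<partial>N x) \<in> borel_measurable \<nu>"
    using measurable_compose[OF N integral_measurable_subprob_algebra[OF u]] by simp
  show "integrable \<nu> (\<lambda>x. \<integral>y. u y \<partial>N x)"
    using Bochner_Integration.integrable_diff[OF ip im] eq
    by (subst integrable_cong_AE[OF _ _ eq]) auto
  have "(\<integral>x. enn2real (p x) \<partial>\<nu>) = enn2real (\<integral>\<^sup>+x. p x \<partial>\<nu>)"
    using aeP by (subst integral_eq_nn_integral) (auto intro!: arg_cong[where f=enn2real] nn_integral_cong_AE elim!: eventually_mono simp: top.not_eq_extremum)
  moreover have "(\<integral>x. enn2real (m x) \<partial>\<nu>) = enn2real (\<integral>\<^sup>+x. m x \<partial>\<nu>)"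
    using aeM by (subst integral_eq_nn_integral) (auto intro!: arg_cong[where f=enn2real] nn_integral_cong_AE elim!: eventually_mono simp: top.not_eq_extremum)
  moreover have "(\<integral>x. (\<integral>y. u y \<partial>N x) \<partial>\<nu>) = (\<integral>x. enn2real (p x) - enn2real (m x) \<partial>\<nu>)"
    using eq by (intro integral_cong_AE) auto
  ultimately show "(\<integral>y. u y \<partial>(\<nu> \<bind> N)) = (\<integral>x. (\<integral>y. u y \<partial>N x) \<partial>\<nu>)"
    by (simp add: real_lebesgue_integral_def[OF i] P M Bochner_Integration.integral_diff[OF ip im])
qed

locale invariant_kernel = prob_space \<mu> for \<mu> :: "'a measure" +
  fixes P :: "'a \<Rightarrow> 'a measure"
  assumes kernel: "P \<in> measurable \<mu> (prob_algebra \<mu>)"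
    and invariant: "\<mu> \<bind> P = \<mu>"
begin

lemma kernel_subprob [measurable]: "P \<in> measurable \<mu> (subprob_algebra \<mu>)"
  using kernel by (rule measurable_prob_algebraD)

lemma kernel_prob_space: "x \<in> space \<mu> \<Longrightarrow> prob_space (P x)"
  using measurable_space[OF kernel] by (auto simp: space_prob_algebra)

lemma kernel_sets: "x \<in> space \<mu> \<Longrightarrow> sets (P x) = sets \<mu>"
  using measurable_space[OF kernel] by (auto simp: space_prob_algebra)

lemma kernel_op_measurable [measurable]:
  "u \<in> borel_measurable \<mu> \<Longrightarrow> kernel_op P u \<in> borel_measurable \<mu>"
  unfolding kernel_op_def[abs_def]
  by (rule measurable_compose[OF kernel_subprob integral_measurable_subprob_algebra])

lemma
  assumes "integrable \<mu> u"
  shows kernel_AE_integrable: "AE x in \<mu>. integrable (P x) u"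
    and kernel_op_integrable: "integrable \<mu> (kernel_op P u)"
    and integral_kernel_op: "(\<integral>x. kernel_op P u x \<partial>\<mu>) = (\<integral>x. u x \<partial>\<mu>)"
  using bind_integrable[OF kernel_subprob borel_measurable_integrable[OF assms]] assms not_empty
  by (auto simp: invariant kernel_op_def[abs_def])

text \<open>Jensen's inequality under \<open>P x\<close>, integrated against the invariant law.\<close>

lemma
  assumes "u \<in> L2 \<mu>"
  shows kernel_op_L2: "kernel_op P u \<in> L2 \<mu>"
    and L2_norm_kernel_op_le: "L2_norm \<mu> (kernel_op P u) \<le> L2_norm \<mu> u"
proof -
  have [measurable]: "u \<in> borel_measurable \<mu>" using assms by measurable
  have i: "integrable \<mu> (\<lambda>x. (u x)\<^sup>2)" using assms by (rule L2_square_integrable)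
  have le: "AE x in \<mu>. (kernel_op P u x)\<^sup>2 \<le> kernel_op P (\<lambda>y. (u y)\<^sup>2) x"
    using kernel_AE_integrable[OF i] AE_space
  proof eventually_elim
    case (elim x)
    interpret Px: prob_space "P x" using elim by (intro kernel_prob_space)
    have "u \<in> L2 (P x)"
      using elim measurable_cong_sets[OF kernel_sets[of x] refl] by (intro L2I) auto
    from Px.abs_integral_le_L2_norm[OF this]
    have "\<bar>kernel_op P u x\<bar> \<le> \<bar>L2_norm (P x) u\<bar>"
      by (simp add: kernel_op_def)
    then have "(kernel_op P u x)\<^sup>2 \<le> (L2_norm (P x) u)\<^sup>2" by (simp only: abs_le_square_iff)
    then show ?case by (simp add: kernel_op_def L2_norm_power2)
  qed
  have i2: "integrable \<mu> (\<lambda>x. (kernel_op P u x)\<^sup>2)"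
    by (rule Bochner_Integration.integrable_bound[OF kernel_op_integrable[OF i]])
       (use le in \<open>auto elim!: eventually_mono\<close>)
  then show "kernel_op P u \<in> L2 \<mu>" by (intro L2I) auto
  have "(\<integral>x. (kernel_op P u x)\<^sup>2 \<partial>\<mu>) \<le> (\<integral>x. kernel_op P (\<lambda>y. (u y)\<^sup>2) x \<partial>\<mu>)"
    using le by (intro integral_mono_AE i2 kernel_op_integrable i)
  then show "L2_norm \<mu> (kernel_op P u) \<le> L2_norm \<mu> u"
    by (simp add: L2_norm_def integral_kernel_op[OF i])
qed

lemma kernel_op_add:
  assumes "integrable \<mu> u" "integrable \<mu> v"
  shows "AE x in \<mu>. kernel_op P (\<lambda>y. u y + v y) x = kernel_op P u x + kernel_op P v x"
  using kernel_AE_integrable[OF assms(1)] kernel_AE_integrable[OF assms(2)]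
  by eventually_elim (simp add: kernel_op_def)

lemma kernel_op_cmult: "kernel_op P (\<lambda>y. c * u y) x = c * kernel_op P u x"
  by (simp add: kernel_op_def)

lemma kernel_op_sum:
  assumes "\<And>i. i \<in> I \<Longrightarrow> integrable \<mu> (u i)"
  shows "AE x in \<mu>. kernel_op P (\<lambda>y. \<Sum>i\<in>I. u i y) x = (\<Sum>i\<in>I. kernel_op P (u i) x)"
  using assms
proof (induction I rule: infinite_finite_induct)
  case (insert i I)
  have "AE x in \<mu>. kernel_op P (\<lambda>y. u i y + (\<Sum>i\<in>I. u i y)) x
      = kernel_op P (u i) x + kernel_op P (\<lambda>y. \<Sum>i\<in>I. u i y) x"
    using insert.prems by (intro kernel_op_add) auto
  with insert.IH insert.prems insert.hyps show ?case by auto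
qed (auto simp: kernel_op_def)

lemma kernel_op_power_L2: "u \<in> L2 \<mu> \<Longrightarrow> (kernel_op P ^^ n) u \<in> L2 \<mu>"
  by (induction n) (auto intro: kernel_op_L2)

lemma integral_kernel_op_power:
  "u \<in> L2 \<mu> \<Longrightarrow> (\<integral>x. (kernel_op P ^^ n) u x \<partial>\<mu>) = (\<integral>x. u x \<partial>\<mu>)"
  by (induction n) (auto simp: integral_kernel_op L2_integrable kernel_op_power_L2)

end

section \<open>Stationary Markov chains\<close>

lemma markov_chain_cong_sets:
  assumes "sets S = sets S'"
  shows "markov_chain \<Omega> S \<mu> P X \<longleftrightarrow> markov_chain \<Omega> S' \<mu> P X"
proof -
  have "measurable \<Omega> S = measurable \<Omega> S'"
    by (rule measurable_cong_sets) (auto simp: assms)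
  moreover have "distr \<Omega> S (X 0) = distr \<Omega> S' (X 0)"
    by (rule distr_cong) (auto simp: assms)
  ultimately show ?thesis
    unfolding markov_chain_def history_def assms by simp
qed

locale stationary_chain = invariant_kernel \<mu> P + \<Omega>: prob_space \<Omega>
  for \<mu> :: "'a measure" and P and \<Omega> :: "'w measure" +
  fixes X :: "nat \<Rightarrow> 'w \<Rightarrow> 'a"
  assumes chain: "markov_chain \<Omega> \<mu> \<mu> P X"
begin

abbreviation \<F> :: "nat \<Rightarrow> 'w measure" where
  "\<F> n \<equiv> history \<Omega> \<mu> X n"

lemma X_measurable [measurable]: "X n \<in> measurable \<Omega> \<mu>"
  using chain by (simp add: markov_chain_def)

lemma space_history [simp]: "space (\<F> n) = space \<Omega>"
  by (simp add: history_def space_measure_of_conv)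

lemma sets_history:
  "sets (\<F> n) = sigma_sets (space \<Omega>) (\<Union>i\<in>{..n}. {X i -` A \<inter> space \<Omega> |A. A \<in> sets \<mu>})"
  unfolding history_def by (rule sets_measure_of) auto

lemma history_mono: "m \<le> n \<Longrightarrow> sets (\<F> m) \<subseteq> sets (\<F> n)"
  unfolding sets_history by (intro sigma_sets_mono') force

lemma history_subalgebra: "subalgebra \<Omega> (\<F> n)"
proof -
  have "sets (\<F> n) \<subseteq> sets \<Omega>"
    unfolding sets_history by (intro sets.sigma_sets_subset) (auto intro: measurable_sets)
  then show ?thesis by (simp add: subalgebra_def)
qed

lemma X_history_measurable: "k \<le> n \<Longrightarrow> X k \<in> measurable (\<F> n) \<mu>"
  by (rule measurableI)
     (auto simp: sets_history intro!: sigma_sets.Basic measurable_space[OF X_measurable])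

lemma history_measurable_mono:
  "f \<in> measurable (\<F> m) N \<Longrightarrow> m \<le> n \<Longrightarrow> f \<in> measurable (\<F> n) N"
  using history_mono[of m n] by (auto simp: measurable_def)

lemma history_measurable_imp: "f \<in> measurable (\<F> n) N \<Longrightarrow> f \<in> measurable \<Omega> N"
  using measurable_from_subalg[OF history_subalgebra] .

lemma history_finite_subalgebra: "finite_measure_subalgebra \<Omega> (\<F> n)"
  using history_subalgebra by unfold_locales

lemma history_sigma_finite_subalgebra: "sigma_finite_subalgebra \<Omega> (\<F> n)"
  by (rule finite_measure_subalgebra_is_sigma_finite[OF history_finite_subalgebra])

text \<open>The Markov property is given for indicators of events only. Stated as an identity between laws,
  on each event \<open>B\<close> of the past, it applies to all integrands at once.\<close>

lemma law_step:
  assumes B: "B \<in> sets (\<F> n)"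
  shows "distr (density \<Omega> (indicator B)) \<mu> (X (Suc n))
       = distr (density \<Omega> (indicator B)) \<mu> (X n) \<bind> P"
proof (rule measure_eqI)
  have B\<Omega>[measurable]: "B \<in> sets \<Omega>"
    using B history_subalgebra[of n] by (auto simp: subalgebra_def)
  let ?D = "density \<Omega> (indicator B)"
  have P': "P \<in> measurable (distr ?D \<mu> (X n)) (subprob_algebra \<mu>)"
    using kernel_subprob by simp
  show "sets (distr ?D \<mu> (X (Suc n))) = sets (distr ?D \<mu> (X n) \<bind> P)"
    using not_empty by (subst sets_bind_measurable[OF P']) auto
  fix A assume "A \<in> sets (distr ?D \<mu> (X (Suc n)))"
  then have A[measurable]: "A \<in> sets \<mu>" by simp
  interpret sub: sigma_finite_subalgebra \<Omega> "\<F> n" by (rule history_sigma_finite_subalgebra)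
  let ?E = "X (Suc n) -` A \<inter> space \<Omega>"
  have E[measurable]: "?E \<in> sets \<Omega>" by measurable
  have mk[measurable]: "(\<lambda>\<omega>. measure (P (X n \<omega>)) A) \<in> borel_measurable \<Omega>"
    by measurable
  have ae: "AE \<omega> in \<Omega>. real_cond_exp \<Omega> (\<F> n) (indicator ?E) \<omega> = measure (P (X n \<omega>)) A"
    using chain by (simp add: markov_chain_def)
  have le1: "measure (P (X n \<omega>)) A \<le> 1" if "\<omega> \<in> space \<Omega>" for \<omega>
    using kernel_prob_space[OF measurable_space[OF X_measurable that]] by (rule prob_space.prob_le_1)
  have im: "integrable \<Omega> (\<lambda>\<omega>. indicator B \<omega> * measure (P (X n \<omega>)) A)"
    by (rule \<Omega>.integrable_const_bound[where B=1]) (auto simp: le1 split: split_indicator)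
  have "emeasure (distr ?D \<mu> (X (Suc n))) A = (\<integral>\<^sup>+\<omega>. indicator B \<omega> * indicator ?E \<omega> \<partial>\<Omega>)"
    by (simp add: emeasure_distr emeasure_density)
  also have "\<dots> = (\<integral>\<^sup>+\<omega>. ennreal (indicator B \<omega> * indicator ?E \<omega>) \<partial>\<Omega>)"
    by (intro nn_integral_cong) (auto split: split_indicator)
  also have "\<dots> = ennreal (\<integral>\<omega>. indicator B \<omega> * indicator ?E \<omega> \<partial>\<Omega>)"
    by (intro nn_integral_eq_integral \<Omega>.integrable_const_bound[where B=1]) (auto split: split_indicator)
  also have "(\<integral>\<omega>. indicator B \<omega> * indicator ?E \<omega> \<partial>\<Omega>)
      = (\<integral>\<omega>. indicator B \<omega> * real_cond_exp \<Omega> (\<F> n) (indicator ?E) \<omega> \<partial>\<Omega>)"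
    using B by (intro sub.real_cond_exp_intg(2)[symmetric] \<Omega>.integrable_const_bound[where B=1])
      (auto split: split_indicator)
  also have "\<dots> = (\<integral>\<omega>. indicator B \<omega> * measure (P (X n \<omega>)) A \<partial>\<Omega>)"
    using ae by (intro integral_cong_AE) auto
  also have "ennreal \<dots> = (\<integral>\<^sup>+\<omega>. ennreal (indicator B \<omega> * measure (P (X n \<omega>)) A) \<partial>\<Omega>)"
    by (intro nn_integral_eq_integral[symmetric] im) auto
  also have "\<dots> = (\<integral>\<^sup>+\<omega>. indicator B \<omega> * emeasure (P (X n \<omega>)) A \<partial>\<Omega>)"
  proof (intro nn_integral_cong)
    fix \<omega> assume "\<omega> \<in> space \<Omega>"
    then interpret Px: prob_space "P (X n \<omega>)"
      by (intro kernel_prob_space measurable_space[OF X_measurable])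
    show "ennreal (indicator B \<omega> * measure (P (X n \<omega>)) A) = indicator B \<omega> * emeasure (P (X n \<omega>)) A"
      by (auto simp: Px.emeasure_eq_measure split: split_indicator)
  qed
  also have "\<dots> = (\<integral>\<^sup>+x. emeasure (P x) A \<partial>distr ?D \<mu> (X n))"
    by (simp add: nn_integral_distr nn_integral_density)
  also have "\<dots> = emeasure (distr ?D \<mu> (X n) \<bind> P) A"
    using not_empty by (intro emeasure_bind[symmetric, OF _ P']) auto
  finally show "emeasure (distr ?D \<mu> (X (Suc n))) A = emeasure (distr ?D \<mu> (X n) \<bind> P) A" .
qed

lemma law_stationary: "distr \<Omega> \<mu> (X n) = \<mu>"
proof (induction n)
  case 0
  then show ?case using chain by (simp add: markov_chain_def)
next
  case (Suc n)
  have "density \<Omega> (indicator (space \<Omega>)) = density \<Omega> (\<lambda>_. 1)"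
    by (intro density_cong) auto
  then show ?case
    using law_step[of "space \<Omega>" n] sets.top[of "\<F> n"] Suc.IH invariant by (simp add: density_1)
qed

lemma
  fixes u :: "'a \<Rightarrow> real"
  assumes "integrable \<mu> u"
  shows integrable_X: "integrable \<Omega> (\<lambda>\<omega>. u (X n \<omega>))"
    and integral_X: "(\<integral>\<omega>. u (X n \<omega>) \<partial>\<Omega>) = (\<integral>x. u x \<partial>\<mu>)"
  using integrable_distr_eq[OF X_measurable, of u n] integral_distr[OF X_measurable, of u n] assms
  by (auto simp: law_stationary)

lemma
  assumes "u \<in> L2 \<mu>"
  shows L2_X: "(\<lambda>\<omega>. u (X n \<omega>)) \<in> L2 \<Omega>"
    and L2_norm_X: "L2_norm \<Omega> (\<lambda>\<omega>. u (X n \<omega>)) = L2_norm \<mu> u"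
proof -
  have [measurable]: "u \<in> borel_measurable \<mu>" using assms by measurable
  show "(\<lambda>\<omega>. u (X n \<omega>)) \<in> L2 \<Omega>"
    using integrable_X[OF L2_square_integrable[OF assms]] by (intro L2I) auto
  show "L2_norm \<Omega> (\<lambda>\<omega>. u (X n \<omega>)) = L2_norm \<mu> u"
    using integral_X[OF L2_square_integrable[OF assms], of n] by (simp add: L2_norm_def)
qed

lemma AE_X: "AE x in \<mu>. Q x \<Longrightarrow> AE \<omega> in \<Omega>. Q (X n \<omega>)"
  using AE_distrD[OF X_measurable[of n], of Q] unfolding law_stationary by blast

lemma cond_exp_step:
  fixes u :: "'a \<Rightarrow> real"
  assumes u: "integrable \<mu> u"
  shows "AE \<omega> in \<Omega>. real_cond_exp \<Omega> (\<F> n) (\<lambda>\<omega>. u (X (Suc n) \<omega>)) \<omega> = kernel_op P u (X n \<omega>)"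
proof (rule sigma_finite_subalgebra.real_cond_exp_charact[OF history_sigma_finite_subalgebra])
  show "integrable \<Omega> (\<lambda>\<omega>. u (X (Suc n) \<omega>))" using u by (rule integrable_X)
  show "integrable \<Omega> (\<lambda>\<omega>. kernel_op P u (X n \<omega>))"
    using kernel_op_integrable[OF u] by (rule integrable_X)
  have um[measurable]: "u \<in> borel_measurable \<mu>" using u by auto
  show "(\<lambda>\<omega>. kernel_op P u (X n \<omega>)) \<in> borel_measurable (\<F> n)"
    by (rule measurable_compose[OF X_history_measurable]) auto
  fix B assume B: "B \<in> sets (\<F> n)"
  then have B\<Omega>[measurable]: "B \<in> sets \<Omega>"
    using history_subalgebra[of n] by (auto simp: subalgebra_def)
  let ?D = "density \<Omega> (indicator B)"
  let ?D' = "density \<Omega> (\<lambda>\<omega>. ennreal (indicator B \<omega>))"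
  have D: "?D = ?D'"
    by (intro density_cong) (auto split: split_indicator)
  have P': "P \<in> measurable (distr ?D \<mu> (X n)) (subprob_algebra \<mu>)"
    using kernel_subprob by simp
  have i: "integrable (distr ?D \<mu> (X (Suc n))) u"
    using integrable_mult_indicator[OF B\<Omega> integrable_X[OF u, of "Suc n"]]
    by (subst integrable_distr_eq) (auto simp: D integrable_density)
  have "(\<integral>x. u x \<partial>distr ?D \<mu> (X (Suc n))) = (\<integral>x. kernel_op P u x \<partial>distr ?D \<mu> (X n))"
    using bind_integral_eq[OF P' um] i not_empty by (simp add: law_step[OF B] kernel_op_def)
  then show "(\<integral>\<omega>\<in>B. u (X (Suc n) \<omega>) \<partial>\<Omega>) = (\<integral>\<omega>\<in>B. kernel_op P u (X n \<omega>) \<partial>\<Omega>)"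
    by (simp add: integral_distr D integral_density set_lebesgue_integral_def)
qed

text \<open>Integrability is required only of the product, so that \<open>Z\<close> may itself be an unbounded function of
  \<open>X n\<close>; this is needed for the mixed term in the square of a martingale increment.\<close>

lemma markov_integral:
  fixes Z :: "'w \<Rightarrow> complex"
  assumes Z: "Z \<in> borel_measurable (\<F> n)" and u: "integrable \<mu> u"
    and i: "integrable \<Omega> (\<lambda>\<omega>. Z \<omega> * of_real (u (X (Suc n) \<omega>)))"
  shows "integrable \<Omega> (\<lambda>\<omega>. Z \<omega> * of_real (kernel_op P u (X n \<omega>)))"
    and "(\<integral>\<omega>. Z \<omega> * of_real (u (X (Suc n) \<omega>)) \<partial>\<Omega>) = (\<integral>\<omega>. Z \<omega> * of_real (kernel_op P u (X n \<omega>)) \<partial>\<Omega>)"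
proof -
  interpret sub: sigma_finite_subalgebra \<Omega> "\<F> n" by (rule history_sigma_finite_subalgebra)
  have [measurable]: "u \<in> borel_measurable \<mu>" using u by auto
  have Z\<Omega>[measurable]: "Z \<in> borel_measurable \<Omega>" using Z by (rule history_measurable_imp)
  have real: "integrable \<Omega> (\<lambda>\<omega>. z \<omega> * kernel_op P u (X n \<omega>)) \<and>
      (\<integral>\<omega>. z \<omega> * u (X (Suc n) \<omega>) \<partial>\<Omega>) = (\<integral>\<omega>. z \<omega> * kernel_op P u (X n \<omega>) \<partial>\<Omega>)"
    if z: "z \<in> borel_measurable (\<F> n)" and iz: "integrable \<Omega> (\<lambda>\<omega>. z \<omega> * u (X (Suc n) \<omega>))" for z
  proof -
    have zO[measurable]: "z \<in> borel_measurable \<Omega>" using z by (rule history_measurable_imp)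
    note r = sub.real_cond_exp_intg[OF iz z, simplified]
    have ae: "AE \<omega> in \<Omega>. z \<omega> * real_cond_exp \<Omega> (\<F> n) (\<lambda>\<omega>. u (X (Suc n) \<omega>)) \<omega> = z \<omega> * kernel_op P u (X n \<omega>)"
      using cond_exp_step[OF u, of n] by eventually_elim simp
    show ?thesis
      using r integral_cong_AE[OF _ _ ae] integrable_cong_AE[OF _ _ ae] by auto
  qed
  have R: "(\<lambda>\<omega>. Re (Z \<omega>)) \<in> borel_measurable (\<F> n)" "(\<lambda>\<omega>. Im (Z \<omega>)) \<in> borel_measurable (\<F> n)"
    using Z by auto
  have iR: "integrable \<Omega> (\<lambda>\<omega>. Re (Z \<omega>) * u (X (Suc n) \<omega>))"
    and iI: "integrable \<Omega> (\<lambda>\<omega>. Im (Z \<omega>) * u (X (Suc n) \<omega>))"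
    using integrable_Re[OF i] integrable_Im[OF i] by simp_all
  note real[OF R(1) iR] real[OF R(2) iI]
  then have kR: "integrable \<Omega> (\<lambda>\<omega>. Re (Z \<omega>) * kernel_op P u (X n \<omega>))"
    and kI: "integrable \<Omega> (\<lambda>\<omega>. Im (Z \<omega>) * kernel_op P u (X n \<omega>))"
    and eR: "(\<integral>\<omega>. Re (Z \<omega>) * u (X (Suc n) \<omega>) \<partial>\<Omega>) = (\<integral>\<omega>. Re (Z \<omega>) * kernel_op P u (X n \<omega>) \<partial>\<Omega>)"
    and eI: "(\<integral>\<omega>. Im (Z \<omega>) * u (X (Suc n) \<omega>) \<partial>\<Omega>) = (\<integral>\<omega>. Im (Z \<omega>) * kernel_op P u (X n \<omega>) \<partial>\<Omega>)"
    by auto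
  show ik: "integrable \<Omega> (\<lambda>\<omega>. Z \<omega> * of_real (kernel_op P u (X n \<omega>)))"
  proof -
    have "integrable \<Omega> (\<lambda>\<omega>. of_real (Re (Z \<omega>) * kernel_op P u (X n \<omega>))
        + \<i> * of_real (Im (Z \<omega>) * kernel_op P u (X n \<omega>)))"
      using kR kI by (intro Bochner_Integration.integrable_add integrable_mult_right integrable_of_real)
    also have "(\<lambda>\<omega>. of_real (Re (Z \<omega>) * kernel_op P u (X n \<omega>))
        + \<i> * of_real (Im (Z \<omega>) * kernel_op P u (X n \<omega>)))
      = (\<lambda>\<omega>. Z \<omega> * of_real (kernel_op P u (X n \<omega>)))"
      by (auto simp: complex_eq_iff)
    finally show ?thesis .
  qed
  show "(\<integral>\<omega>. Z \<omega> * of_real (u (X (Suc n) \<omega>)) \<partial>\<Omega>) = (\<integral>\<omega>. Z \<omega> * of_real (kernel_op P u (X n \<omega>)) \<partial>\<Omega>)"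
    by (rule complex_eqI)
       (simp_all add: integral_Re[OF i, symmetric] integral_Im[OF i, symmetric]
          integral_Re[OF ik, symmetric] integral_Im[OF ik, symmetric] eR eI)
qed

end

section \<open>Kernels that contract mean-zero functions\<close>

locale contracting_kernel = invariant_kernel \<mu> P for \<mu> :: "'a measure" and P +
  fixes \<rho> :: real
  assumes rate_nonneg: "0 \<le> \<rho>" and rate_less_1: "\<rho> < 1"
    and contraction:
      "\<And>u. u \<in> L2 \<mu> \<Longrightarrow> (\<integral>x. u x \<partial>\<mu>) = 0 \<Longrightarrow> L2_norm \<mu> (kernel_op P u) \<le> \<rho> * L2_norm \<mu> u"
begin

lemma L2_norm_kernel_op_power_le:
  assumes "u \<in> L2 \<mu>" "(\<integral>x. u x \<partial>\<mu>) = 0"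
  shows "L2_norm \<mu> ((kernel_op P ^^ n) u) \<le> \<rho> ^ n * L2_norm \<mu> u"
proof (induction n)
  case (Suc n)
  have "L2_norm \<mu> ((kernel_op P ^^ Suc n) u) \<le> \<rho> * L2_norm \<mu> ((kernel_op P ^^ n) u)"
    using contraction[of "(kernel_op P ^^ n) u"] assms
    by (simp add: kernel_op_power_L2 integral_kernel_op_power)
  also have "\<dots> \<le> \<rho> * (\<rho> ^ n * L2_norm \<mu> u)"
    by (intro mult_left_mono Suc.IH rate_nonneg)
  finally show ?case by simp
qed simp

definition autocov :: "('a \<Rightarrow> real) \<Rightarrow> nat \<Rightarrow> real" where
  "autocov f k = (\<integral>x. f x * (kernel_op P ^^ k) f x \<partial>\<mu>)"

text \<open>Since \<open>autocov f 0\<close> is the squared norm, this is \<open>autocov f 0\<close> plus twice the sum of the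
  \<open>autocov f k\<close> with \<open>k \<ge> 1\<close>, the limit of the variance of the normalised sums.\<close>

definition asymptotic_variance :: "('a \<Rightarrow> real) \<Rightarrow> real" where
  "asymptotic_variance f = 2 * (\<Sum>k. autocov f k) - (L2_norm \<mu> f)\<^sup>2"

text \<open>A truncation of the Neumann series of the inverse of \<open>I - P\<close>.\<close>

definition partial_resolvent :: "nat \<Rightarrow> ('a \<Rightarrow> real) \<Rightarrow> 'a \<Rightarrow> real" where
  "partial_resolvent N f x = (\<Sum>k<N. (kernel_op P ^^ k) f x)"

text \<open>The variance of \<open>g (X\<^sub>1) - (P g) (X\<^sub>0)\<close> in stationarity.\<close>

definition martingale_variance :: "('a \<Rightarrow> real) \<Rightarrow> real" where
  "martingale_variance g = (L2_norm \<mu> g)\<^sup>2 - (L2_norm \<mu> (kernel_op P g))\<^sup>2"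

lemma partial_resolvent_L2: "f \<in> L2 \<mu> \<Longrightarrow> partial_resolvent N f \<in> L2 \<mu>"
  unfolding partial_resolvent_def[abs_def] by (intro L2_sum kernel_op_power_L2)

context
  fixes f assumes f: "f \<in> L2 \<mu>" and mean: "(\<integral>x. f x \<partial>\<mu>) = 0"
begin

lemma autocov_bound: "\<bar>autocov f k\<bar> \<le> (L2_norm \<mu> f)\<^sup>2 * \<rho> ^ k"
proof -
  have "\<bar>autocov f k\<bar> \<le> L2_norm \<mu> f * L2_norm \<mu> ((kernel_op P ^^ k) f)"
    unfolding autocov_def by (intro L2_Cauchy_Schwarz f kernel_op_power_L2)
  also have "\<dots> \<le> L2_norm \<mu> f * (\<rho> ^ k * L2_norm \<mu> f)"
    by (intro mult_left_mono L2_norm_kernel_op_power_le f mean L2_norm_nonneg)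
  finally show ?thesis by (simp add: power2_eq_square mult_ac)
qed

lemma autocov_summable: "summable (autocov f)"
proof (rule summable_comparison_test'[where N = 0])
  show "summable (\<lambda>k. (L2_norm \<mu> f)\<^sup>2 * \<rho> ^ k)"
    using rate_nonneg rate_less_1 by (intro summable_mult summable_geometric) simp
qed (simp add: autocov_bound)

lemma autocov_suminf_bound: "\<bar>\<Sum>k. autocov f k\<bar> \<le> (L2_norm \<mu> f)\<^sup>2 / (1 - \<rho>)"
proof -
  have s: "summable (\<lambda>k. (L2_norm \<mu> f)\<^sup>2 * \<rho> ^ k)"
    using rate_nonneg rate_less_1 by (intro summable_mult summable_geometric) simp
  have s': "summable (\<lambda>k. \<bar>autocov f k\<bar>)"
    by (rule summable_comparison_test'[OF s, where N = 0]) (simp add: autocov_bound)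
  have "\<bar>\<Sum>k. autocov f k\<bar> \<le> (\<Sum>k. \<bar>autocov f k\<bar>)"
    using s' by (rule summable_rabs)
  also have "\<dots> \<le> (\<Sum>k. (L2_norm \<mu> f)\<^sup>2 * \<rho> ^ k)"
    by (intro suminf_le s s' autocov_bound)
  also have "\<dots> = (L2_norm \<mu> f)\<^sup>2 / (1 - \<rho>)"
    using rate_nonneg rate_less_1 by (simp add: suminf_mult suminf_geometric summable_geometric)
  finally show ?thesis .
qed

lemma partial_resolvent_norm: "L2_norm \<mu> (partial_resolvent N f) \<le> L2_norm \<mu> f / (1 - \<rho>)"
proof -
  have "L2_norm \<mu> (partial_resolvent N f) \<le> (\<Sum>k<N. L2_norm \<mu> ((kernel_op P ^^ k) f))"
    unfolding partial_resolvent_def[abs_def] by (intro L2_norm_sum_le kernel_op_power_L2 f)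
  also have "\<dots> \<le> (\<Sum>k<N. \<rho> ^ k * L2_norm \<mu> f)"
    by (intro sum_mono L2_norm_kernel_op_power_le f mean)
  also have "\<dots> = (\<Sum>k<N. \<rho> ^ k) * L2_norm \<mu> f"
    by (simp add: sum_distrib_right)
  also have "\<dots> \<le> (1 / (1 - \<rho>)) * L2_norm \<mu> f"
  proof (intro mult_right_mono L2_norm_nonneg)
    show "(\<Sum>k<N. \<rho> ^ k) \<le> 1 / (1 - \<rho>)"
      using sum_le_suminf[of "\<lambda>k. \<rho> ^ k" "{..<N}"] rate_nonneg rate_less_1
      by (simp add: suminf_geometric summable_geometric)
  qed
  finally show ?thesis by simp
qed

text \<open>The Poisson equation \<open>g - P g = f\<close> is solved up to the small error \<open>P\<^sup>N f\<close>, since the sum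
  defining \<open>P g - g\<close> telescopes. It is an identity almost everywhere only, because \<open>kernel_op\<close> is additive
  only where the functions involved are integrable.\<close>

lemma poisson_approx:
  "AE x in \<mu>. kernel_op P (partial_resolvent N f) x
     = partial_resolvent N f x - f x + (kernel_op P ^^ N) f x"
proof -
  have "AE x in \<mu>. kernel_op P (partial_resolvent N f) x
      = (\<Sum>k<N. kernel_op P ((kernel_op P ^^ k) f) x)"
    unfolding partial_resolvent_def[abs_def]
    by (intro kernel_op_sum L2_integrable kernel_op_power_L2 f)
  moreover have "(\<Sum>k<N. kernel_op P ((kernel_op P ^^ k) f) x)
      = partial_resolvent N f x - f x + (kernel_op P ^^ N) f x" for x
    by (induction N) (simp_all add: partial_resolvent_def)
  ultimately show ?thesis by simp
qed

text \<open>Substituting \<open>P g = g - f + e\<close> with \<open>e = P\<^sup>N f\<close> gives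
  \<open>\<parallel>g\<parallel>\<^sup>2 - \<parallel>P g\<parallel>\<^sup>2 = 2 \<langle>g, f\<rangle> - \<parallel>f\<parallel>\<^sup>2 + \<dots>\<close>, where \<open>\<langle>g, f\<rangle>\<close> is a partial sum of the
  autocovariance series and all omitted terms contain \<open>e\<close>, hence vanish in the limit.\<close>

lemma martingale_variance_tendsto:
  "(\<lambda>N. martingale_variance (partial_resolvent N f)) \<longlonglongrightarrow> asymptotic_variance f"
proof -
  let ?g = "\<lambda>N. partial_resolvent N f" and ?e = "\<lambda>N. (kernel_op P ^^ N) f"
  have L2: "?g N \<in> L2 \<mu>" "?e N \<in> L2 \<mu>" for N
    using f by (auto intro: partial_resolvent_L2 kernel_op_power_L2)
  note int = L2_mult_integrable[OF L2(1) f] L2_mult_integrable[OF L2(1) L2(2)]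
    L2_mult_integrable[OF f L2(2)] L2_square_integrable[OF f]
    L2_square_integrable[OF L2(1)] L2_square_integrable[OF L2(2)]
  have eq: "martingale_variance (?g N)
      = 2 * (\<Sum>k<N. autocov f k) - (L2_norm \<mu> f)\<^sup>2
        - 2 * (\<integral>x. ?g N x * ?e N x \<partial>\<mu>) + 2 * autocov f N - (L2_norm \<mu> (?e N))\<^sup>2" for N
  proof -
    have "(L2_norm \<mu> (kernel_op P (?g N)))\<^sup>2 = (L2_norm \<mu> (\<lambda>x. ?g N x - f x + ?e N x))\<^sup>2"
      by (intro arg_cong[where f="\<lambda>x. x\<^sup>2"] L2_norm_cong_AE poisson_approx kernel_op_L2 L2_add L2_diff L2 f)
    also have "\<dots> = (\<integral>x. (?g N x)\<^sup>2 - 2 * (?g N x * f x) + 2 * (?g N x * ?e N x)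
        + (f x)\<^sup>2 - 2 * (f x * ?e N x) + (?e N x)\<^sup>2 \<partial>\<mu>)"
      unfolding L2_norm_power2
      by (intro Bochner_Integration.integral_cong) (auto simp: power2_eq_square algebra_simps)
    also have "\<dots> = (L2_norm \<mu> (?g N))\<^sup>2 - 2 * (\<integral>x. ?g N x * f x \<partial>\<mu>)
        + 2 * (\<integral>x. ?g N x * ?e N x \<partial>\<mu>) + (L2_norm \<mu> f)\<^sup>2 - 2 * autocov f N + (L2_norm \<mu> (?e N))\<^sup>2"
      unfolding L2_norm_power2 autocov_def using int by simp
    also have "(\<integral>x. ?g N x * f x \<partial>\<mu>) = (\<integral>x. (\<Sum>k<N. f x * ?e k x) \<partial>\<mu>)"
      by (simp add: partial_resolvent_def sum_distrib_left mult.commute)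
    also have "\<dots> = (\<Sum>k<N. autocov f k)"
      unfolding autocov_def
      by (intro Bochner_Integration.integral_sum L2_mult_integrable f L2)
    finally show ?thesis by (simp add: martingale_variance_def)
  qed
  have \<rho>0: "(\<lambda>N. \<rho> ^ N) \<longlonglongrightarrow> 0"
    using rate_nonneg rate_less_1 by (intro LIMSEQ_realpow_zero) auto
  have 1: "(\<lambda>N. \<integral>x. ?g N x * ?e N x \<partial>\<mu>) \<longlonglongrightarrow> 0"
  proof (rule Lim_null_comparison)
    show "\<forall>\<^sub>F N in sequentially. norm (\<integral>x. ?g N x * ?e N x \<partial>\<mu>)
        \<le> (L2_norm \<mu> f / (1 - \<rho>)) * (\<rho> ^ N * L2_norm \<mu> f)"
    proof (intro always_eventually allI)
      fix N
      have "norm (\<integral>x. ?g N x * ?e N x \<partial>\<mu>) \<le> L2_norm \<mu> (?g N) * L2_norm \<mu> (?e N)"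
        using L2_Cauchy_Schwarz[OF L2] by simp
      also have "\<dots> \<le> (L2_norm \<mu> f / (1 - \<rho>)) * (\<rho> ^ N * L2_norm \<mu> f)"
        using rate_less_1
        by (intro mult_mono partial_resolvent_norm L2_norm_kernel_op_power_le f mean)
           (auto simp: L2_norm_nonneg)
      finally show "norm (\<integral>x. ?g N x * ?e N x \<partial>\<mu>) \<le> (L2_norm \<mu> f / (1 - \<rho>)) * (\<rho> ^ N * L2_norm \<mu> f)" .
    qed
    show "(\<lambda>N. (L2_norm \<mu> f / (1 - \<rho>)) * (\<rho> ^ N * L2_norm \<mu> f)) \<longlonglongrightarrow> 0"
      by (intro tendsto_mult_right_zero tendsto_mult_left_zero \<rho>0)
  qed
  have 2: "autocov f \<longlonglongrightarrow> 0"
    using autocov_summable by (rule summable_LIMSEQ_zero)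
  have 3: "(\<lambda>N. L2_norm \<mu> (?e N)) \<longlonglongrightarrow> 0"
  proof (rule Lim_null_comparison)
    show "\<forall>\<^sub>F N in sequentially. norm (L2_norm \<mu> (?e N)) \<le> \<rho> ^ N * L2_norm \<mu> f"
      using L2_norm_kernel_op_power_le[OF f mean] by (simp add: L2_norm_nonneg)
    show "(\<lambda>N. \<rho> ^ N * L2_norm \<mu> f) \<longlonglongrightarrow> 0"
      using \<rho>0 by (rule tendsto_mult_left_zero)
  qed
  have "(\<lambda>N. martingale_variance (?g N))
      \<longlonglongrightarrow> 2 * (\<Sum>k. autocov f k) - (L2_norm \<mu> f)\<^sup>2 - 2 * 0 + 2 * 0 - 0\<^sup>2"
    unfolding eq by (intro tendsto_intros summable_LIMSEQ autocov_summable 1 2 3)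
  then show ?thesis by (simp add: asymptotic_variance_def)
qed

end

lemma martingale_variance_nonneg: "g \<in> L2 \<mu> \<Longrightarrow> 0 \<le> martingale_variance g"
  unfolding martingale_variance_def
  using L2_norm_kernel_op_le[of g] by (simp add: L2_norm_nonneg power_mono)

lemma asymptotic_variance_nonneg:
  assumes "f \<in> L2 \<mu>" "(\<integral>x. f x \<partial>\<mu>) = 0"
  shows "0 \<le> asymptotic_variance f"
  using martingale_variance_tendsto[OF assms]
  by (rule LIMSEQ_le_const) (auto intro: martingale_variance_nonneg partial_resolvent_L2 assms)

end

section \<open>Taylor remainders and truncation\<close>

lemma norm_recursion_le:
  fixes x :: "nat \<Rightarrow> complex" and a :: complex
  assumes "x 0 = 1" "norm a \<le> 1" "\<And>k. norm (x (Suc k) - a * x k) \<le> e k"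
  shows "norm (x n - a ^ n) \<le> (\<Sum>k<n. e k)"
proof (induction n)
  case (Suc n)
  have "x (Suc n) - a ^ Suc n = (x (Suc n) - a * x n) + a * (x n - a ^ n)"
    by (simp add: algebra_simps)
  also have "norm \<dots> \<le> norm (x (Suc n) - a * x n) + norm a * norm (x n - a ^ n)"
    by (metis norm_triangle_ineq norm_mult)
  also have "\<dots> \<le> e n + 1 * (\<Sum>k<n. e k)"
    by (intro add_mono mult_mono assms Suc.IH) auto
  finally show ?case by simp
qed (use assms in simp)

lemma norm_iexp_diff_le: "norm (iexp a - iexp b) \<le> \<bar>a - b\<bar>" for a b :: real
proof -
  have "iexp a - iexp b = iexp b * (iexp (a - b) - 1)"
    by (simp add: algebra_simps flip: exp_add)
  then have "norm (iexp a - iexp b) = norm (iexp (a - b) - 1)"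
    by (simp add: norm_mult)
  also have "\<dots> \<le> \<bar>a - b\<bar>"
    using iexp_approx1[of "a - b" 0] by simp
  finally show ?thesis .
qed

text \<open>An upper bound for the remainder of \<open>exp (\<i> y)\<close> after its second-order Taylor polynomial. The
  cubic branch makes it negligible for small \<open>y\<close>, the quadratic one keeps it integrable when only second
  moments are available.\<close>

definition taylor_bound :: "real \<Rightarrow> real" where
  "taylor_bound y = min (y\<^sup>2) (\<bar>y\<bar> ^ 3)"

lemma taylor_bound_measurable [measurable]: "taylor_bound \<in> borel_measurable borel"
  unfolding taylor_bound_def[abs_def] by measurable

lemma taylor_bound_nonneg: "0 \<le> taylor_bound y"
  by (simp add: taylor_bound_def)

lemma iexp_taylor: "norm (iexp y - (1 + \<i> * of_real y - of_real (y\<^sup>2) / 2)) \<le> taylor_bound y"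
proof -
  have *: "(\<Sum>k\<le>2. (\<i> * of_real y) ^ k / fact k) = 1 + \<i> * of_real y - of_real (y\<^sup>2) / 2"
    by (simp add: numeral_2_eq_2 power_mult_distrib)
  have "norm (iexp y - (1 + \<i> * of_real y - of_real (y\<^sup>2) / 2)) \<le> y\<^sup>2"
    using iexp_approx2[of y 2] unfolding * by (simp add: numeral_2_eq_2)
  moreover have "norm (iexp y - (1 + \<i> * of_real y - of_real (y\<^sup>2) / 2)) \<le> \<bar>y\<bar> ^ 3"
  proof -
    have "norm (iexp y - (1 + \<i> * of_real y - of_real (y\<^sup>2) / 2)) \<le> \<bar>y\<bar> ^ 3 / 6"
      using iexp_approx1[of y 2] unfolding * by (simp add: numeral_2_eq_2 numeral_3_eq_3 fact_numeral)
    also have "\<dots> \<le> \<bar>y\<bar> ^ 3" by simp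
    finally show ?thesis .
  qed
  ultimately show ?thesis by (simp add: taylor_bound_def)
qed

text \<open>Splitting the bound in this way lets the increment \<open>g (X\<^sub>k\<^sub>+\<^sub>1) - (P g) (X\<^sub>k)\<close> be controlled through
  the one-dimensional marginals alone.\<close>

lemma taylor_bound_diff: "taylor_bound (a - b) \<le> 8 * (taylor_bound a + taylor_bound b)"
proof -
  have mono: "taylor_bound x \<le> taylor_bound y" if "\<bar>x\<bar> \<le> \<bar>y\<bar>" for x y
    using that unfolding taylor_bound_def
    by (intro min.mono) (auto simp: abs_le_square_iff power_mono)
  have dbl: "taylor_bound (2 * x) \<le> 8 * taylor_bound x" for x
  proof -
    have "min (4 * x\<^sup>2) (8 * \<bar>x\<bar> ^ 3) \<le> min (8 * x\<^sup>2) (8 * \<bar>x\<bar> ^ 3)"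
      by (intro min.mono) auto
    then show ?thesis
      by (simp add: taylor_bound_def abs_mult power_mult_distrib mult_min_right)
  qed
  show ?thesis
  proof (cases "\<bar>a\<bar> \<le> \<bar>b\<bar>")
    case True
    then have "taylor_bound (a - b) \<le> taylor_bound (2 * b)" by (intro mono) auto
    also note dbl[of b]
    also have "8 * taylor_bound b \<le> 8 * (taylor_bound a + taylor_bound b)"
      using taylor_bound_nonneg[of a] by simp
    finally show ?thesis .
  next
    case False
    then have "taylor_bound (a - b) \<le> taylor_bound (2 * a)" by (intro mono) auto
    also note dbl[of a]
    also have "8 * taylor_bound a \<le> 8 * (taylor_bound a + taylor_bound b)"
      using taylor_bound_nonneg[of b] by simp
    finally show ?thesis .
  qed
qed

lemma L2_taylor_bound_integrable:
  assumes "u \<in> L2 \<mu>"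
  shows "integrable \<mu> (\<lambda>x. taylor_bound (\<theta> * u x))"
proof (rule Bochner_Integration.integrable_bound)
  show "integrable \<mu> (\<lambda>x. (\<theta> * u x)\<^sup>2)"
    using L2_square_integrable[OF L2_cmult[OF assms]] .
  show "(\<lambda>x. taylor_bound (\<theta> * u x)) \<in> borel_measurable \<mu>"
    using assms by measurable
qed (auto simp: taylor_bound_def)

text \<open>This is the Lindeberg condition for identically distributed summands: the remainders of \<open>n\<close> steps
  together are negligible, by dominated convergence with majorant \<open>t\<^sup>2 u\<^sup>2\<close>.\<close>

lemma L2_taylor_bound_tendsto:
  assumes u: "u \<in> L2 \<mu>"
  shows "(\<lambda>n. real n * (\<integral>x. taylor_bound (t / sqrt n * u x) \<partial>\<mu>)) \<longlonglongrightarrow> 0"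
proof -
  have [measurable]: "u \<in> borel_measurable \<mu>" using u by measurable
  have "(\<lambda>n. \<integral>x. real n * taylor_bound (t / sqrt n * u x) \<partial>\<mu>) \<longlonglongrightarrow> (\<integral>x. 0 \<partial>\<mu>)"
  proof (rule integral_dominated_convergence)
    show "integrable \<mu> (\<lambda>x. t\<^sup>2 * (u x)\<^sup>2)"
      using L2_square_integrable[OF u] by simp
    have le1: "real n * taylor_bound (t / sqrt n * y) \<le> t\<^sup>2 * y\<^sup>2" for n y
    proof (cases "n = 0")
      case False
      have "real n * taylor_bound (t / sqrt n * y) \<le> real n * (t / sqrt n * y)\<^sup>2"
        by (intro mult_left_mono) (auto simp: taylor_bound_def)
      also have "\<dots> = t\<^sup>2 * y\<^sup>2"
        using False by (simp add: power_mult_distrib power_divide)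
      finally show ?thesis .
    qed simp
    show "AE x in \<mu>. norm (real n * taylor_bound (t / sqrt n * u x)) \<le> t\<^sup>2 * (u x)\<^sup>2" for n
      using le1 by (simp add: taylor_bound_nonneg abs_mult)
    have "(\<lambda>n. real n * taylor_bound (t / sqrt n * y)) \<longlonglongrightarrow> 0" for y
    proof (rule Lim_null_comparison)
      show "\<forall>\<^sub>F n in sequentially. norm (real n * taylor_bound (t / sqrt n * y)) \<le> \<bar>t * y\<bar> ^ 3 / sqrt n"
      proof (intro always_eventually allI)
        fix n
        show "norm (real n * taylor_bound (t / sqrt n * y)) \<le> \<bar>t * y\<bar> ^ 3 / sqrt n"
        proof (cases "n = 0")
          case False
          have "norm (real n * taylor_bound (t / sqrt n * y)) \<le> real n * \<bar>t / sqrt n * y\<bar> ^ 3"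
            by (auto simp: taylor_bound_nonneg abs_mult intro!: mult_left_mono) (simp add: taylor_bound_def abs_mult)
          also have "\<dots> = \<bar>t * y\<bar> ^ 3 * (real n / (sqrt n) ^ 3)"
            by (simp add: abs_mult power_mult_distrib power_divide)
          also have "real n / (sqrt n) ^ 3 = 1 / sqrt n"
            using False by (simp add: power3_eq_cube divide_simps)
          finally show ?thesis by simp
        qed simp
      qed
      show "(\<lambda>n. \<bar>t * y\<bar> ^ 3 / sqrt (real n)) \<longlonglongrightarrow> 0"
        by (intro tendsto_divide_0[OF tendsto_const] filterlim_at_top_imp_at_infinity
          filterlim_compose[OF sqrt_at_top] filterlim_real_sequentially)
    qed
    then show "AE x in \<mu>. (\<lambda>n. real n * taylor_bound (t / sqrt n * u x)) \<longlonglongrightarrow> 0"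
      by simp
  qed auto
  then show ?thesis by simp
qed

text \<open>The form in which limits with an auxiliary parameter are taken below: for each choice of the
  parameter there is a convergent majorant, and its limit is small for a good choice.\<close>

lemma tendsto_zero_approx:
  fixes D :: "nat \<Rightarrow> real"
  assumes nonneg: "\<And>n. 0 \<le> D n"
    and approx: "\<And>\<epsilon>. 0 < \<epsilon> \<Longrightarrow> \<exists>e l. e \<longlonglongrightarrow> l \<and> l < \<epsilon> \<and> (\<forall>\<^sub>F n in sequentially. D n \<le> e n)"
  shows "D \<longlonglongrightarrow> 0"
proof (rule order_tendstoI)
  fix \<epsilon> :: real assume "0 < \<epsilon>"
  then obtain e l where "e \<longlonglongrightarrow> l" "l < \<epsilon>" and le: "\<forall>\<^sub>F n in sequentially. D n \<le> e n"
    using approx by blast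
  then have "\<forall>\<^sub>F n in sequentially. e n < \<epsilon>" by (intro order_tendstoD)
  with le show "\<forall>\<^sub>F n in sequentially. D n < \<epsilon>" by eventually_elim simp
qed (use nonneg in \<open>auto intro!: always_eventually elim: less_le_trans\<close>)

text \<open>The conditional variance lies in \<open>L\<^sup>1\<close> only, whereas contraction is an \<open>L\<^sup>2\<close> statement; truncation
  followed by recentring bridges the gap.\<close>

lemma (in prob_space) bounded_mean_zero_approx:
  fixes u :: "'a \<Rightarrow> real"
  assumes u: "integrable M u" and mean: "(\<integral>x. u x \<partial>M) = 0" and \<epsilon>: "0 < \<epsilon>"
  obtains w L where "w \<in> borel_measurable M" "\<And>x. \<bar>w x\<bar> \<le> L" "0 \<le> L" "(\<integral>x. w x \<partial>M) = 0"
    "(\<integral>x. \<bar>u x - w x\<bar> \<partial>M) \<le> \<epsilon>"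
proof -
  have [measurable]: "u \<in> borel_measurable M" using u by auto
  define v where "v n x = max (- real n) (min (real n) (u x))" for n x
  have [measurable]: "v n \<in> borel_measurable M" for n unfolding v_def[abs_def] by measurable
  have vb: "\<bar>v n x\<bar> \<le> real n" for n x by (auto simp: v_def)
  have vi: "integrable M (v n)" for n
    by (rule integrable_const_bound[where B="real n"]) (auto simp: vb)
  have "(\<lambda>n. \<integral>x. \<bar>u x - v n x\<bar> \<partial>M) \<longlonglongrightarrow> (\<integral>x. 0 \<partial>M)"
  proof (rule integral_dominated_convergence)
    show "integrable M (\<lambda>x. \<bar>u x\<bar>)" using u by simp
    show "AE x in M. norm \<bar>u x - v n x\<bar> \<le> \<bar>u x\<bar>" for n
      by (intro AE_I2) (auto simp: v_def)
    have "(\<lambda>n. \<bar>u x - v n x\<bar>) \<longlonglongrightarrow> 0" for x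
    proof (rule tendsto_eventually)
      show "\<forall>\<^sub>F n in sequentially. \<bar>u x - v n x\<bar> = 0"
        using eventually_ge_at_top[of "nat \<lceil>\<bar>u x\<bar>\<rceil>"]
        by eventually_elim (auto simp: v_def min_def max_def nat_le_iff ceiling_le_iff)
    qed
    then show "AE x in M. (\<lambda>n. \<bar>u x - v n x\<bar>) \<longlonglongrightarrow> 0" by simp
  qed auto
  then have "\<forall>\<^sub>F n in sequentially. (\<integral>x. \<bar>u x - v n x\<bar> \<partial>M) < \<epsilon> / 2"
    using \<epsilon> by (intro order_tendstoD) auto
  then obtain n where n: "(\<integral>x. \<bar>u x - v n x\<bar> \<partial>M) < \<epsilon> / 2"
    by (auto simp: eventually_sequentially)
  define c where "c = (\<integral>x. v n x \<partial>M)"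
  have uv: "integrable M (\<lambda>x. u x - v n x)" using u vi by simp
  have "\<bar>c\<bar> = \<bar>\<integral>x. u x - v n x \<partial>M\<bar>"
    using u vi mean by (simp add: c_def)
  also have "\<dots> \<le> (\<integral>x. \<bar>u x - v n x\<bar> \<partial>M)" by (rule integral_abs_bound)
  finally have c: "\<bar>c\<bar> \<le> (\<integral>x. \<bar>u x - v n x\<bar> \<partial>M)" .
  have "(\<integral>x. \<bar>u x - (v n x - c)\<bar> \<partial>M) \<le> (\<integral>x. \<bar>u x - v n x\<bar> + \<bar>c\<bar> \<partial>M)"
    using uv u vi by (intro integral_mono) auto
  also have "\<dots> = (\<integral>x. \<bar>u x - v n x\<bar> \<partial>M) + \<bar>c\<bar>"
    using uv by (simp add: prob_space)
  also have "\<dots> \<le> \<epsilon>" using c n by linarith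
  finally have fin: "(\<integral>x. \<bar>u x - (v n x - c)\<bar> \<partial>M) \<le> \<epsilon>" .
  show ?thesis
  proof (rule that[of "\<lambda>x. v n x - c" "real n + \<bar>c\<bar>"])
    show "\<bar>v n x - c\<bar> \<le> real n + \<bar>c\<bar>" for x using vb[of n x] by linarith
    show "(\<integral>x. v n x - c \<partial>M) = 0" using vi by (simp add: c_def prob_space)
  qed (use fin in auto)
qed

section \<open>The characteristic function of the martingale part\<close>

context prob_space
begin

lemma
  fixes Z :: "'a \<Rightarrow> complex" and w :: "'a \<Rightarrow> real"
  assumes Z[measurable]: "Z \<in> borel_measurable M" and Z1: "\<And>x. norm (Z x) \<le> 1" and w: "integrable M w"
  shows integrable_bounded_mult: "integrable M (\<lambda>x. Z x * of_real (w x))"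
    and norm_integral_bounded_mult_le: "norm (\<integral>x. Z x * of_real (w x) \<partial>M) \<le> (\<integral>x. \<bar>w x\<bar> \<partial>M)"
proof -
  have [measurable]: "w \<in> borel_measurable M" using w by auto
  have le: "norm (Z x * of_real (w x)) \<le> \<bar>w x\<bar>" for x
    using mult_right_mono[OF Z1[of x], of "\<bar>w x\<bar>"] by (simp add: norm_mult)
  show i: "integrable M (\<lambda>x. Z x * of_real (w x))"
    by (rule Bochner_Integration.integrable_bound[OF w]) (auto simp: le)
  have "norm (\<integral>x. Z x * of_real (w x) \<partial>M) \<le> (\<integral>x. norm (Z x * of_real (w x)) \<partial>M)"
    by (rule integral_norm_bound)
  also have "\<dots> \<le> (\<integral>x. \<bar>w x\<bar> \<partial>M)"
    using i w by (intro integral_mono le) auto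
  finally show "norm (\<integral>x. Z x * of_real (w x) \<partial>M) \<le> (\<integral>x. \<bar>w x\<bar> \<partial>M)" .
qed

end

locale contracting_chain =
  contracting_kernel \<mu> P \<rho> + stationary_chain \<mu> P \<Omega> X
  for \<mu> :: "'a measure" and P \<rho> and \<Omega> :: "'w measure" and X
begin

lemma markov_integral_steps:
  fixes Z :: "'w \<Rightarrow> complex"
  assumes Z: "Z \<in> borel_measurable (\<F> j)" and Z1: "\<And>\<omega>. norm (Z \<omega>) \<le> 1" and u: "u \<in> L2 \<mu>"
  shows "(\<integral>\<omega>. Z \<omega> * of_real (u (X (j + m) \<omega>)) \<partial>\<Omega>)
       = (\<integral>\<omega>. Z \<omega> * of_real ((kernel_op P ^^ m) u (X j \<omega>)) \<partial>\<Omega>)"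
  using u
proof (induction m arbitrary: u)
  case (Suc m)
  have "(\<integral>\<omega>. Z \<omega> * of_real (u (X (Suc (j + m)) \<omega>)) \<partial>\<Omega>)
      = (\<integral>\<omega>. Z \<omega> * of_real (kernel_op P u (X (j + m) \<omega>)) \<partial>\<Omega>)"
    using Suc.prems
    by (intro markov_integral(2) history_measurable_mono[OF Z] L2_integrable
          \<Omega>.integrable_bounded_mult Z1 history_measurable_imp[OF Z] integrable_X) auto
  also have "\<dots> = (\<integral>\<omega>. Z \<omega> * of_real ((kernel_op P ^^ m) (kernel_op P u) (X j \<omega>)) \<partial>\<Omega>)"
    by (rule Suc.IH[OF kernel_op_L2[OF Suc.prems]])
  finally show ?case by (simp add: funpow_swap1)
qed simp

definition increment :: "('a \<Rightarrow> real) \<Rightarrow> nat \<Rightarrow> 'w \<Rightarrow> real" where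
  "increment g k \<omega> = g (X (Suc k) \<omega>) - kernel_op P g (X k \<omega>)"

definition martingale :: "('a \<Rightarrow> real) \<Rightarrow> nat \<Rightarrow> 'w \<Rightarrow> real" where
  "martingale g k \<omega> = (\<Sum>j<k. increment g j \<omega>)"

definition phase :: "('a \<Rightarrow> real) \<Rightarrow> real \<Rightarrow> nat \<Rightarrow> 'w \<Rightarrow> complex" where
  "phase g \<theta> k \<omega> = iexp (\<theta> * martingale g k \<omega>)"

definition conditional_variance :: "('a \<Rightarrow> real) \<Rightarrow> 'a \<Rightarrow> real" where
  "conditional_variance g x = kernel_op P (\<lambda>y. (g y)\<^sup>2) x - (kernel_op P g x)\<^sup>2"

context
  fixes g assumes g: "g \<in> L2 \<mu>"
begin

lemma g_measurable [measurable]: "g \<in> borel_measurable \<mu>"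
  using g by measurable

lemma increment_L2: "increment g k \<in> L2 \<Omega>"
  unfolding increment_def[abs_def] by (intro L2_diff L2_X g kernel_op_L2)

lemma increment_norm_le: "L2_norm \<Omega> (increment g k) \<le> 2 * L2_norm \<mu> g"
proof -
  have "L2_norm \<Omega> (increment g k)
      \<le> L2_norm \<Omega> (\<lambda>\<omega>. g (X (Suc k) \<omega>)) + L2_norm \<Omega> (\<lambda>\<omega>. kernel_op P g (X k \<omega>))"
    unfolding increment_def[abs_def] by (intro L2_norm_triangle_diff L2_X g kernel_op_L2)
  then show ?thesis
    using L2_norm_kernel_op_le[OF g] by (simp add: L2_norm_X g kernel_op_L2)
qed

lemma increment_history_measurable: "j < k \<Longrightarrow> increment g j \<in> borel_measurable (\<F> k)"
  unfolding increment_def[abs_def]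
  by (intro borel_measurable_diff measurable_compose[OF X_history_measurable]) auto

lemma martingale_history_measurable: "martingale g k \<in> borel_measurable (\<F> k)"
  unfolding martingale_def[abs_def] by (intro borel_measurable_sum increment_history_measurable) auto

lemma martingale_measurable [measurable]: "martingale g k \<in> borel_measurable \<Omega>"
  using martingale_history_measurable by (rule history_measurable_imp)

lemma martingale_L2: "martingale g k \<in> L2 \<Omega>"
  unfolding martingale_def[abs_def] by (intro L2_sum increment_L2)

lemma phase_history_measurable: "phase g \<theta> k \<in> borel_measurable (\<F> k)"
  unfolding phase_def[abs_def] using martingale_history_measurable[of k] by measurable

lemma phase_measurable [measurable]: "phase g \<theta> k \<in> borel_measurable \<Omega>"
  using phase_history_measurable by (rule history_measurable_imp)

lemma norm_phase: "norm (phase g \<theta> k \<omega>) = 1"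
  by (simp add: phase_def)

lemma phase_integrable: "integrable \<Omega> (phase g \<theta> k)"
  by (rule \<Omega>.integrable_const_bound[where B = 1]) (auto simp: norm_phase)

lemma conditional_variance_integrable: "integrable \<mu> (conditional_variance g)"
  unfolding conditional_variance_def[abs_def]
  by (intro Bochner_Integration.integrable_diff kernel_op_integrable L2_square_integrable kernel_op_L2 g)

lemma conditional_variance_integral:
  "(\<integral>x. conditional_variance g x \<partial>\<mu>) = martingale_variance g"
  unfolding conditional_variance_def martingale_variance_def L2_norm_power2
  using L2_square_integrable[OF g] L2_square_integrable[OF kernel_op_L2[OF g]]
  by (simp add: kernel_op_integrable integral_kernel_op)

text \<open>The first two conditional moments of a martingale increment, tested against bounded functions of
  the past. In the mixed term of the square the factor \<open>(P g) (X\<^sub>k)\<close> belongs to the past, so it is moved into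
  the test function; there it meets \<open>g (X\<^sub>k\<^sub>+\<^sub>1)\<close>, which the Markov property turns into a second
  \<open>(P g) (X\<^sub>k)\<close>.\<close>

lemma
  fixes Z :: "'w \<Rightarrow> complex"
  assumes Z: "Z \<in> borel_measurable (\<F> k)" and Z1: "\<And>\<omega>. norm (Z \<omega>) \<le> 1"
  shows increment_cond_mean: "(\<integral>\<omega>. Z \<omega> * of_real (increment g k \<omega>) \<partial>\<Omega>) = 0"
    and increment_cond_square: "(\<integral>\<omega>. Z \<omega> * of_real ((increment g k \<omega>)\<^sup>2) \<partial>\<Omega>)
      = (\<integral>\<omega>. Z \<omega> * of_real (conditional_variance g (X k \<omega>)) \<partial>\<Omega>)"
proof -
  let ?b = "kernel_op P g"
  note b = kernel_op_L2[OF g]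
  note Z\<Omega>[measurable] = history_measurable_imp[OF Z]
  note bm = \<Omega>.integrable_bounded_mult[OF Z\<Omega> Z1]
  note i1 = bm[OF integrable_X[OF L2_integrable[OF g], of "Suc k"]]
  note i2 = bm[OF integrable_X[OF L2_integrable[OF b], of k]]
  note m1 = markov_integral[OF Z L2_integrable[OF g] i1]
  show "(\<integral>\<omega>. Z \<omega> * of_real (increment g k \<omega>) \<partial>\<Omega>) = 0"
    unfolding increment_def of_real_diff right_diff_distrib
    using m1(2) i1 i2 by simp
  note i3 = bm[OF integrable_X[OF L2_square_integrable[OF g], of "Suc k"]]
  note m3 = markov_integral[OF Z L2_square_integrable[OF g] i3]
  have Zb: "(\<lambda>\<omega>. Z \<omega> * of_real (?b (X k \<omega>))) \<in> borel_measurable (\<F> k)"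
    by (intro borel_measurable_times Z borel_measurable_of_real measurable_compose[OF X_history_measurable]) auto
  have "integrable \<Omega> (\<lambda>\<omega>. ?b (X k \<omega>) * g (X (Suc k) \<omega>))"
    by (intro L2_mult_integrable L2_X b g)
  from bm[OF this]
  have i4: "integrable \<Omega> (\<lambda>\<omega>. (Z \<omega> * of_real (?b (X k \<omega>))) * of_real (g (X (Suc k) \<omega>)))"
    by (simp add: mult.assoc)
  note m4 = markov_integral[OF Zb L2_integrable[OF g] i4]
  have "(\<lambda>\<omega>. Z \<omega> * of_real ((increment g k \<omega>)\<^sup>2))
      = (\<lambda>\<omega>. Z \<omega> * of_real ((g (X (Suc k) \<omega>))\<^sup>2)
        - 2 * ((Z \<omega> * of_real (?b (X k \<omega>))) * of_real (g (X (Suc k) \<omega>)))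
        + (Z \<omega> * of_real (?b (X k \<omega>))) * of_real (?b (X k \<omega>)))"
    by (auto simp: increment_def power2_eq_square algebra_simps)
  then have "(\<integral>\<omega>. Z \<omega> * of_real ((increment g k \<omega>)\<^sup>2) \<partial>\<Omega>)
      = (\<integral>\<omega>. Z \<omega> * of_real (kernel_op P (\<lambda>y. (g y)\<^sup>2) (X k \<omega>)) \<partial>\<Omega>)
        - 2 * (\<integral>\<omega>. (Z \<omega> * of_real (?b (X k \<omega>))) * of_real (?b (X k \<omega>)) \<partial>\<Omega>)
        + (\<integral>\<omega>. (Z \<omega> * of_real (?b (X k \<omega>))) * of_real (?b (X k \<omega>)) \<partial>\<Omega>)"
    using i3 i4 m3 m4 by simp
  also have "\<dots> = (\<integral>\<omega>. Z \<omega> * of_real (kernel_op P (\<lambda>y. (g y)\<^sup>2) (X k \<omega>))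
        - (Z \<omega> * of_real (?b (X k \<omega>))) * of_real (?b (X k \<omega>)) \<partial>\<Omega>)"
    using m3 m4 by simp
  also have "\<dots> = (\<integral>\<omega>. Z \<omega> * of_real (conditional_variance g (X k \<omega>)) \<partial>\<Omega>)"
    by (intro Bochner_Integration.integral_cong)
       (auto simp: conditional_variance_def power2_eq_square algebra_simps)
  finally show "(\<integral>\<omega>. Z \<omega> * of_real ((increment g k \<omega>)\<^sup>2) \<partial>\<Omega>)
      = (\<integral>\<omega>. Z \<omega> * of_real (conditional_variance g (X k \<omega>)) \<partial>\<Omega>)" .
qed

text \<open>One step of the recursion for the characteristic function. Conditionally on the past, the
  linear term of the expansion of \<open>exp (\<i> \<theta> h)\<close> has mean zero and the quadratic one has mean
  \<open>- \<theta>\<^sup>2 V / 2\<close> with \<open>V\<close> the conditional variance at the current state. Replacing \<open>V\<close> by its mean costs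
  the first error term, the Taylor remainder the second.\<close>

lemma phase_step:
  "norm ((\<integral>\<omega>. phase g \<theta> (Suc k) \<omega> \<partial>\<Omega>)
      - of_real (1 - \<theta>\<^sup>2 * martingale_variance g / 2) * (\<integral>\<omega>. phase g \<theta> k \<omega> \<partial>\<Omega>))
    \<le> \<theta>\<^sup>2 / 2 * norm (\<integral>\<omega>. phase g \<theta> k \<omega> * of_real (conditional_variance g (X k \<omega>) - martingale_variance g) \<partial>\<Omega>)
      + 8 * ((\<integral>x. taylor_bound (\<theta> * g x) \<partial>\<mu>) + (\<integral>x. taylor_bound (\<theta> * kernel_op P g x) \<partial>\<mu>))"
proof -
  let ?Z = "phase g \<theta> k" and ?h = "increment g k" and ?v = "martingale_variance g"
  let ?V = "conditional_variance g"
  define R where "R \<omega> = iexp (\<theta> * ?h \<omega>) - (1 + \<i> * of_real (\<theta> * ?h \<omega>) - of_real ((\<theta> * ?h \<omega>)\<^sup>2) / 2)" for \<omega>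
  have hm[measurable]: "?h \<in> borel_measurable \<Omega>" using increment_L2 by measurable
  have Rm[measurable]: "R \<in> borel_measurable \<Omega>" unfolding R_def[abs_def] by measurable
  note bm = \<Omega>.integrable_bounded_mult[OF phase_measurable norm_phase[THEN eq_refl]]
  note i1 = bm[OF \<Omega>.L2_integrable[OF increment_L2[of k]], of \<theta> k]
  note i2 = bm[OF L2_square_integrable[OF increment_L2[of k]], of \<theta> k]
  have iT: "integrable \<Omega> (\<lambda>\<omega>. taylor_bound (\<theta> * ?h \<omega>))"
    by (rule L2_taylor_bound_integrable[OF increment_L2])
  have Rle: "norm (R \<omega>) \<le> taylor_bound (\<theta> * ?h \<omega>)" for \<omega>
    unfolding R_def by (rule iexp_taylor)
  have ZR: "integrable \<Omega> (\<lambda>\<omega>. ?Z \<omega> * R \<omega>)"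
    by (rule Bochner_Integration.integrable_bound[OF iT])
       (use Rle in \<open>auto simp: norm_mult norm_phase taylor_bound_nonneg\<close>)
  have "phase g \<theta> (Suc k) \<omega> = ?Z \<omega> + (\<i> * of_real \<theta>) * (?Z \<omega> * of_real (?h \<omega>))
      - of_real (\<theta>\<^sup>2 / 2) * (?Z \<omega> * of_real ((?h \<omega>)\<^sup>2)) + ?Z \<omega> * R \<omega>" for \<omega>
  proof -
    have "phase g \<theta> (Suc k) \<omega> = ?Z \<omega> * iexp (\<theta> * ?h \<omega>)"
      by (simp add: phase_def martingale_def distrib_left flip: exp_add)
    also have "iexp (\<theta> * ?h \<omega>) = R \<omega> + (1 + \<i> * of_real (\<theta> * ?h \<omega>) - of_real ((\<theta> * ?h \<omega>)\<^sup>2) / 2)"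
      by (simp add: R_def)
    finally show ?thesis by (simp add: power2_eq_square algebra_simps)
  qed
  then have "(\<integral>\<omega>. phase g \<theta> (Suc k) \<omega> \<partial>\<Omega>)
      = (\<integral>\<omega>. ?Z \<omega> + (\<i> * of_real \<theta>) * (?Z \<omega> * of_real (?h \<omega>))
        - of_real (\<theta>\<^sup>2 / 2) * (?Z \<omega> * of_real ((?h \<omega>)\<^sup>2)) + ?Z \<omega> * R \<omega> \<partial>\<Omega>)"
    by simp
  also have "\<dots> = (\<integral>\<omega>. ?Z \<omega> \<partial>\<Omega>) + (\<i> * of_real \<theta>) * (\<integral>\<omega>. ?Z \<omega> * of_real (?h \<omega>) \<partial>\<Omega>)
        - of_real (\<theta>\<^sup>2 / 2) * (\<integral>\<omega>. ?Z \<omega> * of_real ((?h \<omega>)\<^sup>2) \<partial>\<Omega>) + (\<integral>\<omega>. ?Z \<omega> * R \<omega> \<partial>\<Omega>)"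
    using phase_integrable[of \<theta> k] i1 i2 ZR
    by (simp del: of_real_divide of_real_power)
  also have "(\<integral>\<omega>. ?Z \<omega> * of_real (?h \<omega>) \<partial>\<Omega>) = 0"
    by (rule increment_cond_mean[OF phase_history_measurable]) (simp add: norm_phase)
  also have "(\<integral>\<omega>. ?Z \<omega> * of_real ((?h \<omega>)\<^sup>2) \<partial>\<Omega>) = (\<integral>\<omega>. ?Z \<omega> * of_real (?V (X k \<omega>)) \<partial>\<Omega>)"
    by (rule increment_cond_square[OF phase_history_measurable]) (simp add: norm_phase)
  finally have step: "(\<integral>\<omega>. phase g \<theta> (Suc k) \<omega> \<partial>\<Omega>) = (\<integral>\<omega>. ?Z \<omega> \<partial>\<Omega>)
      - of_real (\<theta>\<^sup>2 / 2) * (\<integral>\<omega>. ?Z \<omega> * of_real (?V (X k \<omega>)) \<partial>\<Omega>) + (\<integral>\<omega>. ?Z \<omega> * R \<omega> \<partial>\<Omega>)"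
    by simp
  have iV: "integrable \<Omega> (\<lambda>\<omega>. ?Z \<omega> * of_real (?V (X k \<omega>)))"
    by (intro bm integrable_X conditional_variance_integrable)
  have "(\<integral>\<omega>. ?Z \<omega> * of_real (?V (X k \<omega>) - ?v) \<partial>\<Omega>)
      = (\<integral>\<omega>. ?Z \<omega> * of_real (?V (X k \<omega>)) - ?Z \<omega> * of_real ?v \<partial>\<Omega>)"
    by (simp add: right_diff_distrib)
  also have "\<dots> = (\<integral>\<omega>. ?Z \<omega> * of_real (?V (X k \<omega>)) \<partial>\<Omega>) - (\<integral>\<omega>. ?Z \<omega> \<partial>\<Omega>) * of_real ?v"
    using iV phase_integrable[of \<theta> k] by simp
  finally have centre: "(\<integral>\<omega>. ?Z \<omega> * of_real (?V (X k \<omega>) - ?v) \<partial>\<Omega>)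
      = (\<integral>\<omega>. ?Z \<omega> * of_real (?V (X k \<omega>)) \<partial>\<Omega>) - (\<integral>\<omega>. ?Z \<omega> \<partial>\<Omega>) * of_real ?v" .
  have eq: "(\<integral>\<omega>. phase g \<theta> (Suc k) \<omega> \<partial>\<Omega>)
      - of_real (1 - \<theta>\<^sup>2 * ?v / 2) * (\<integral>\<omega>. ?Z \<omega> \<partial>\<Omega>)
    = (\<integral>\<omega>. ?Z \<omega> * R \<omega> \<partial>\<Omega>) - of_real (\<theta>\<^sup>2 / 2) * (\<integral>\<omega>. ?Z \<omega> * of_real (?V (X k \<omega>) - ?v) \<partial>\<Omega>)"
    unfolding step centre by (simp add: algebra_simps)
  have remainder: "norm (\<integral>\<omega>. ?Z \<omega> * R \<omega> \<partial>\<Omega>)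
      \<le> 8 * ((\<integral>x. taylor_bound (\<theta> * g x) \<partial>\<mu>) + (\<integral>x. taylor_bound (\<theta> * kernel_op P g x) \<partial>\<mu>))"
  proof -
    have "norm (\<integral>\<omega>. ?Z \<omega> * R \<omega> \<partial>\<Omega>) \<le> (\<integral>\<omega>. norm (?Z \<omega> * R \<omega>) \<partial>\<Omega>)"
      by (rule integral_norm_bound)
    also have "\<dots> \<le> (\<integral>\<omega>. 8 * (taylor_bound (\<theta> * g (X (Suc k) \<omega>)) + taylor_bound (\<theta> * kernel_op P g (X k \<omega>))) \<partial>\<Omega>)"
    proof (rule integral_mono)
      show "integrable \<Omega> (\<lambda>\<omega>. norm (?Z \<omega> * R \<omega>))" using ZR by simp
      show "integrable \<Omega> (\<lambda>\<omega>. 8 * (taylor_bound (\<theta> * g (X (Suc k) \<omega>)) + taylor_bound (\<theta> * kernel_op P g (X k \<omega>))))"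
        by (intro integrable_mult_right Bochner_Integration.integrable_add L2_taylor_bound_integrable L2_X g kernel_op_L2)
      show "norm (?Z \<omega> * R \<omega>) \<le> 8 * (taylor_bound (\<theta> * g (X (Suc k) \<omega>)) + taylor_bound (\<theta> * kernel_op P g (X k \<omega>)))" for \<omega>
        using order_trans[OF Rle[of \<omega>], of "8 * (taylor_bound (\<theta> * g (X (Suc k) \<omega>)) + taylor_bound (\<theta> * kernel_op P g (X k \<omega>)))"]
          taylor_bound_diff[of "\<theta> * g (X (Suc k) \<omega>)" "\<theta> * kernel_op P g (X k \<omega>)"]
        by (simp add: norm_mult norm_phase increment_def right_diff_distrib)
    qed
    also have "\<dots> = 8 * ((\<integral>\<omega>. taylor_bound (\<theta> * g (X (Suc k) \<omega>)) \<partial>\<Omega>) + (\<integral>\<omega>. taylor_bound (\<theta> * kernel_op P g (X k \<omega>)) \<partial>\<Omega>))"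
      using L2_taylor_bound_integrable[OF L2_X[OF g], of \<theta> "Suc k"]
        L2_taylor_bound_integrable[OF L2_X[OF kernel_op_L2[OF g]], of \<theta> k] by simp
    finally show ?thesis
      using integral_X[OF L2_taylor_bound_integrable[OF g], of \<theta> "Suc k"]
        integral_X[OF L2_taylor_bound_integrable[OF kernel_op_L2[OF g]], of \<theta> k] by simp
  qed
  have "norm (of_real (\<theta>\<^sup>2 / 2) * (\<integral>\<omega>. ?Z \<omega> * of_real (?V (X k \<omega>) - ?v) \<partial>\<Omega>))
      = \<theta>\<^sup>2 / 2 * norm (\<integral>\<omega>. ?Z \<omega> * of_real (?V (X k \<omega>) - ?v) \<partial>\<Omega>)"
    unfolding norm_mult norm_of_real by simp
  then show ?thesis
    unfolding eq
    using norm_triangle_ineq4[of "\<integral>\<omega>. ?Z \<omega> * R \<omega> \<partial>\<Omega>"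
        "of_real (\<theta>\<^sup>2 / 2) * (\<integral>\<omega>. ?Z \<omega> * of_real (?V (X k \<omega>) - ?v) \<partial>\<Omega>)"] remainder
    by linarith
qed

text \<open>The first error term counts the change of the exponential over \<open>m\<close> steps, at most
  \<open>\<bar>\<theta>\<bar>\<close> times the sum of \<open>m\<close> increments in absolute value. Once the exponential is frozen at time
  \<open>k - m\<close>, the Markov property turns \<open>w\<close> into \<open>P\<^sup>m w\<close>, of norm at most \<open>\<rho>\<^sup>m L\<close>.\<close>

lemma phase_decorrelation:
  assumes w[measurable]: "w \<in> borel_measurable \<mu>" and wL: "\<And>x. \<bar>w x\<bar> \<le> L" and w0: "(\<integral>x. w x \<partial>\<mu>) = 0"
    and mk: "m \<le> k"
  shows "norm (\<integral>\<omega>. phase g \<theta> k \<omega> * of_real (w (X k \<omega>)) \<partial>\<Omega>)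
    \<le> L * (\<bar>\<theta>\<bar> * (real m * (2 * L2_norm \<mu> g))) + \<rho> ^ m * L"
proof -
  define j where "j = k - m"
  have k: "k = j + m" using mk by (simp add: j_def)
  have L0: "0 \<le> L" using wL[of undefined] by linarith
  have wL2: "w \<in> L2 \<mu>" by (rule L2_bounded[OF w wL])
  have wi: "integrable \<Omega> (\<lambda>\<omega>. w (X k \<omega>))" by (intro integrable_X L2_integrable wL2)
  let ?Z = "phase g \<theta> k" and ?Z' = "phase g \<theta> j"
  note bm = \<Omega>.integrable_bounded_mult[OF phase_measurable norm_phase[THEN eq_refl] wi]
  have diff: "norm (?Z \<omega> - ?Z' \<omega>) \<le> \<bar>\<theta>\<bar> * (\<Sum>i\<in>{j..<k}. \<bar>increment g i \<omega>\<bar>)" for \<omega>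
  proof -
    have "martingale g k \<omega> - martingale g j \<omega> = (\<Sum>i\<in>{j..<k}. increment g i \<omega>)"
      using k sum_diff_nat_ivl[of 0 j k "\<lambda>i. increment g i \<omega>"]
      by (simp add: martingale_def lessThan_atLeast0)
    then have "\<bar>\<theta> * martingale g k \<omega> - \<theta> * martingale g j \<omega>\<bar> = \<bar>\<theta>\<bar> * \<bar>\<Sum>i\<in>{j..<k}. increment g i \<omega>\<bar>"
      by (simp flip: right_diff_distrib add: abs_mult)
    also have "\<dots> \<le> \<bar>\<theta>\<bar> * (\<Sum>i\<in>{j..<k}. \<bar>increment g i \<omega>\<bar>)"
      by (intro mult_left_mono sum_abs) auto
    finally show ?thesis
      unfolding phase_def using norm_iexp_diff_le order_trans by blast
  qed
  have ii: "integrable \<Omega> (\<lambda>\<omega>. \<bar>increment g i \<omega>\<bar>)" for i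
    using \<Omega>.L2_integrable[OF increment_L2] by simp
  have "norm (\<integral>\<omega>. (?Z \<omega> - ?Z' \<omega>) * of_real (w (X k \<omega>)) \<partial>\<Omega>)
      \<le> (\<integral>\<omega>. norm ((?Z \<omega> - ?Z' \<omega>) * of_real (w (X k \<omega>))) \<partial>\<Omega>)"
    by (rule integral_norm_bound)
  also have "\<dots> \<le> (\<integral>\<omega>. L * (\<bar>\<theta>\<bar> * (\<Sum>i\<in>{j..<k}. \<bar>increment g i \<omega>\<bar>)) \<partial>\<Omega>)"
  proof (rule integral_mono)
    show "integrable \<Omega> (\<lambda>\<omega>. norm ((?Z \<omega> - ?Z' \<omega>) * of_real (w (X k \<omega>))))"
      using bm[of \<theta> k] bm[of \<theta> j] by (intro integrable_norm) (simp add: left_diff_distrib)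
    show "integrable \<Omega> (\<lambda>\<omega>. L * (\<bar>\<theta>\<bar> * (\<Sum>i\<in>{j..<k}. \<bar>increment g i \<omega>\<bar>)))"
      using ii by simp
    show "norm ((?Z \<omega> - ?Z' \<omega>) * of_real (w (X k \<omega>))) \<le> L * (\<bar>\<theta>\<bar> * (\<Sum>i\<in>{j..<k}. \<bar>increment g i \<omega>\<bar>))" for \<omega>
      unfolding norm_mult norm_of_real mult.commute[of L]
      by (intro mult_mono diff wL) (auto simp: sum_nonneg)
  qed
  also have "\<dots> = L * (\<bar>\<theta>\<bar> * (\<Sum>i\<in>{j..<k}. \<integral>\<omega>. \<bar>increment g i \<omega>\<bar> \<partial>\<Omega>))"
    using ii by simp
  also have "\<dots> \<le> L * (\<bar>\<theta>\<bar> * (\<Sum>i\<in>{j..<k}. 2 * L2_norm \<mu> g))"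
    by (intro mult_left_mono sum_mono order_trans[OF \<Omega>.integral_abs_le_L2_norm[OF increment_L2] increment_norm_le] L0) auto
  also have "\<dots> = L * (\<bar>\<theta>\<bar> * (real m * (2 * L2_norm \<mu> g)))"
    by (simp add: k)
  finally have 1: "norm (\<integral>\<omega>. (?Z \<omega> - ?Z' \<omega>) * of_real (w (X k \<omega>)) \<partial>\<Omega>)
      \<le> L * (\<bar>\<theta>\<bar> * (real m * (2 * L2_norm \<mu> g)))" .
  have "norm (\<integral>\<omega>. ?Z' \<omega> * of_real (w (X k \<omega>)) \<partial>\<Omega>)
      = norm (\<integral>\<omega>. ?Z' \<omega> * of_real ((kernel_op P ^^ m) w (X j \<omega>)) \<partial>\<Omega>)"
    unfolding k by (subst markov_integral_steps[OF phase_history_measurable _ wL2]) (auto simp: norm_phase)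
  also have "\<dots> \<le> (\<integral>\<omega>. \<bar>(kernel_op P ^^ m) w (X j \<omega>)\<bar> \<partial>\<Omega>)"
    by (intro \<Omega>.norm_integral_bounded_mult_le phase_measurable integrable_X L2_integrable kernel_op_power_L2 wL2)
       (simp add: norm_phase)
  also have "\<dots> = (\<integral>x. \<bar>(kernel_op P ^^ m) w x\<bar> \<partial>\<mu>)"
    by (rule integral_X) (intro integrable_abs L2_integrable kernel_op_power_L2 wL2)
  also have "\<dots> \<le> L2_norm \<mu> ((kernel_op P ^^ m) w)"
    by (intro integral_abs_le_L2_norm kernel_op_power_L2 wL2)
  also have "\<dots> \<le> \<rho> ^ m * L2_norm \<mu> w"
    by (intro L2_norm_kernel_op_power_le wL2 w0)
  also have "\<dots> \<le> \<rho> ^ m * L"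
  proof (intro mult_left_mono)
    have "L2_norm \<mu> w \<le> L2_norm \<mu> (\<lambda>x. L)"
      using wL L0 by (intro L2_norm_mono_AE wL2 L2_const) auto
    then show "L2_norm \<mu> w \<le> L" using L0 by (simp add: L2_norm_def prob_space)
  qed (simp add: rate_nonneg)
  finally have 2: "norm (\<integral>\<omega>. ?Z' \<omega> * of_real (w (X k \<omega>)) \<partial>\<Omega>) \<le> \<rho> ^ m * L" .
  have "(\<integral>\<omega>. ?Z \<omega> * of_real (w (X k \<omega>)) \<partial>\<Omega>)
      = (\<integral>\<omega>. (?Z \<omega> - ?Z' \<omega>) * of_real (w (X k \<omega>)) \<partial>\<Omega>) + (\<integral>\<omega>. ?Z' \<omega> * of_real (w (X k \<omega>)) \<partial>\<Omega>)"
    using bm[of \<theta> k] bm[of \<theta> j] by (simp add: left_diff_distrib)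
  then show ?thesis
    using norm_triangle_ineq[of "\<integral>\<omega>. (?Z \<omega> - ?Z' \<omega>) * of_real (w (X k \<omega>)) \<partial>\<Omega>"
        "\<integral>\<omega>. ?Z' \<omega> * of_real (w (X k \<omega>)) \<partial>\<Omega>"] 1 2 by simp
qed

end

end

section \<open>The central limit theorem\<close>

lemma real_distribution_centered_normal: "0 \<le> v \<Longrightarrow> real_distribution (centered_normal v)"
  unfolding centered_normal_def real_distribution_def real_distribution_axioms_def
  by (auto simp: prob_space_return intro!: prob_space_normal_density)

lemma char_centered_normal:
  assumes "0 \<le> v"
  shows "char (centered_normal v) t = of_real (exp (- (t\<^sup>2 * v) / 2))"
proof (cases "v = 0")
  case True
  have "(\<integral>x. iexp (t * x) \<partial>return borel 0) = iexp (t * 0)"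
    by (rule integral_return) auto
  then show ?thesis by (simp add: True centered_normal_def char_def)
next
  case False
  with assms have v: "0 < v" by simp
  interpret N: prob_space std_normal_distribution
    by (rule prob_space_normal_density) simp
  have "distributed std_normal_distribution lborel (\<lambda>x. x) std_normal_density"
    unfolding distributed_def
    by (auto intro!: measure_eqI simp: emeasure_distr emeasure_density)
  then have "distributed std_normal_distribution lborel (\<lambda>x. 0 + sqrt v * x)
      (normal_density (0 + sqrt v * 0) (\<bar>sqrt v\<bar> * 1))"
    using v by (intro N.normal_density_affine) auto
  then have "centered_normal v = distr std_normal_distribution lborel (\<lambda>x. sqrt v * x)"
    using v by (simp add: distributed_def centered_normal_def)
  also have "\<dots> = distr std_normal_distribution borel (\<lambda>x. sqrt v * x)"
    by (rule distr_cong) auto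
  finally have "char (centered_normal v) t = char std_normal_distribution (t * sqrt v)"
    by (simp add: char_def integral_distr mult.assoc)
  then show ?thesis
    using v by (simp add: char_std_normal_distribution power_mult_distrib)
qed

context contracting_chain
begin

text \<open>The martingale central limit theorem. The errors of \<open>phase_step\<close> are summed over \<open>k < n\<close>. As
  \<open>\<theta>\<^sup>2 = t\<^sup>2 / n\<close>, the sum of the variance errors is \<open>t\<^sup>2 / 2\<close> times an average, to which the first
  \<open>m\<close> steps contribute \<open>O(m / n)\<close> and the others are estimated by \<open>phase_decorrelation\<close>.\<close>

lemma phase_tendsto:
  assumes g: "g \<in> L2 \<mu>"
  shows "(\<lambda>n. \<integral>\<omega>. phase g (t / sqrt n) n \<omega> \<partial>\<Omega>)
    \<longlonglongrightarrow> of_real (exp (- (t\<^sup>2 * martingale_variance g) / 2))"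
proof -
  let ?v = "martingale_variance g" and ?b = "kernel_op P g" and ?G = "2 * L2_norm \<mu> g"
  let ?U = "\<lambda>x. conditional_variance g x - ?v"
  define \<psi> where "\<psi> n k = (\<integral>\<omega>. phase g (t / sqrt (real n)) k \<omega> \<partial>\<Omega>)" for n k
  define a where "a n = complex_of_real (1 - (t / sqrt (real n))\<^sup>2 * ?v / 2)" for n
  define T where "T n = real n * (\<integral>x. taylor_bound (t / sqrt (real n) * g x) \<partial>\<mu>)
    + real n * (\<integral>x. taylor_bound (t / sqrt (real n) * ?b x) \<partial>\<mu>)" for n
  have v: "0 \<le> ?v" by (rule martingale_variance_nonneg[OF g])
  have G: "0 \<le> ?G" by (simp add: L2_norm_nonneg)
  have T: "T \<longlonglongrightarrow> 0 + 0"
    unfolding T_def[abs_def] by (intro tendsto_add L2_taylor_bound_tendsto g kernel_op_L2)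
  have Ui: "integrable \<mu> ?U"
    using conditional_variance_integrable[OF g] by simp
  have U0: "(\<integral>x. ?U x \<partial>\<mu>) = 0"
    using conditional_variance_integrable[OF g] by (simp add: conditional_variance_integral g prob_space)
  have sqrt0: "(\<lambda>n. 1 / sqrt (real n)) \<longlonglongrightarrow> 0"
    by (intro tendsto_divide_0[OF tendsto_const] filterlim_at_top_imp_at_infinity
          filterlim_compose[OF sqrt_at_top] filterlim_real_sequentially)
  have D: "(\<lambda>n. norm (\<psi> n n - a n ^ n)) \<longlonglongrightarrow> 0"
  proof (rule tendsto_zero_approx)
    fix \<epsilon> :: real assume \<epsilon>: "0 < \<epsilon>"
    (* The error budget: a quarter of epsilon for the L1 approximation of the conditional variance
       (delta), a quarter for the forgetting over m steps; the rest vanishes as n grows. *)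
    define \<delta> where "\<delta> = \<epsilon> / (2 * (t\<^sup>2 + 1))"
    have t1: "0 < t\<^sup>2 + 1" by (simp add: add_nonneg_pos)
    have \<delta>: "0 < \<delta>" unfolding \<delta>_def using \<epsilon> t1 by simp
    have \<delta>2: "t\<^sup>2 / 2 * \<delta> \<le> \<epsilon> / 4"
      unfolding \<delta>_def using \<epsilon> t1 by (simp add: divide_simps)
    obtain w L where w[measurable]: "w \<in> borel_measurable \<mu>" and wL: "\<And>x. \<bar>w x\<bar> \<le> L"
      and L: "0 \<le> L" and w0: "(\<integral>x. w x \<partial>\<mu>) = 0" and Uw: "(\<integral>x. \<bar>?U x - w x\<bar> \<partial>\<mu>) \<le> \<delta>"
      using bounded_mean_zero_approx[OF Ui U0 \<delta>] by blast
    have "(\<lambda>m. t\<^sup>2 / 2 * (\<rho> ^ m * L)) \<longlonglongrightarrow> 0"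
      using rate_nonneg rate_less_1
      by (intro tendsto_mult_right_zero tendsto_mult_left_zero LIMSEQ_realpow_zero) auto
    from order_tendstoD(2)[OF this, of "\<epsilon> / 4"]
    have "\<forall>\<^sub>F m in sequentially. t\<^sup>2 / 2 * (\<rho> ^ m * L) < \<epsilon> / 4"
      using \<epsilon> by simp
    then obtain m where m: "t\<^sup>2 / 2 * (\<rho> ^ m * L) < \<epsilon> / 4"
      by (auto simp: eventually_sequentially)
    define e where "e n = t\<^sup>2 / 2 * (\<delta> + real m * L / real n
        + L * (\<bar>t\<bar> * (1 / sqrt (real n)) * (real m * ?G)) + \<rho> ^ m * L) + 8 * T n" for n
    have wi: "integrable \<mu> w" by (rule L2_integrable[OF L2_bounded[OF w wL]])
    have corr: "norm (\<integral>\<omega>. phase g \<theta> k \<omega> * of_real (?U (X k \<omega>)) \<partial>\<Omega>)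
        \<le> \<delta> + (L * (\<bar>\<theta>\<bar> * (real m * ?G)) + \<rho> ^ m * L) + (if k < m then L else 0)" for \<theta> k
    proof -
      have Z1: "norm (phase g \<theta> k \<omega>) \<le> 1" for \<omega> by (simp add: norm_phase g)
      note ph = phase_measurable[OF g, of \<theta> k]
      have iUw: "integrable \<Omega> (\<lambda>\<omega>. ?U (X k \<omega>) - w (X k \<omega>))"
        using integrable_X[of "\<lambda>x. ?U x - w x" k] Ui wi by simp
      have iw: "integrable \<Omega> (\<lambda>\<omega>. w (X k \<omega>))" using wi by (rule integrable_X)
      have "(\<integral>\<omega>. phase g \<theta> k \<omega> * of_real (?U (X k \<omega>)) \<partial>\<Omega>)
          = (\<integral>\<omega>. phase g \<theta> k \<omega> * of_real (?U (X k \<omega>) - w (X k \<omega>)) + phase g \<theta> k \<omega> * of_real (w (X k \<omega>)) \<partial>\<Omega>)"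
        by (simp add: algebra_simps)
      also have "\<dots> = (\<integral>\<omega>. phase g \<theta> k \<omega> * of_real (?U (X k \<omega>) - w (X k \<omega>)) \<partial>\<Omega>)
          + (\<integral>\<omega>. phase g \<theta> k \<omega> * of_real (w (X k \<omega>)) \<partial>\<Omega>)"
        by (intro Bochner_Integration.integral_add \<Omega>.integrable_bounded_mult ph Z1 iUw iw)
      finally have split: "(\<integral>\<omega>. phase g \<theta> k \<omega> * of_real (?U (X k \<omega>)) \<partial>\<Omega>)
          = (\<integral>\<omega>. phase g \<theta> k \<omega> * of_real (?U (X k \<omega>) - w (X k \<omega>)) \<partial>\<Omega>)
          + (\<integral>\<omega>. phase g \<theta> k \<omega> * of_real (w (X k \<omega>)) \<partial>\<Omega>)" .
      have "norm (\<integral>\<omega>. phase g \<theta> k \<omega> * of_real (?U (X k \<omega>) - w (X k \<omega>)) \<partial>\<Omega>)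
          \<le> (\<integral>\<omega>. \<bar>?U (X k \<omega>) - w (X k \<omega>)\<bar> \<partial>\<Omega>)"
        by (intro \<Omega>.norm_integral_bounded_mult_le ph Z1 iUw)
      also have "\<dots> = (\<integral>x. \<bar>?U x - w x\<bar> \<partial>\<mu>)"
        using Ui wi by (intro integral_X[of "\<lambda>x. \<bar>?U x - w x\<bar>"]) simp
      finally have 1: "norm (\<integral>\<omega>. phase g \<theta> k \<omega> * of_real (?U (X k \<omega>) - w (X k \<omega>)) \<partial>\<Omega>) \<le> \<delta>"
        using Uw by simp
      have 2: "norm (\<integral>\<omega>. phase g \<theta> k \<omega> * of_real (w (X k \<omega>)) \<partial>\<Omega>)
          \<le> (L * (\<bar>\<theta>\<bar> * (real m * ?G)) + \<rho> ^ m * L) + (if k < m then L else 0)"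
      proof (cases "k < m")
        case False
        then show ?thesis using phase_decorrelation[OF g w wL w0, of m k \<theta>] by simp
      next
        case True
        have "norm (\<integral>\<omega>. phase g \<theta> k \<omega> * of_real (w (X k \<omega>)) \<partial>\<Omega>) \<le> (\<integral>\<omega>. \<bar>w (X k \<omega>)\<bar> \<partial>\<Omega>)"
          by (intro \<Omega>.norm_integral_bounded_mult_le ph Z1 iw)
        also have "\<dots> \<le> (\<integral>\<omega>. L \<partial>\<Omega>)"
          using iw wL by (intro integral_mono) auto
        finally have "norm (\<integral>\<omega>. phase g \<theta> k \<omega> * of_real (w (X k \<omega>)) \<partial>\<Omega>) \<le> L"
          by (simp add: \<Omega>.prob_space)
        moreover have "0 \<le> L * (\<bar>\<theta>\<bar> * (real m * ?G)) + \<rho> ^ m * L"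
          using L G rate_nonneg by simp
        ultimately show ?thesis using True by simp
      qed
      show ?thesis
        unfolding split using norm_triangle_ineq 1 2 by (smt (verit))
    qed
    have bound: "norm (\<psi> n n - a n ^ n) \<le> e n" if n: "1 \<le> n" and nv: "t\<^sup>2 * ?v / 4 \<le> real n" for n
    proof -
      let ?\<theta> = "t / sqrt (real n)"
      let ?c = "L * (\<bar>?\<theta>\<bar> * (real m * ?G)) + \<rho> ^ m * L"
      have n0: "0 < real n" using n by simp
      have \<theta>2: "?\<theta>\<^sup>2 = t\<^sup>2 / real n" by (simp add: power_divide)
      (* For t^2 v / n <= 4 the factor 1 - t^2 v / (2 n) lies in [-1, 1]. *)
      have a1: "norm (a n) \<le> 1"
      proof -
        have "0 \<le> ?\<theta>\<^sup>2 * ?v / 2" using v by simp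
        moreover have "?\<theta>\<^sup>2 * ?v / 2 \<le> 2"
          unfolding \<theta>2 using nv n0 by (simp add: divide_simps)
        ultimately show ?thesis unfolding a_def norm_of_real by (simp add: abs_le_iff)
      qed
      have "norm (\<psi> n n - a n ^ n) \<le> (\<Sum>k<n. ?\<theta>\<^sup>2 / 2 * (\<delta> + ?c + (if k < m then L else 0)) + 8 * (T n / real n))"
      proof (rule norm_recursion_le[where x = "\<psi> n", OF _ a1])
        show "\<psi> n 0 = 1"
          by (simp add: \<psi>_def phase_def martingale_def \<Omega>.prob_space)
        fix k
        have "norm (\<psi> n (Suc k) - a n * \<psi> n k)
            \<le> ?\<theta>\<^sup>2 / 2 * norm (\<integral>\<omega>. phase g ?\<theta> k \<omega> * of_real (?U (X k \<omega>)) \<partial>\<Omega>)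
              + 8 * ((\<integral>x. taylor_bound (?\<theta> * g x) \<partial>\<mu>) + (\<integral>x. taylor_bound (?\<theta> * ?b x) \<partial>\<mu>))"
          unfolding \<psi>_def a_def by (rule phase_step[OF g])
        also have "(\<integral>x. taylor_bound (?\<theta> * g x) \<partial>\<mu>) + (\<integral>x. taylor_bound (?\<theta> * ?b x) \<partial>\<mu>) = T n / real n"
          using n0 by (simp add: T_def add_divide_distrib)
        finally have "norm (\<psi> n (Suc k) - a n * \<psi> n k)
            \<le> ?\<theta>\<^sup>2 / 2 * norm (\<integral>\<omega>. phase g ?\<theta> k \<omega> * of_real (?U (X k \<omega>)) \<partial>\<Omega>) + 8 * (T n / real n)" .
        then show "norm (\<psi> n (Suc k) - a n * \<psi> n k)
            \<le> ?\<theta>\<^sup>2 / 2 * (\<delta> + ?c + (if k < m then L else 0)) + 8 * (T n / real n)"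
          by (rule order_trans) (intro add_right_mono mult_left_mono corr, simp)
      qed
      also have "\<dots> = ?\<theta>\<^sup>2 / 2 * (real n * (\<delta> + ?c) + (\<Sum>k<n. if k < m then L else 0)) + 8 * T n"
      proof -
        have "(\<Sum>k<n. A * (B + s k) + 8 * (E / real n)) = A * (real n * B + (\<Sum>k<n. s k)) + 8 * E"
          for A B E :: real and s :: "nat \<Rightarrow> real"
          unfolding sum.distrib sum_distrib_left[symmetric] using n0 by simp
        then show ?thesis .
      qed
      also have "\<dots> \<le> ?\<theta>\<^sup>2 / 2 * (real n * (\<delta> + ?c) + real m * L) + 8 * T n"
      proof (intro add_right_mono mult_left_mono add_left_mono)
        have "(\<Sum>k<n. if k < m then L else 0) = (\<Sum>k\<in>{..<n} \<inter> {k. k < m}. L)"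
          by (simp add: sum.If_cases)
        also have "\<dots> \<le> (\<Sum>k<m. L)"
          using L by (intro sum_mono2) auto
        finally show "(\<Sum>k<n. if k < m then L else 0) \<le> real m * L" by simp
      qed simp
      also have "\<dots> = e n"
        unfolding \<theta>2 e_def using n0 by (simp add: field_simps abs_divide)
      finally show ?thesis .
    qed
    have "\<forall>\<^sub>F n in sequentially. norm (\<psi> n n - a n ^ n) \<le> e n"
      using eventually_ge_at_top[of 1] eventually_ge_at_top[of "nat \<lceil>t\<^sup>2 * ?v / 4\<rceil>"]
      by eventually_elim (rule bound, auto simp: nat_le_iff ceiling_le_iff)
    moreover have "e \<longlonglongrightarrow> t\<^sup>2 / 2 * (\<delta> + 0 + L * (\<bar>t\<bar> * 0 * (real m * ?G)) + \<rho> ^ m * L) + 8 * (0 + 0)"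
      unfolding e_def[abs_def]
      by (intro tendsto_intros T sqrt0 lim_const_over_n)
    moreover have "t\<^sup>2 / 2 * (\<delta> + 0 + L * (\<bar>t\<bar> * 0 * (real m * ?G)) + \<rho> ^ m * L) + 8 * (0 + 0) < \<epsilon>"
    proof -
      have "t\<^sup>2 / 2 * (\<delta> + 0 + L * (\<bar>t\<bar> * 0 * (real m * ?G)) + \<rho> ^ m * L) + 8 * (0 + 0)
          = t\<^sup>2 / 2 * \<delta> + t\<^sup>2 / 2 * (\<rho> ^ m * L)"
        by (simp add: distrib_left)
      with m \<delta>2 \<epsilon> show ?thesis by linarith
    qed
    ultimately show "\<exists>e l. e \<longlonglongrightarrow> l \<and> l < \<epsilon> \<and> (\<forall>\<^sub>F n in sequentially. norm (\<psi> n n - a n ^ n) \<le> e n)"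
      by blast
  qed simp
  have "(\<lambda>n. (1 + (- (t\<^sup>2 * ?v) / 2) / real n) ^ n) \<longlonglongrightarrow> exp (- (t\<^sup>2 * ?v) / 2)"
    by (rule tendsto_exp_limit_sequentially)
  then have "(\<lambda>n. complex_of_real ((1 + (- (t\<^sup>2 * ?v) / 2) / real n) ^ n)) \<longlonglongrightarrow> of_real (exp (- (t\<^sup>2 * ?v) / 2))"
    by (rule tendsto_of_real)
  moreover have "complex_of_real ((1 + (- (t\<^sup>2 * ?v) / 2) / real n) ^ n) = a n ^ n" for n
    by (simp add: a_def power_divide mult.commute)
  ultimately have an: "(\<lambda>n. a n ^ n) \<longlonglongrightarrow> of_real (exp (- (t\<^sup>2 * ?v) / 2))" by simp
  have "(\<lambda>n. \<psi> n n) \<longlonglongrightarrow> of_real (exp (- (t\<^sup>2 * ?v) / 2))"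
using tendsto_add[OF tendsto_norm_zero_cancel[OF D] an] by simp
  then show ?thesis by (simp add: \<psi>_def)
qed

lemma integral_X_X:
  assumes v: "v \<in> L2 \<mu>" and u: "u \<in> L2 \<mu>"
  shows "(\<integral>\<omega>. v (X j \<omega>) * u (X (j + m) \<omega>) \<partial>\<Omega>) = (\<integral>x. v x * (kernel_op P ^^ m) u x \<partial>\<mu>)"
  using u
proof (induction m arbitrary: u)
  case 0
  then show ?case using integral_X[OF L2_mult_integrable[OF v 0], of j] by simp
next
  case (Suc m)
  let ?Z = "\<lambda>\<omega>. complex_of_real (v (X j \<omega>))"
  have [measurable]: "v \<in> borel_measurable \<mu>" using v by measurable
  have Z: "?Z \<in> borel_measurable (\<F> (j + m))"
    by (intro borel_measurable_of_real measurable_compose[OF X_history_measurable]) auto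
  have "integrable \<Omega> (\<lambda>\<omega>. v (X j \<omega>) * u (X (Suc (j + m)) \<omega>))"
    by (intro L2_mult_integrable L2_X v Suc.prems)
  then have "integrable \<Omega> (\<lambda>\<omega>. ?Z \<omega> * of_real (u (X (Suc (j + m)) \<omega>)))"
    by (simp flip: of_real_mult)
  from markov_integral(2)[OF Z L2_integrable[OF Suc.prems] this]
  have "(\<integral>\<omega>. v (X j \<omega>) * u (X (Suc (j + m)) \<omega>) \<partial>\<Omega>) = (\<integral>\<omega>. v (X j \<omega>) * kernel_op P u (X (j + m) \<omega>) \<partial>\<Omega>)"
    by (simp flip: of_real_mult)
  also have "\<dots> = (\<integral>x. v x * (kernel_op P ^^ m) (kernel_op P u) x \<partial>\<mu>)"
    by (rule Suc.IH[OF kernel_op_L2[OF Suc.prems]])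
  finally show ?case by (simp add: funpow_swap1)
qed

text \<open>The variance of the sum grows linearly because the covariances decay geometrically in the time
  lag. Applied to \<open>P\<^sup>N f\<close>, it makes the error of the martingale approximation small uniformly in \<open>n\<close>.\<close>

lemma L2_norm_sum_X_le:
  assumes e: "e \<in> L2 \<mu>" and mean: "(\<integral>x. e x \<partial>\<mu>) = 0"
  shows "(L2_norm \<Omega> (\<lambda>\<omega>. \<Sum>k<n. e (X k \<omega>)))\<^sup>2 \<le> real n * ((1 + 2 / (1 - \<rho>)) * (L2_norm \<mu> e)\<^sup>2)"
proof (induction n)
  case 0
  then show ?case by (simp add: L2_norm_def)
next
  case (Suc n)
  let ?S = "\<lambda>\<omega>. \<Sum>k<n. e (X k \<omega>)" and ?E = "(L2_norm \<mu> e)\<^sup>2"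
  have S: "?S \<in> L2 \<Omega>" by (intro L2_sum L2_X e)
  have eX: "(\<lambda>\<omega>. e (X k \<omega>)) \<in> L2 \<Omega>" for k by (intro L2_X e)
  have cov: "\<bar>\<integral>\<omega>. e (X j \<omega>) * e (X n \<omega>) \<partial>\<Omega>\<bar> \<le> ?E * \<rho> ^ (n - Suc j)" if "j < n" for j
  proof -
    have "\<bar>\<integral>\<omega>. e (X j \<omega>) * e (X n \<omega>) \<partial>\<Omega>\<bar> = \<bar>autocov e (n - j)\<bar>"
      using integral_X_X[OF e e, of j "n - j"] that by (simp add: autocov_def)
    also have "\<dots> \<le> ?E * \<rho> ^ (n - j)" by (rule autocov_bound[OF e mean])
    also have "\<dots> \<le> ?E * \<rho> ^ (n - Suc j)"
      using that rate_nonneg rate_less_1 by (intro mult_left_mono power_decreasing) auto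
    finally show ?thesis .
  qed
  have "(\<integral>\<omega>. ?S \<omega> * e (X n \<omega>) \<partial>\<Omega>) = (\<Sum>j<n. \<integral>\<omega>. e (X j \<omega>) * e (X n \<omega>) \<partial>\<Omega>)"
    unfolding sum_distrib_right by (intro Bochner_Integration.integral_sum L2_mult_integrable eX)
  also have "\<dots> \<le> (\<Sum>j<n. ?E * \<rho> ^ (n - Suc j))"
    using cov by (intro sum_mono) (auto simp: abs_le_iff)
  also have "\<dots> = ?E * (\<Sum>j<n. \<rho> ^ j)"
    unfolding sum_distrib_left[symmetric] sum.nat_diff_reindex ..
  also have "\<dots> \<le> ?E * (1 / (1 - \<rho>))"
    using sum_le_suminf[of "\<lambda>k. \<rho> ^ k" "{..<n}"] rate_nonneg rate_less_1
    by (intro mult_left_mono) (auto simp: suminf_geometric summable_geometric)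
  finally have cross: "(\<integral>\<omega>. ?S \<omega> * e (X n \<omega>) \<partial>\<Omega>) \<le> ?E * (1 / (1 - \<rho>))" .
  have "(L2_norm \<Omega> (\<lambda>\<omega>. \<Sum>k<Suc n. e (X k \<omega>)))\<^sup>2
      = (\<integral>\<omega>. (?S \<omega>)\<^sup>2 + 2 * (?S \<omega> * e (X n \<omega>)) + (e (X n \<omega>))\<^sup>2 \<partial>\<Omega>)"
    unfolding L2_norm_power2
    by (intro Bochner_Integration.integral_cong) (auto simp: power2_sum)
  also have "\<dots> = (L2_norm \<Omega> ?S)\<^sup>2 + 2 * (\<integral>\<omega>. ?S \<omega> * e (X n \<omega>) \<partial>\<Omega>) + (L2_norm \<Omega> (\<lambda>\<omega>. e (X n \<omega>)))\<^sup>2"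
    unfolding L2_norm_power2
    using L2_square_integrable[OF S] L2_mult_integrable[OF S eX[of n]] L2_square_integrable[OF eX[of n]]
    by simp
  also have "\<dots> \<le> real n * ((1 + 2 / (1 - \<rho>)) * ?E) + 2 * (?E * (1 / (1 - \<rho>))) + ?E"
    using Suc.IH cross by (simp add: L2_norm_X[OF e])
  also have "\<dots> = real (Suc n) * ((1 + 2 / (1 - \<rho>)) * ?E)"
  proof -
    have "real n * ((1 + 2 * r) * ?E) + 2 * (?E * r) + ?E = real (Suc n) * ((1 + 2 * r) * ?E)" for r
      by (simp add: algebra_simps)
    from this[of "1 / (1 - \<rho>)"] show ?thesis by simp
  qed
  finally show ?case .
qed

text \<open>Levy's continuity theorem reduces the claim to the characteristic functions. For fixed \<open>N\<close> they are
  within \<open>O(1 / sqrt n) + O(\<rho>\<^sup>N)\<close> of those of the martingale built from \<open>partial_resolvent N f\<close>, whose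
  limit is known; letting \<open>n\<close> and then \<open>N\<close> tend to infinity gives the result.\<close>

theorem chain_central_limit_theorem:
  assumes f: "f \<in> L2 \<mu>" and mean: "(\<integral>x. f x \<partial>\<mu>) = 0"
  shows "weak_conv_m (scaled_sum_law \<Omega> X f) (centered_normal (asymptotic_variance f))"
proof (rule levy_continuity)
  let ?v = "asymptotic_variance f"
  have fm[measurable]: "f \<in> borel_measurable \<mu>" using f by measurable
  have v: "0 \<le> ?v" by (rule asymptotic_variance_nonneg[OF f mean])
  show "real_distribution (scaled_sum_law \<Omega> X f n)" for n
    unfolding scaled_sum_law_def by (rule \<Omega>.real_distribution_distr) measurable
  show "real_distribution (centered_normal ?v)" using v by (rule real_distribution_centered_normal)
  fix t
  define C where "C = sqrt (1 + 2 / (1 - \<rho>))"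
  have C: "0 \<le> C" using rate_less_1 by (simp add: C_def)
  define \<psi> where "\<psi> N n = (\<integral>\<omega>. phase (partial_resolvent N f) (t / sqrt (real n)) n \<omega> \<partial>\<Omega>)" for N n
  let ?w = "\<lambda>v. complex_of_real (exp (- (t\<^sup>2 * v) / 2))"
  let ?c = "\<lambda>n. char (scaled_sum_law \<Omega> X f n) t"
  let ?vN = "\<lambda>N. martingale_variance (partial_resolvent N f)"
  have sqrt0: "(\<lambda>n. 1 / sqrt (real n)) \<longlonglongrightarrow> 0"
    by (intro tendsto_divide_0[OF tendsto_const] filterlim_at_top_imp_at_infinity
          filterlim_compose[OF sqrt_at_top] filterlim_real_sequentially)
  have char: "?c n = (\<integral>\<omega>. iexp (t / sqrt (real n) * (\<Sum>k<n. f (X k \<omega>))) \<partial>\<Omega>)" for n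
    unfolding scaled_sum_law_def char_def by (subst integral_distr) auto
  have compare: "norm (?c n - \<psi> N n)
      \<le> \<bar>t\<bar> * (1 / sqrt (real n)) * (2 * L2_norm \<mu> (partial_resolvent N f)) + \<bar>t\<bar> * (C * (\<rho> ^ N * L2_norm \<mu> f))"
    if n: "1 \<le> n" for n N
  proof -
    let ?g = "partial_resolvent N f" and ?e = "(kernel_op P ^^ N) f" and ?\<theta> = "t / sqrt (real n)"
    let ?S = "\<lambda>\<omega>. \<Sum>k<n. f (X k \<omega>)" and ?M = "martingale (partial_resolvent N f) n"
    have g: "?g \<in> L2 \<mu>" by (rule partial_resolvent_L2[OF f])
    have e: "?e \<in> L2 \<mu>" by (rule kernel_op_power_L2[OF f])
    have e0: "(\<integral>x. ?e x \<partial>\<mu>) = 0" using integral_kernel_op_power[OF f] mean by simp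
    define Q where "Q \<omega> = (?g (X 0 \<omega>) - ?g (X n \<omega>)) + (\<Sum>k<n. ?e (X k \<omega>))" for \<omega>
    have QL2: "Q \<in> L2 \<Omega>"
      unfolding Q_def[abs_def] by (intro L2_add L2_diff L2_sum L2_X g e)
    have ML2: "?M \<in> L2 \<Omega>" by (rule martingale_L2[OF g])
    have SL2: "?S \<in> L2 \<Omega>" by (intro L2_sum L2_X f)
    have ae: "AE \<omega> in \<Omega>. ?S \<omega> - ?M \<omega> = Q \<omega>"
    proof -
      have "AE \<omega> in \<Omega>. \<forall>k. kernel_op P ?g (X k \<omega>) = ?g (X k \<omega>) - f (X k \<omega>) + ?e (X k \<omega>)"
        unfolding AE_all_countable by (intro allI AE_X poisson_approx f mean)
      then show ?thesis
      proof eventually_elim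
        case (elim \<omega>)
        have "?S \<omega> - ?M \<omega> = (\<Sum>k<n. (?g (X k \<omega>) - ?g (X (Suc k) \<omega>)) + ?e (X k \<omega>))"
          unfolding martingale_def sum_subtractf[symmetric] using elim
          by (intro sum.cong) (auto simp: increment_def)
        then show ?case
          using sum_lessThan_telescope'[of "\<lambda>k. ?g (X k \<omega>)" n] by (simp add: Q_def sum.distrib)
      qed
    qed
    have QN: "L2_norm \<Omega> Q \<le> 2 * L2_norm \<mu> ?g + sqrt (real n) * (C * (\<rho> ^ N * L2_norm \<mu> f))"
    proof -
      have "L2_norm \<Omega> Q \<le> L2_norm \<Omega> (\<lambda>\<omega>. ?g (X 0 \<omega>) - ?g (X n \<omega>)) + L2_norm \<Omega> (\<lambda>\<omega>. \<Sum>k<n. ?e (X k \<omega>))"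
        unfolding Q_def[abs_def] by (intro L2_norm_triangle L2_diff L2_sum L2_X g e)
      moreover have "L2_norm \<Omega> (\<lambda>\<omega>. ?g (X 0 \<omega>) - ?g (X n \<omega>)) \<le> L2_norm \<mu> ?g + L2_norm \<mu> ?g"
        using L2_norm_triangle_diff[OF L2_X[OF g, of 0] L2_X[OF g, of n]] by (simp add: L2_norm_X g)
      moreover have "L2_norm \<Omega> (\<lambda>\<omega>. \<Sum>k<n. ?e (X k \<omega>)) \<le> sqrt (real n) * (C * L2_norm \<mu> ?e)"
      proof (rule power2_le_imp_le)
        show "(L2_norm \<Omega> (\<lambda>\<omega>. \<Sum>k<n. ?e (X k \<omega>)))\<^sup>2 \<le> (sqrt (real n) * (C * L2_norm \<mu> ?e))\<^sup>2"
          using L2_norm_sum_X_le[OF e e0, of n] rate_less_1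
          by (simp add: power_mult_distrib C_def)
      qed (use C in \<open>simp add: L2_norm_nonneg\<close>)
      moreover have "sqrt (real n) * (C * L2_norm \<mu> ?e) \<le> sqrt (real n) * (C * (\<rho> ^ N * L2_norm \<mu> f))"
        using C by (intro mult_left_mono L2_norm_kernel_op_power_le f mean) auto
      ultimately show ?thesis by linarith
    qed
    have [measurable]: "?S \<in> borel_measurable \<Omega>" "?M \<in> borel_measurable \<Omega>"
      using SL2 ML2 by measurable
    have iS: "integrable \<Omega> (\<lambda>\<omega>. iexp (?\<theta> * ?S \<omega>))" "integrable \<Omega> (\<lambda>\<omega>. iexp (?\<theta> * ?M \<omega>))"
      by (rule \<Omega>.integrable_const_bound[where B=1]; simp)+
    have "norm (?c n - \<psi> N n) = norm (\<integral>\<omega>. iexp (?\<theta> * ?S \<omega>) - iexp (?\<theta> * ?M \<omega>) \<partial>\<Omega>)"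
      unfolding char \<psi>_def phase_def using iS by simp
    also have "\<dots> \<le> (\<integral>\<omega>. norm (iexp (?\<theta> * ?S \<omega>) - iexp (?\<theta> * ?M \<omega>)) \<partial>\<Omega>)"
      by (rule integral_norm_bound)
    also have "\<dots> \<le> (\<integral>\<omega>. \<bar>?\<theta>\<bar> * \<bar>Q \<omega>\<bar> \<partial>\<Omega>)"
    proof (rule integral_mono_AE)
      show "integrable \<Omega> (\<lambda>\<omega>. norm (iexp (?\<theta> * ?S \<omega>) - iexp (?\<theta> * ?M \<omega>)))" using iS by auto
      show "integrable \<Omega> (\<lambda>\<omega>. \<bar>?\<theta>\<bar> * \<bar>Q \<omega>\<bar>)" using \<Omega>.L2_integrable[OF QL2] by auto
      show "AE \<omega> in \<Omega>. norm (iexp (?\<theta> * ?S \<omega>) - iexp (?\<theta> * ?M \<omega>)) \<le> \<bar>?\<theta>\<bar> * \<bar>Q \<omega>\<bar>"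
        using ae
      proof eventually_elim
        case (elim \<omega>)
        have "\<bar>?\<theta> * ?S \<omega> - ?\<theta> * ?M \<omega>\<bar> = \<bar>?\<theta>\<bar> * \<bar>Q \<omega>\<bar>"
          unfolding elim[symmetric] abs_mult[symmetric] right_diff_distrib ..
        then show ?case using norm_iexp_diff_le[of "?\<theta> * ?S \<omega>" "?\<theta> * ?M \<omega>"] by simp
      qed
    qed
    also have "\<dots> = \<bar>?\<theta>\<bar> * (\<integral>\<omega>. \<bar>Q \<omega>\<bar> \<partial>\<Omega>)" by simp
    also have "\<dots> \<le> \<bar>?\<theta>\<bar> * (2 * L2_norm \<mu> ?g + sqrt (real n) * (C * (\<rho> ^ N * L2_norm \<mu> f)))"
      by (intro mult_left_mono order_trans[OF \<Omega>.integral_abs_le_L2_norm[OF QL2] QN]) auto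
    also have "\<dots> = \<bar>t\<bar> * (1 / sqrt (real n)) * (2 * L2_norm \<mu> ?g) + \<bar>t\<bar> * (C * (\<rho> ^ N * L2_norm \<mu> f))"
      using n by (simp add: field_simps abs_divide)
    finally show ?thesis .
  qed
  have "(\<lambda>n. norm (?c n - ?w ?v)) \<longlonglongrightarrow> 0"
  proof (rule tendsto_zero_approx)
    fix \<epsilon> :: real assume \<epsilon>: "0 < \<epsilon>"
    have "(\<lambda>N. \<bar>t\<bar> * (C * (\<rho> ^ N * L2_norm \<mu> f)) + norm (?w (?vN N) - ?w ?v))
        \<longlonglongrightarrow> \<bar>t\<bar> * (C * (0 * L2_norm \<mu> f)) + norm (?w ?v - ?w ?v)"
      using rate_nonneg rate_less_1
      by (intro tendsto_intros martingale_variance_tendsto f mean LIMSEQ_realpow_zero) auto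
    from order_tendstoD(2)[OF this, of \<epsilon>]
    have "\<forall>\<^sub>F N in sequentially. \<bar>t\<bar> * (C * (\<rho> ^ N * L2_norm \<mu> f)) + norm (?w (?vN N) - ?w ?v) < \<epsilon>"
      using \<epsilon> by simp
    then obtain N where N: "\<bar>t\<bar> * (C * (\<rho> ^ N * L2_norm \<mu> f)) + norm (?w (?vN N) - ?w ?v) < \<epsilon>"
      by (auto simp: eventually_sequentially)
    define e where "e n = \<bar>t\<bar> * (1 / sqrt (real n)) * (2 * L2_norm \<mu> (partial_resolvent N f))
        + \<bar>t\<bar> * (C * (\<rho> ^ N * L2_norm \<mu> f)) + norm (\<psi> N n - ?w (?vN N)) + norm (?w (?vN N) - ?w ?v)" for n
    have "e \<longlonglongrightarrow> \<bar>t\<bar> * 0 * (2 * L2_norm \<mu> (partial_resolvent N f))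
        + \<bar>t\<bar> * (C * (\<rho> ^ N * L2_norm \<mu> f)) + norm (?w (?vN N) - ?w (?vN N)) + norm (?w (?vN N) - ?w ?v)"
      unfolding e_def[abs_def] \<psi>_def
      by (intro tendsto_add tendsto_mult tendsto_const sqrt0 tendsto_norm tendsto_diff
            phase_tendsto partial_resolvent_L2 f)
    moreover have "\<forall>\<^sub>F n in sequentially. norm (?c n - ?w ?v) \<le> e n"
      using eventually_ge_at_top[of 1]
    proof eventually_elim
      case (elim n)
      have "?c n - ?w ?v = (?c n - \<psi> N n) + ((\<psi> N n - ?w (?vN N)) + (?w (?vN N) - ?w ?v))" by simp
      then have "norm (?c n - ?w ?v) \<le> norm (?c n - \<psi> N n) + (norm (\<psi> N n - ?w (?vN N)) + norm (?w (?vN N) - ?w ?v))"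
        by (metis norm_triangle_le norm_triangle_ineq add_left_mono)
      with compare[OF elim, of N] show ?case by (simp add: e_def)
    qed
    ultimately show "\<exists>e l. e \<longlonglongrightarrow> l \<and> l < \<epsilon> \<and> (\<forall>\<^sub>F n in sequentially. norm (?c n - ?w ?v) \<le> e n)"
      using N by (intro exI[of _ e]) auto
  qed simp
  then have "?c \<longlonglongrightarrow> ?w ?v"
    by (simp add: tendsto_norm_zero_iff LIM_zero_iff)
  then show "(\<lambda>n. char (scaled_sum_law \<Omega> X f n) t) \<longlonglongrightarrow> char (centered_normal ?v) t"
    by (simp add: char_centered_normal[OF v])
qed

end

section \<open>Spectral gaps\<close>

context invariant_kernel
begin

lemma centred_kernel_op_norm:
  assumes "u \<in> L2 \<mu>"
  shows "L2_norm \<mu> (\<lambda>x. kernel_op P u x - (\<integral>y. u y \<partial>\<mu>)) \<le> 2 * L2_norm \<mu> u"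
proof -
  have "L2_norm \<mu> (\<lambda>x. kernel_op P u x - (\<integral>y. u y \<partial>\<mu>))
      \<le> L2_norm \<mu> (kernel_op P u) + L2_norm \<mu> (\<lambda>x. \<integral>y. u y \<partial>\<mu>)"
    by (intro L2_norm_triangle_diff kernel_op_L2 assms L2_const)
  also have "L2_norm \<mu> (\<lambda>x. \<integral>y. u y \<partial>\<mu>) = \<bar>\<integral>y. u y \<partial>\<mu>\<bar>"
    by (simp add: L2_norm_def prob_space)
  finally show "L2_norm \<mu> (\<lambda>x. kernel_op P u x - (\<integral>y. u y \<partial>\<mu>)) \<le> 2 * L2_norm \<mu> u"
    using L2_norm_kernel_op_le[OF assms] abs_integral_le_L2_norm[OF assms] by linarith
qed

text \<open>The supremum in the operator norm is one of reals; \<open>centred_kernel_op_norm\<close> shows that it is taken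
  over a bounded set, so that it does dominate its members.\<close>

lemma norm_centred_le_gap:
  assumes "u \<in> L2 \<mu>" "L2_norm \<mu> u \<le> 1"
  shows "L2_norm \<mu> (\<lambda>x. kernel_op P u x - (\<integral>y. u y \<partial>\<mu>)) \<le> 1 - spectral_gap \<mu> P"
proof -
  have "bdd_above ((\<lambda>u. L2_norm \<mu> (\<lambda>x. kernel_op P u x - (\<integral>y. u y \<partial>\<mu>))) ` {u \<in> L2 \<mu>. L2_norm \<mu> u \<le> 1})"
    by (intro bdd_aboveI2[where M = 2]) (auto intro: order_trans[OF centred_kernel_op_norm])
  then show ?thesis
    using assms unfolding spectral_gap_def L2_opnorm_def by (auto intro!: cSUP_upper)
qed

lemma spectral_gap_le_1: "spectral_gap \<mu> P \<le> 1"
proof -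
  have "0 \<le> L2_norm \<mu> (\<lambda>x. kernel_op P (\<lambda>x. 0) x - (\<integral>y. 0 \<partial>\<mu>))"
    by (rule L2_norm_nonneg)
  also have "\<dots> \<le> 1 - spectral_gap \<mu> P"
    by (rule norm_centred_le_gap) (auto simp: L2_const L2_norm_def)
  finally show ?thesis by simp
qed

lemma spectral_gap_contracting:
  assumes "0 < spectral_gap \<mu> P"
  shows "contracting_kernel \<mu> P (1 - spectral_gap \<mu> P)"
proof unfold_locales
  fix u assume u: "u \<in> L2 \<mu>" and mean: "(\<integral>x. u x \<partial>\<mu>) = 0"
  show "L2_norm \<mu> (kernel_op P u) \<le> (1 - spectral_gap \<mu> P) * L2_norm \<mu> u"
  proof (cases "L2_norm \<mu> u = 0")
    case True
    then show ?thesis using L2_norm_kernel_op_le[OF u] by simp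
  next
    case False
    then have pos: "0 < L2_norm \<mu> u" using L2_norm_nonneg[of \<mu> u] by simp
    let ?c = "inverse (L2_norm \<mu> u)"
    have c: "0 < ?c" using pos by simp
    have "L2_norm \<mu> (\<lambda>x. ?c * u x) \<le> 1"
      using pos by (simp add: L2_norm_cmult)
    from norm_centred_le_gap[OF L2_cmult[OF u] this]
    have "?c * L2_norm \<mu> (kernel_op P u) \<le> 1 - spectral_gap \<mu> P"
      using mean c by (simp add: kernel_op_cmult[abs_def] L2_norm_cmult)
    then show ?thesis using pos by (simp add: field_simps)
  qed
qed (use assms spectral_gap_le_1 in auto)

end

section \<open>Products, powers and mixtures of kernels\<close>

lemma invariant_kernel_return:
  assumes "prob_space \<mu>" "sets S = sets \<mu>"
  shows "invariant_kernel \<mu> (return S)"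
proof -
  interpret prob_space \<mu> by fact
  have [measurable_cong]: "sets S = sets \<mu>" by fact
  show ?thesis
  proof unfold_locales
    show "return S \<in> measurable \<mu> (prob_algebra \<mu>)"
      unfolding return_cong[OF assms(2), abs_def] by (rule measurable_return_prob_space)
    show "\<mu> \<bind> return S = \<mu>" using assms(2) by (intro bind_return'') simp
  qed
qed

lemma invariant_kernel_comp:
  assumes "invariant_kernel \<mu> P" "invariant_kernel \<mu> Q"
  shows "invariant_kernel \<mu> (kernel_comp P Q)"
proof -
  interpret P: invariant_kernel \<mu> P by fact
  interpret Q: invariant_kernel \<mu> Q by fact
  have eq: "kernel_comp P Q = (\<lambda>x. P x \<bind> Q)"
    by (auto simp: kernel_comp_def)
  show ?thesis
  proof unfold_locales
    show "kernel_comp P Q \<in> measurable \<mu> (prob_algebra \<mu>)"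
      unfolding eq by (rule measurable_bind_prob_space[OF P.kernel Q.kernel])
    have "\<mu> \<bind> (\<lambda>x. P x \<bind> Q) = (\<mu> \<bind> P) \<bind> Q"
      by (rule bind_assoc[symmetric, OF P.kernel_subprob Q.kernel_subprob])
    then show "\<mu> \<bind> kernel_comp P Q = \<mu>"
      by (simp add: eq P.invariant Q.invariant)
  qed
qed

lemma invariant_kernel_power:
  assumes "invariant_kernel \<mu> P" "sets S = sets \<mu>"
  shows "invariant_kernel \<mu> (kernel_power S P n)"
  using assms
  by (induction n) (auto intro: invariant_kernel_return invariant_kernel_comp invariant_kernel.axioms)

text \<open>Almost everywhere only: at exceptional \<open>x\<close> the function \<open>u\<close> may fail to be integrable, and the
  integral then takes the default value \<open>0\<close>, on one side only.\<close>

lemma kernel_op_comp: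
  assumes P: "invariant_kernel \<mu> P" and Q: "invariant_kernel \<mu> Q" and u: "integrable \<mu> u"
  shows "AE x in \<mu>. kernel_op (kernel_comp P Q) u x = kernel_op P (kernel_op Q u) x"
proof -
  interpret P: invariant_kernel \<mu> P by fact
  interpret Q: invariant_kernel \<mu> Q by fact
  interpret PQ: invariant_kernel \<mu> "kernel_comp P Q" by (rule invariant_kernel_comp[OF P Q])
  have um: "u \<in> borel_measurable \<mu>" using u by auto
  show ?thesis
    using PQ.kernel_AE_integrable[OF u] AE_space
  proof eventually_elim
    case (elim x)
    interpret Px: prob_space "P x" using elim by (intro P.kernel_prob_space)
    have "Q \<in> measurable (P x) (subprob_algebra \<mu>)"
      using Q.kernel_subprob measurable_cong_sets[OF P.kernel_sets[of x] refl] elim by auto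
    from bind_integral_eq[OF this um] elim Px.not_empty show ?case
      by (simp add: kernel_op_def kernel_comp_def)
  qed
qed

text \<open>The power contracts by \<open>\<rho>\<^sup>n\<close>; the weaker rate \<open>\<rho>\<close> is what the variance bound uses, being
  expressed through the gap of a single step.\<close>

lemma contracting_kernel_power:
  assumes "contracting_kernel \<mu> P \<rho>" and S: "sets S = sets \<mu>" and n: "1 \<le> n"
  shows "contracting_kernel \<mu> (kernel_power S P n) \<rho>"
proof -
  interpret contracting_kernel \<mu> P \<rho> by fact
  have inv: "invariant_kernel \<mu> (kernel_power S P n)" for n
    by (rule invariant_kernel_power[OF invariant_kernel_axioms S])
  have le: "L2_norm \<mu> (kernel_op (kernel_power S P n) u) \<le> \<rho> ^ n * L2_norm \<mu> u"
    if u: "u \<in> L2 \<mu>" and mean: "(\<integral>x. u x \<partial>\<mu>) = 0" for u n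
  proof (induction n)
    case 0
    interpret Q: invariant_kernel \<mu> "kernel_power S P 0" by (rule inv)
    show ?case using Q.L2_norm_kernel_op_le[OF u] by simp
  next
    case (Suc n)
    interpret Q: invariant_kernel \<mu> "kernel_power S P n" by (rule inv)
    interpret Q': invariant_kernel \<mu> "kernel_power S P (Suc n)" by (rule inv)
    have "L2_norm \<mu> (kernel_op (kernel_power S P (Suc n)) u)
        = L2_norm \<mu> (kernel_op P (kernel_op (kernel_power S P n) u))"
      using kernel_op_comp[OF invariant_kernel_axioms inv L2_integrable[OF u]]
      by (intro L2_norm_cong_AE Q'.kernel_op_L2 kernel_op_L2 Q.kernel_op_L2 u) simp
    also have "\<dots> \<le> \<rho> * L2_norm \<mu> (kernel_op (kernel_power S P n) u)"
      by (intro contraction Q.kernel_op_L2 u) (simp add: Q.integral_kernel_op L2_integrable u mean)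
    also have "\<dots> \<le> \<rho> * (\<rho> ^ n * L2_norm \<mu> u)"
      by (intro mult_left_mono Suc.IH rate_nonneg)
    finally show ?case by simp
  qed
  interpret Q: invariant_kernel \<mu> "kernel_power S P n" by (rule inv)
  show ?thesis
  proof unfold_locales
    fix u assume "u \<in> L2 \<mu>" "(\<integral>x. u x \<partial>\<mu>) = 0"
    from le[OF this, of n]
    have "L2_norm \<mu> (kernel_op (kernel_power S P n) u) \<le> \<rho> ^ n * L2_norm \<mu> u" .
    also have "\<dots> \<le> \<rho> * L2_norm \<mu> u"
      using power_decreasing[OF n, of \<rho>] rate_nonneg rate_less_1
      by (intro mult_right_mono) (auto simp: L2_norm_nonneg)
    finally show "L2_norm \<mu> (kernel_op (kernel_power S P n) u) \<le> \<rho> * L2_norm \<mu> u" .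
  qed (use rate_nonneg rate_less_1 in auto)
qed

text \<open>The measure is given by its values, so its countable additivity has to be checked before its
  values can be read off.\<close>

lemma invariant_kernel_uniform_mixture:
  assumes \<mu>: "prob_space \<mu>" and Q: "\<And>j. j \<in> J \<Longrightarrow> invariant_kernel \<mu> (Q j)"
    and J: "finite J" "J \<noteq> {}"
  shows "invariant_kernel \<mu>
    (\<lambda>x. measure_of (space \<mu>) (sets \<mu>) (\<lambda>A. (\<Sum>j\<in>J. emeasure (Q j x) A) / of_nat (card J)))"
    (is "invariant_kernel \<mu> ?R")
proof -
  interpret prob_space \<mu> by fact
  let ?d = "of_nat (card J) :: ennreal"
  have d: "?d \<noteq> 0" "?d \<noteq> \<top>" using J by auto
  have em: "emeasure (?R x) A = (\<Sum>j\<in>J. emeasure (Q j x) A) / ?d"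
    if x: "x \<in> space \<mu>" and A: "A \<in> sets \<mu>" for x A
  proof (rule emeasure_measure_of[OF refl])
    show "countably_additive (sets (?R x)) (\<lambda>A. (\<Sum>j\<in>J. emeasure (Q j x) A) / ?d)"
    proof (rule countably_additiveI)
      fix B :: "nat \<Rightarrow> 'a set"
      assume "range B \<subseteq> sets (?R x)" and dis: "disjoint_family B"
      then have B: "range B \<subseteq> sets \<mu>" by simp
      have "(\<Sum>i. emeasure (Q j x) (B i)) = emeasure (Q j x) (\<Union> (range B))" if "j \<in> J" for j
        using B dis invariant_kernel.kernel_sets[OF Q[OF that] x] by (intro suminf_emeasure) auto
      then have "(\<Sum>j\<in>J. emeasure (Q j x) (\<Union> (range B))) = (\<Sum>i. \<Sum>j\<in>J. emeasure (Q j x) (B i))"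
        by (subst suminf_sum) auto
      then show "(\<Sum>i. (\<Sum>j\<in>J. emeasure (Q j x) (B i)) / ?d) = (\<Sum>j\<in>J. emeasure (Q j x) (\<Union> (range B))) / ?d"
        by (simp add: divide_ennreal_def)
    qed
  qed (use A sets.space_closed in \<open>auto simp: positive_def\<close>)
  have sets: "sets (?R x) = sets \<mu>" for x by simp
  have Rm: "?R \<in> measurable \<mu> (prob_algebra \<mu>)"
  proof (rule measurable_prob_algebraI)
    show pr: "prob_space (?R x)" if x: "x \<in> space \<mu>" for x
    proof
      have "emeasure (?R x) (space \<mu>) = (\<Sum>j\<in>J. 1) / ?d"
        unfolding em[OF x sets.top]
        using prob_space.emeasure_space_1[OF invariant_kernel.kernel_prob_space[OF Q x]]
          sets_eq_imp_space_eq[OF invariant_kernel.kernel_sets[OF Q x]] by simp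
      then show "emeasure (?R x) (space (?R x)) = 1"
        using d by (simp add: divide_eq_1_ennreal)
    qed
    show "?R \<in> measurable \<mu> (subprob_algebra \<mu>)"
    proof (rule measurable_subprob_algebra)
      fix A assume A[measurable]: "A \<in> sets \<mu>"
      have "(\<lambda>x. (\<Sum>j\<in>J. emeasure (Q j x) A) / ?d) \<in> borel_measurable \<mu>"
        using measurable_emeasure_kernel[OF invariant_kernel.kernel_subprob[OF Q] A]
        by (intro borel_measurable_divide_ennreal borel_measurable_sum) auto
      then show "(\<lambda>x. emeasure (?R x) A) \<in> borel_measurable \<mu>"
        by (subst measurable_cong[OF em[OF _ A]])
    qed (use pr in \<open>auto intro: prob_space_imp_subprob_space\<close>)
  qed
  note Rm' = measurable_prob_algebraD[OF Rm]
  show ?thesis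
  proof unfold_locales
    show "?R \<in> measurable \<mu> (prob_algebra \<mu>)" by (rule Rm)
    show "\<mu> \<bind> ?R = \<mu>"
    proof (rule measure_eqI)
      show s: "sets (\<mu> \<bind> ?R) = sets \<mu>"
        using not_empty by (rule sets_bind_measurable[OF Rm'])
      fix A assume "A \<in> sets (\<mu> \<bind> ?R)"
      then have A[measurable]: "A \<in> sets \<mu>" unfolding s .
      have m: "(\<lambda>x. emeasure (Q j x) A) \<in> borel_measurable \<mu>" if "j \<in> J" for j
        using measurable_emeasure_kernel[OF invariant_kernel.kernel_subprob[OF Q[OF that]] A] .
      have inv: "(\<integral>\<^sup>+x. emeasure (Q j x) A \<partial>\<mu>) = emeasure \<mu> A" if "j \<in> J" for j
        using emeasure_bind[OF not_empty invariant_kernel.kernel_subprob[OF Q[OF that]] A]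
          invariant_kernel.invariant[OF Q[OF that]] by simp
      have "emeasure (\<mu> \<bind> ?R) A = (\<integral>\<^sup>+x. emeasure (?R x) A \<partial>\<mu>)"
        by (rule emeasure_bind[OF not_empty Rm' A])
      also have "\<dots> = (\<integral>\<^sup>+x. (\<Sum>j\<in>J. emeasure (Q j x) A) / ?d \<partial>\<mu>)"
        by (intro nn_integral_cong em A)
      also have "\<dots> = (\<Sum>j\<in>J. (\<integral>\<^sup>+x. emeasure (Q j x) A \<partial>\<mu>)) / ?d"
        using m by (simp add: nn_integral_divide nn_integral_sum)
      also have "\<dots> = (?d * emeasure \<mu> A) / ?d"
        by (simp add: inv)
      also have "\<dots> = emeasure \<mu> A"
        using mult_divide_eq_ennreal[OF d, of "emeasure \<mu> A"] by (simp only: mult.commute)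
      finally show "emeasure (\<mu> \<bind> ?R) A = emeasure \<mu> A" .
    qed
  qed
qed

section \<open>Component-wise updates\<close>

text \<open>Detailed balance between the whole space and \<open>B\<close>.\<close>

lemma reversible_invariant:
  assumes P: "P \<in> measurable N (prob_algebra N)" and s: "sets \<mu> = sets N"
    and rev: "reversible \<mu> P" and B: "B \<in> sets N"
  shows "(\<integral>\<^sup>+y. emeasure (P y) B \<partial>\<mu>) = emeasure \<mu> B"
proof -
  have sp: "space \<mu> = space N" using s by (rule sets_eq_imp_space_eq)
  have one: "emeasure (P y) (space \<mu>) = 1" if "y \<in> space \<mu>" for y
    using in_space_prob_algebra[OF measurable_space[OF P]] that by (simp add: sp)
  have "(\<integral>\<^sup>+y. emeasure (P y) B \<partial>\<mu>) = (\<integral>\<^sup>+y\<in>space \<mu>. emeasure (P y) B \<partial>\<mu>)"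
    by (intro nn_integral_cong) simp
  also have "\<dots> = (\<integral>\<^sup>+y\<in>B. emeasure (P y) (space \<mu>) \<partial>\<mu>)"
    using B s sets.top by (intro rev[unfolded reversible_def, rule_format]) auto
  also have "\<dots> = (\<integral>\<^sup>+y. indicator B y \<partial>\<mu>)"
    by (intro nn_integral_cong) (simp add: one)
  also have "\<dots> = emeasure \<mu> B" using B s by simp
  finally show ?thesis .
qed

text \<open>The coordinate \<open>j\<close> that is updated and the others: \<open>S\<close> is the whole product, \<open>N\<close> the product
  without factor \<open>j\<close>, and a point of \<open>S\<close> corresponds to a pair in \<open>N \<times> M j\<close> by splitting off its
  \<open>j\<close>-th coordinate.\<close>

locale component =
  fixes d :: nat and M :: "nat \<Rightarrow> 'a measure" and \<pi> :: "(nat \<Rightarrow> 'a) measure" and j :: nat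
  assumes j: "j \<in> {1..d}" and sets_\<pi>: "sets \<pi> = sets (prod_space d M)" and prob_\<pi>: "prob_space \<pi>"
begin

abbreviation "S \<equiv> prod_space d M"
abbreviation "N \<equiv> prod_space_without d j M"
abbreviation others :: "(nat \<Rightarrow> 'a) \<Rightarrow> nat \<Rightarrow> 'a" where "others \<equiv> drop_coord d j"

(* Rewriting 1 to Suc 0 would change the index set {1..d} inside the product spaces. *)
declare One_nat_def [simp del]

lemma space_\<pi>: "space \<pi> = space S"
  using sets_\<pi> by (rule sets_eq_imp_space_eq)

lemma others_measurable: "others \<in> measurable S N"
  by (rule measurable_restrict_subset) auto

lemma coord_measurable: "(\<lambda>x. x j) \<in> measurable S (M j)"
  using j by (rule measurable_component_singleton)

lemma update_measurable: "(\<lambda>(x, y). x(j := y)) \<in> measurable (S \<Otimes>\<^sub>M M j) S"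
proof -
  have "(\<lambda>p. (fst p)(j := snd p)) \<in> measurable (S \<Otimes>\<^sub>M M j) S"
    using j by (intro measurable_fun_upd[where J = "{1..d}"]) auto
  then show ?thesis by (simp add: split_beta')
qed

lemma insert_measurable: "(\<lambda>(z, y). z(j := y)) \<in> measurable (N \<Otimes>\<^sub>M M j) S"
proof -
  have "(\<lambda>p. (fst p)(j := snd p)) \<in> measurable (N \<Otimes>\<^sub>M M j) S"
    using j by (intro measurable_fun_upd[where J = "{1..d} - {j}"]) auto
  then show ?thesis by (simp add: split_beta')
qed

lemma others_insert: "z \<in> space N \<Longrightarrow> others (z(j := y)) = z"
  by (auto simp: space_PiM PiE_def extensional_def restrict_def fun_eq_iff)

lemma insert_others: "x \<in> space S \<Longrightarrow> (others x)(j := y) = x(j := y)"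
  by (auto simp: space_PiM PiE_def extensional_def restrict_def fun_eq_iff)

lemma insert_others_self: "x \<in> space S \<Longrightarrow> (others x)(j := x j) = x"
  by (simp only: insert_others fun_upd_triv)

text \<open>The defining property of the conditional distribution is this identity for indicators of
  rectangles. These generate the product \<open>\<sigma>\<close>-algebra and are closed under intersection, so the joint
  law of \<open>(x\<^sub>-\<^sub>j, x\<^sub>j)\<close> is the mixture of the conditional laws.\<close>

lemma disintegration:
  assumes cd: "conditional_distribution d M \<pi> j \<kappa>"
    and F[measurable]: "(\<lambda>(z, y). F z y) \<in> borel_measurable (N \<Otimes>\<^sub>M M j)"
  shows "(\<integral>\<^sup>+x. F (others x) (x j) \<partial>\<pi>) = (\<integral>\<^sup>+x. (\<integral>\<^sup>+y. F (others x) y \<partial>\<kappa> (others x)) \<partial>\<pi>)"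
proof -
  have \<kappa>: "\<kappa> \<in> measurable N (prob_algebra (M j))"
    using cd by (simp add: conditional_distribution_def)
  interpret prob_space \<pi> by (rule prob_\<pi>)
  have [measurable_cong]: "sets \<pi> = sets S" by (rule sets_\<pi>)
  note [measurable] = others_measurable coord_measurable measurable_prob_algebraD[OF \<kappa>]
  define \<nu> where "\<nu> = distr \<pi> N others"
  define k where "k z = distr (\<kappa> z) (N \<Otimes>\<^sub>M M j) (Pair z)" for z
  have k[measurable]: "k \<in> measurable N (subprob_algebra (N \<Otimes>\<^sub>M M j))"
    unfolding k_def[abs_def] by (rule measurable_distr2[where M = "M j"]) measurable
  then have k\<nu>: "k \<in> measurable \<nu> (subprob_algebra (N \<Otimes>\<^sub>M M j))"
    by (simp add: \<nu>_def)
  have ne: "space \<nu> \<noteq> {}"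
    using not_empty measurable_space[OF others_measurable] by (auto simp: \<nu>_def space_\<pi>)
  have sets_\<kappa>: "sets (\<kappa> z) = sets (M j)" if "z \<in> space N" for z
    using sets_kernel[OF measurable_prob_algebraD[OF \<kappa>] that] .
  let ?\<delta> = "\<lambda>x. (others x, x j)"
  have "distr \<pi> (N \<Otimes>\<^sub>M M j) ?\<delta> = \<nu> \<bind> k"
  proof (rule measure_eqI_generator_eq[where \<Omega> = "space N \<times> space (M j)"
        and E = "{a \<times> b | a b. a \<in> sets N \<and> b \<in> sets (M j)}" and A = "\<lambda>_. space N \<times> space (M j)"])
    show "Int_stable {a \<times> b |a b. a \<in> sets N \<and> b \<in> sets (M j)}"
      by (rule Int_stable_pair_measure_generator)
    show "{a \<times> b |a b. a \<in> sets N \<and> b \<in> sets (M j)} \<subseteq> Pow (space N \<times> space (M j))"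
      by (rule pair_measure_closed)
    show "sets (distr \<pi> (N \<Otimes>\<^sub>M M j) ?\<delta>) = sigma_sets (space N \<times> space (M j)) {a \<times> b |a b. a \<in> sets N \<and> b \<in> sets (M j)}"
      by (simp add: sets_pair_measure)
    show "sets (\<nu> \<bind> k) = sigma_sets (space N \<times> space (M j)) {a \<times> b |a b. a \<in> sets N \<and> b \<in> sets (M j)}"
      unfolding sets_bind_measurable[OF k\<nu> ne] by (simp add: sets_pair_measure)
    show "range (\<lambda>_. space N \<times> space (M j)) \<subseteq> {a \<times> b |a b. a \<in> sets N \<and> b \<in> sets (M j)}"
      by auto
    show "(\<Union>i::nat. space N \<times> space (M j)) = space N \<times> space (M j)" by simp
    show "emeasure (distr \<pi> (N \<Otimes>\<^sub>M M j) ?\<delta>) (space N \<times> space (M j)) \<noteq> \<infinity>" for i :: nat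
      by (subst emeasure_distr) (auto simp: emeasure_eq_measure)
    fix R assume "R \<in> {a \<times> b |a b. a \<in> sets N \<and> b \<in> sets (M j)}"
    then obtain a b where R: "R = a \<times> b" and a[measurable]: "a \<in> sets N" and b[measurable]: "b \<in> sets (M j)"
      by auto
    have Rs: "R \<in> sets (N \<Otimes>\<^sub>M M j)" unfolding R by (rule pair_measureI[OF a b])
    have "emeasure (distr \<pi> (N \<Otimes>\<^sub>M M j) ?\<delta>) R = emeasure \<pi> {x \<in> space \<pi>. others x \<in> a \<and> x j \<in> b}"
      using Rs by (subst emeasure_distr) (auto intro!: arg_cong[where f = "emeasure \<pi>"] simp: R)
    also have "\<dots> = (\<integral>\<^sup>+x. indicator a (others x) * emeasure (\<kappa> (others x)) b \<partial>\<pi>)"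
      using cd a b by (simp add: conditional_distribution_def)
    also have "\<dots> = (\<integral>\<^sup>+z. indicator a z * emeasure (\<kappa> z) b \<partial>\<nu>)"
    proof -
      have m: "(\<lambda>z. indicator a z * emeasure (\<kappa> z) b) \<in> borel_measurable N"
        using measurable_emeasure_kernel[OF measurable_prob_algebraD[OF \<kappa>] b]
        by (intro borel_measurable_times_ennreal borel_measurable_indicator a)
      have o: "others \<in> measurable \<pi> N" by measurable
      have "(\<lambda>z. indicator a z * emeasure (\<kappa> z) b) \<in> borel_measurable (distr \<pi> N others)"
        using m by simp
      from nn_integral_distr[OF o this] show ?thesis unfolding \<nu>_def ..
    qed
    also have "\<dots> = (\<integral>\<^sup>+z. emeasure (k z) R \<partial>\<nu>)"
    proof (rule nn_integral_cong)
      fix z assume "z \<in> space \<nu>"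
      then have z: "z \<in> space N" by (simp add: \<nu>_def)
      have "Pair z \<in> measurable (\<kappa> z) (N \<Otimes>\<^sub>M M j)"
        unfolding measurable_cong_sets[OF sets_\<kappa>[OF z] refl] by (rule measurable_Pair1'[OF z])
      then have "emeasure (k z) R = emeasure (\<kappa> z) (Pair z -` R \<inter> space (\<kappa> z))"
        unfolding k_def by (rule emeasure_distr[OF _ Rs])
      also have "Pair z -` R \<inter> space (\<kappa> z) = (if z \<in> a then b else {})"
        using sets.sets_into_space[OF b] sets_eq_imp_space_eq[OF sets_\<kappa>[OF z]] by (auto simp: R)
      finally show "indicator a z * emeasure (\<kappa> z) b = emeasure (k z) R" by simp
    qed
    also have "\<dots> = emeasure (\<nu> \<bind> k) R"
      by (rule emeasure_bind[symmetric, OF ne k\<nu> Rs])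
    finally show "emeasure (distr \<pi> (N \<Otimes>\<^sub>M M j) ?\<delta>) R = emeasure (\<nu> \<bind> k) R" .
  qed
  note joint = this
  have "(\<integral>\<^sup>+x. F (others x) (x j) \<partial>\<pi>) = (\<integral>\<^sup>+p. (\<lambda>(z, y). F z y) p \<partial>distr \<pi> (N \<Otimes>\<^sub>M M j) ?\<delta>)"
    by (subst nn_integral_distr) auto
  also have "\<dots> = (\<integral>\<^sup>+z. (\<integral>\<^sup>+p. (\<lambda>(z, y). F z y) p \<partial>k z) \<partial>\<nu>)"
    unfolding joint by (rule nn_integral_bind[OF F k\<nu>])
  also have "\<dots> = (\<integral>\<^sup>+x. (\<integral>\<^sup>+p. (\<lambda>(z, y). F z y) p \<partial>k (others x)) \<partial>\<pi>)"
    unfolding \<nu>_def by (subst nn_integral_distr) auto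
  also have "\<dots> = (\<integral>\<^sup>+x. (\<integral>\<^sup>+y. F (others x) y \<partial>\<kappa> (others x)) \<partial>\<pi>)"
  proof (rule nn_integral_cong)
    fix x assume "x \<in> space \<pi>"
    then have z: "others x \<in> space N" using measurable_space[OF others_measurable] by (simp add: space_\<pi>)
    have P: "Pair (others x) \<in> measurable (\<kappa> (others x)) (N \<Otimes>\<^sub>M M j)"
      unfolding measurable_cong_sets[OF sets_\<kappa>[OF z] refl] by (rule measurable_Pair1'[OF z])
    have "(\<lambda>(z, y). F z y) \<in> borel_measurable (distr (\<kappa> (others x)) (N \<Otimes>\<^sub>M M j) (Pair (others x)))"
      using F by (simp only: measurable_distr_eq1)
    from nn_integral_distr[OF P this]
    show "(\<integral>\<^sup>+p. (\<lambda>(z, y). F z y) p \<partial>k (others x)) = (\<integral>\<^sup>+y. F (others x) y \<partial>\<kappa> (others x))"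
      unfolding k_def by (simp only: prod.case)
  qed
  finally show ?thesis .
qed

text \<open>Given the other coordinates \<open>z\<close>, the update moves the \<open>j\<close>-th coordinate by \<open>K j z\<close>, which
  preserves the conditional law \<open>\<kappa> j z\<close>; averaging over \<open>z\<close> by \<open>disintegration\<close>, used once in each
  direction, shows that \<open>\<pi>\<close> is preserved.\<close>

lemma cw_kernel_invariant:
  assumes cd: "conditional_distribution d M \<pi> j (\<kappa> j)"
    and cu: "componentwise_update d M \<kappa> K"
  shows "invariant_kernel \<pi> (cw_kernel d M K j)"
proof -
  interpret prob_space \<pi> by (rule prob_\<pi>)
  have [measurable_cong]: "sets \<pi> = sets S" by (rule sets_\<pi>)
  note [measurable] = others_measurable coord_measurable insert_measurable
  have Kz: "K j z \<in> measurable (M j) (prob_algebra (M j))" and rev: "reversible (\<kappa> j z) (K j z)"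
    if "z \<in> space N" for z
    using cu j that by (auto simp: componentwise_update_def markov_kernel_def)
  have Kx: "K j (others x) (x j) \<in> space (prob_algebra (M j))" if "x \<in> space S" for x
    using measurable_space[OF Kz[OF measurable_space[OF others_measurable that]]
        measurable_space[OF coord_measurable that]] .
  have G: "(\<lambda>x. K j (others x) (x j)) \<in> measurable S (prob_algebra (M j))"
  proof (rule measurable_prob_algebraI)
    show "prob_space (K j (others x) (x j))" if "x \<in> space S" for x
      using Kx[OF that] by (simp add: space_prob_algebra)
    show "(\<lambda>x. K j (others x) (x j)) \<in> measurable S (subprob_algebra (M j))"
      by (rule measurable_subprob_algebra)
         (use Kx cu j in \<open>auto simp: space_prob_algebra componentwise_update_def
            intro: prob_space_imp_subprob_space\<close>)
  qed
  have cw: "cw_kernel d M K j \<in> measurable S (prob_algebra S)"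
    unfolding cw_kernel_def[abs_def]
    by (rule measurable_distr_prob_space2[OF G update_measurable])
  have cw\<pi>: "cw_kernel d M K j \<in> measurable \<pi> (prob_algebra \<pi>)"
  proof -
    have eq: "prob_algebra \<pi> = prob_algebra S"
      unfolding prob_algebra_def subprob_algebra_cong[OF sets_\<pi>] ..
    show ?thesis using cw unfolding eq measurable_cong_sets[OF sets_\<pi> refl] .
  qed
  have \<kappa>: "\<kappa> j \<in> measurable N (prob_algebra (M j))"
    using cd by (simp add: conditional_distribution_def)
  show ?thesis
  proof unfold_locales
    show "cw_kernel d M K j \<in> measurable \<pi> (prob_algebra \<pi>)" by (rule cw\<pi>)
    note cw' = measurable_prob_algebraD[OF cw\<pi>]
    show "\<pi> \<bind> cw_kernel d M K j = \<pi>"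
    proof (rule measure_eqI)
      show s: "sets (\<pi> \<bind> cw_kernel d M K j) = sets \<pi>"
        using not_empty by (rule sets_bind_measurable[OF cw'])
      fix C assume "C \<in> sets (\<pi> \<bind> cw_kernel d M K j)"
      then have C\<pi>: "C \<in> sets \<pi>" unfolding s .
      then have C[measurable]: "C \<in> sets S" by (simp add: sets_\<pi>)
      (* The update kernel as a function of the pair (z, y), to which disintegration applies. *)
      define F where "F z y = emeasure (cw_kernel d M K j (z(j := y))) C" for z y
      have F: "(\<lambda>(z, y). F z y) \<in> borel_measurable (N \<Otimes>\<^sub>M M j)"
        using measurable_compose[OF insert_measurable
            measurable_emeasure_kernel[OF measurable_prob_algebraD[OF cw] C]]
        by (simp add: F_def split_beta')
      have ind: "(\<lambda>(z, y). indicator C (z(j := y)) :: ennreal) \<in> borel_measurable (N \<Otimes>\<^sub>M M j)"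
        using measurable_compose[OF insert_measurable borel_measurable_indicator[OF C]]
        by (simp add: split_beta')
      have inner: "(\<integral>\<^sup>+y. F z y \<partial>\<kappa> j z) = (\<integral>\<^sup>+y. indicator C (z(j := y)) \<partial>\<kappa> j z)"
        if z: "z \<in> space N" for z
      proof -
        have s\<kappa>: "sets (\<kappa> j z) = sets (M j)"
          using sets_kernel[OF measurable_prob_algebraD[OF \<kappa>] z] .
        have ins: "(\<lambda>y. z(j := y)) \<in> measurable (M j) S"
          using measurable_compose[OF measurable_Pair1'[OF z] insert_measurable] by simp
        define B where "B = (\<lambda>y. z(j := y)) -` C \<inter> space (M j)"
        have B: "B \<in> sets (M j)" unfolding B_def by (rule measurable_sets[OF ins C])
        have "F z y = emeasure (K j z y) B" if y: "y \<in> space (M j)" for y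
        proof -
          have sK: "sets (K j z y) = sets (M j)"
            using measurable_space[OF Kz[OF z] y] by (simp add: space_prob_algebra)
          have "cw_kernel d M K j (z(j := y)) = distr (K j z y) S (\<lambda>y'. z(j := y'))"
          proof -
            have "fun_upd (z(j := y)) j = fun_upd z j" by (rule ext) simp
            then show ?thesis unfolding cw_kernel_def others_insert[OF z] by simp
          qed
          then show ?thesis
            unfolding F_def B_def using ins measurable_cong_sets[OF sK refl, of S] sets_eq_imp_space_eq[OF sK]
            by (simp add: emeasure_distr C)
        qed
        then have "(\<integral>\<^sup>+y. F z y \<partial>\<kappa> j z) = (\<integral>\<^sup>+y. emeasure (K j z y) B \<partial>\<kappa> j z)"
          using sets_eq_imp_space_eq[OF s\<kappa>] by (intro nn_integral_cong) simp
        also have "\<dots> = emeasure (\<kappa> j z) B"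
          by (rule reversible_invariant[OF Kz[OF z] s\<kappa> rev[OF z] B])
        also have "\<dots> = (\<integral>\<^sup>+y. indicator B y \<partial>\<kappa> j z)"
          using B s\<kappa> by simp
        also have "\<dots> = (\<integral>\<^sup>+y. indicator C (z(j := y)) \<partial>\<kappa> j z)"
          using sets_eq_imp_space_eq[OF s\<kappa>]
          by (intro nn_integral_cong) (auto simp: B_def split: split_indicator)
        finally show ?thesis .
      qed
      have "emeasure (\<pi> \<bind> cw_kernel d M K j) C = (\<integral>\<^sup>+x. emeasure (cw_kernel d M K j x) C \<partial>\<pi>)"
        by (rule emeasure_bind[OF not_empty cw' C\<pi>])
      also have "\<dots> = (\<integral>\<^sup>+x. F (others x) (x j) \<partial>\<pi>)"
        by (intro nn_integral_cong) (simp only: F_def insert_others_self space_\<pi>)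
      also have "\<dots> = (\<integral>\<^sup>+x. (\<integral>\<^sup>+y. F (others x) y \<partial>\<kappa> j (others x)) \<partial>\<pi>)"
        by (rule disintegration[OF cd F])
      also have "\<dots> = (\<integral>\<^sup>+x. (\<integral>\<^sup>+y. indicator C ((others x)(j := y)) \<partial>\<kappa> j (others x)) \<partial>\<pi>)"
        using measurable_space[OF others_measurable]
        by (intro nn_integral_cong inner) (simp add: space_\<pi>)
      also have "\<dots> = (\<integral>\<^sup>+x. indicator C ((others x)(j := x j)) \<partial>\<pi>)"
        by (rule disintegration[OF cd ind, symmetric])
      also have "\<dots> = (\<integral>\<^sup>+x. indicator C x \<partial>\<pi>)"
        by (intro nn_integral_cong) (simp only: insert_others_self space_\<pi>)
      also have "\<dots> = emeasure \<pi> C" using C\<pi> by simp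
      finally show "emeasure (\<pi> \<bind> cw_kernel d M K j) C = emeasure \<pi> C" .
    qed
  qed
qed

end

lemma RCW_invariant:
  assumes "1 \<le> d" "prob_space \<pi>" and s: "sets \<pi> = sets (prod_space d M)"
    and "\<And>j. j \<in> {1..d} \<Longrightarrow> invariant_kernel \<pi> (cw_kernel d M K j)"
  shows "invariant_kernel \<pi> (RCW d M K)"
proof -
  have "RCW d M K = (\<lambda>x. measure_of (space \<pi>) (sets \<pi>)
      (\<lambda>A. (\<Sum>j\<in>{1..d}. emeasure (cw_kernel d M K j x) A) / of_nat (card {1..d})))"
    by (auto simp: RCW_def s sets_eq_imp_space_eq[OF s])
  then show ?thesis
    using invariant_kernel_uniform_mixture[OF assms(2), of "{1..d}" "cw_kernel d M K"] assms by simp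
qed

lemma DCW_invariant:
  assumes "prob_space \<pi>" and s: "sets \<pi> = sets (prod_space d M)"
    and cw: "\<And>j. j \<in> {1..d} \<Longrightarrow> invariant_kernel \<pi> (cw_kernel d M K j)"
  shows "invariant_kernel \<pi> (DCW d M K)"
proof -
  have "m \<le> d \<Longrightarrow> invariant_kernel \<pi> (DCW_upto d M K m)" for m
    using assms by (induction m) (auto intro!: invariant_kernel_return invariant_kernel_comp)
  then show ?thesis by (simp add: DCW_def)
qed

section \<open>Comparison of the two scans\<close>

theorem theorem1p4:
  fixes d :: nat
    and M :: "nat \<Rightarrow> 'a measure"
    and \<pi> :: "(nat \<Rightarrow> 'a) measure"
    and \<kappa> :: "nat \<Rightarrow> (nat \<Rightarrow> 'a) \<Rightarrow> 'a measure"
    and K :: "nat \<Rightarrow> (nat \<Rightarrow> 'a) \<Rightarrow> 'a \<Rightarrow> 'a measure"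
    and \<Omega>\<^sub>X :: "'w measure" and X :: "nat \<Rightarrow> 'w \<Rightarrow> nat \<Rightarrow> 'a"
    and \<Omega>\<^sub>Y :: "'v measure" and Y :: "nat \<Rightarrow> 'v \<Rightarrow> nat \<Rightarrow> 'a"
  assumes "1 \<le> d"
    and "\<And>j. j \<in> {1..d} \<Longrightarrow> polish_measurable (M j)"
    and "prob_space \<pi>" and "sets \<pi> = sets (prod_space d M)"
    and "\<And>j. j \<in> {1..d} \<Longrightarrow> conditional_distribution d M \<pi> j (\<kappa> j)"
    and "componentwise_update d M \<kappa> K"
    and "spectral_gap \<pi> (RCW d M K) > 0"
    and "spectral_gap \<pi> (DCW d M K) > 0"
    and "markov_chain \<Omega>\<^sub>X (prod_space d M) \<pi> (kernel_power (prod_space d M) (RCW d M K) d) X"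
    and "markov_chain \<Omega>\<^sub>Y (prod_space d M) \<pi> (DCW d M K) Y"
  shows "\<forall>f\<in>L2 \<pi>. (\<integral>x. f x \<partial>\<pi>) = 0 \<longrightarrow>
    (\<exists>var_RCW var_DCW :: real. 0 \<le> var_RCW \<and> 0 \<le> var_DCW \<and>
       weak_conv_m (scaled_sum_law \<Omega>\<^sub>X X f) (centered_normal var_RCW) \<and>
       weak_conv_m (scaled_sum_law \<Omega>\<^sub>Y Y f) (centered_normal var_DCW) \<and>
       \<bar>var_DCW - var_RCW\<bar> \<le>
         4 / (spectral_gap \<pi> (RCW d M K) * spectral_gap \<pi> (DCW d M K)) * (L2_norm \<pi> f)\<^sup>2)"
proof (intro ballI impI)
  fix f assume f: "f \<in> L2 \<pi>" and mean: "(\<integral>x. f x \<partial>\<pi>) = 0"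
  let ?S = "prod_space d M"
  let ?R = "RCW d M K" and ?Rd = "kernel_power (prod_space d M) (RCW d M K) d" and ?D = "DCW d M K"
  have cw: "invariant_kernel \<pi> (cw_kernel d M K j)" if "j \<in> {1..d}" for j
  proof -
    interpret component d M \<pi> j by (rule component.intro) (use that assms in auto)
    show ?thesis using assms that by (intro cw_kernel_invariant)
  qed
  interpret R: invariant_kernel \<pi> ?R using assms cw by (intro RCW_invariant) auto
  interpret D: invariant_kernel \<pi> ?D using assms cw by (intro DCW_invariant) auto
  define r where "r = spectral_gap \<pi> ?R"
  define s where "s = spectral_gap \<pi> ?D"
  have pos: "0 < r" "0 < s" and le1: "r \<le> 1" "s \<le> 1"
    using assms R.spectral_gap_le_1 D.spectral_gap_le_1 by (auto simp: r_def s_def)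
  interpret Rd: contracting_kernel \<pi> ?Rd "1 - r"
    unfolding r_def using assms by (intro contracting_kernel_power R.spectral_gap_contracting) auto
  interpret Dc: contracting_kernel \<pi> ?D "1 - s"
    unfolding s_def using assms by (intro D.spectral_gap_contracting) auto
  have chX: "markov_chain \<Omega>\<^sub>X \<pi> \<pi> ?Rd X" and chY: "markov_chain \<Omega>\<^sub>Y \<pi> \<pi> ?D Y"
    using assms(9,10) by (simp_all only: markov_chain_cong_sets[OF assms(4)])
  interpret X: contracting_chain \<pi> ?Rd "1 - r" \<Omega>\<^sub>X X
    by (intro contracting_chain.intro stationary_chain.intro stationary_chain_axioms.intro
        Rd.contracting_kernel_axioms Rd.invariant_kernel_axioms chX) (use chX in \<open>simp add: markov_chain_def\<close>)
  interpret Y: contracting_chain \<pi> ?D "1 - s" \<Omega>\<^sub>Y Y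
    by (intro contracting_chain.intro stationary_chain.intro stationary_chain_axioms.intro
        Dc.contracting_kernel_axioms D.invariant_kernel_axioms chY) (use chY in \<open>simp add: markov_chain_def\<close>)
  let ?vX = "Rd.asymptotic_variance f" and ?vY = "Dc.asymptotic_variance f"
  have "\<bar>?vY - ?vX\<bar> = 2 * \<bar>(\<Sum>k. Dc.autocov f k) - (\<Sum>k. Rd.autocov f k)\<bar>"
  proof -
    have "\<bar>(2 * a - c) - (2 * b - c)\<bar> = 2 * \<bar>a - b\<bar>" for a b c :: real by (simp add: abs_if)
    then show ?thesis unfolding Rd.asymptotic_variance_def Dc.asymptotic_variance_def .
  qed
  also have "\<dots> \<le> 2 * ((L2_norm \<pi> f)\<^sup>2 / s + (L2_norm \<pi> f)\<^sup>2 / r)"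
  proof -
    have "\<bar>a - b\<bar> \<le> A + B" if "\<bar>a\<bar> \<le> A" "\<bar>b\<bar> \<le> B" for a b A B :: real
      using that by linarith
    then show ?thesis
      using Dc.autocov_suminf_bound[OF f mean] Rd.autocov_suminf_bound[OF f mean]
      unfolding diff_diff_eq2 add_diff_cancel_left' by (intro mult_left_mono) auto
  qed
  also have "\<dots> = 2 * (r + s) / (r * s) * (L2_norm \<pi> f)\<^sup>2"
    using pos by (simp add: field_simps)
  also have "\<dots> \<le> 4 / (r * s) * (L2_norm \<pi> f)\<^sup>2"
    using pos le1 by (intro mult_right_mono divide_right_mono) auto
  finally have var: "\<bar>?vY - ?vX\<bar> \<le> 4 / (r * s) * (L2_norm \<pi> f)\<^sup>2" .
  show "\<exists>var_RCW var_DCW :: real. 0 \<le> var_RCW \<and> 0 \<le> var_DCW \<and>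
       weak_conv_m (scaled_sum_law \<Omega>\<^sub>X X f) (centered_normal var_RCW) \<and>
       weak_conv_m (scaled_sum_law \<Omega>\<^sub>Y Y f) (centered_normal var_DCW) \<and>
       \<bar>var_DCW - var_RCW\<bar> \<le> 4 / (spectral_gap \<pi> ?R * spectral_gap \<pi> ?D) * (L2_norm \<pi> f)\<^sup>2"
    using var Rd.asymptotic_variance_nonneg[OF f mean] Dc.asymptotic_variance_nonneg[OF f mean]
      X.chain_central_limit_theorem[OF f mean] Y.chain_central_limit_theorem[OF f mean]
    by (auto simp: r_def s_def)
qed

end
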